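(* Let $S\in(0,\infty)$ and let $g:\mathbb{R}\times\mathbb{R}\to\mathbb{R}$ and $G:[0,S]\times\mathbb{R}\times\mathbb{R}\to\mathbb{R}$ be continuous. Assume that $G$ is in $C^{1,2,2}([0,S)\times\mathbb{R}\times\mathbb{R})$ and satisfies \[ \frac{\partial G}{\partial t}(t,x,y)+\mathcal{L}G(t,x,y)=0\qquad((t,x,y)\in[0,S)\times\mathbb{R}\times\mathbb{R}), \] \[ G(S,x,y)=g(x,y)\qquad((x,y)\in\mathbb{R}\times\mathbb{R}), \] where \[ \mathcal{L}G:=\frac{\sigma^2}{2}\frac{\partial^2G}{\partial x^2}+\sigma e^{(p+q)t}l(t)\frac{\partial^2G}{\partial x\partial y}+\frac{\{e^{(p+q)t}l(t)\}^2}{2}\frac{\partial^2G}{\partial y^2}+\left\{a-bx-p\sigma e^{-(p+q)t}y\right\}\frac{\partial G}{\partial x}-xG. \] Assume also that \[ \int_0^S E^Q\left[e^{-2\int_0^t r(s)ds}\left\{\Delta G(t,r(t),u(t))\right\}^2\right]dt<\infty,\qquad\text{where }\ \Delta G:=\sigma\frac{\partial G}{\partial x}+e^{(p+q)t}l(t)\frac{\partial G}{\partial y}. \] Then, for all $0\le t\le S$, \[ E^Q\left[e^{-\int_t^S r(s)ds}\,g(r(S),u(S))\,\middle|\,\mathcal{F}_t\right]=G(t,r(t),u(t)). \]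
   Context: Let $\{W^*(t)\}_{t\ge 0}$ be a one-dimensional standard Brownian motion on a complete probability space $(\Omega,\mathcal{F},Q)$ and let $\{\mathcal{F}_t\}_{t\ge 0}$ be the $Q$-augmentation of the filtration it generates. Let $p,q$ be real numbers with $0<q<\infty$ and $-q<p<\infty$. Define \[ l(\tau)=1-\frac{2qp}{(p+2q)^2e^{2q\tau}-p^2}\quad(\tau\ge 0), \] \[ Z(t)=W^*(t)-\int_0^t\left\{\int_0^s pe^{-(p+q)(s-\tau)}l(\tau)\,dW^*(\tau)\right\}ds\quad(t\ge 0). \] $Z$ is an It\^o process. Let $a,b,\sigma\in(0,\infty)$ and let $\{r(t)\}_{t\ge 0}$ (the short rate) be the unique strong solution of $dr(t)=\{a-br(t)\}dt+\sigma\,dZ(t)$, $t\ge 0$, with deterministic initial value $r(0)\in[0,\infty)$. $E^Q$ denotes expectation under $Q$. Further notation: $u(t):=\int_0^t e^{(p+q)s}l(s)\,dW^*(s)$ for $t\ge 0$. *)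

theory Defs
  imports "HOL-Probability.Probability"
begin

section \<open>Brownian motion and its augmented filtration\<close>

text \<open>Processes are functions of a real time parameter; only times \<open>t \<ge> 0\<close> matter.\<close>

definition events_upto :: "'a measure \<Rightarrow> (real \<Rightarrow> 'a \<Rightarrow> real) \<Rightarrow> real \<Rightarrow> 'a set set" where
  "events_upto M X t = (\<Union>s\<in>{0..t}. {X s -` B \<inter> space M | B. B \<in> sets borel})"

definition natural_filtration :: "'a measure \<Rightarrow> (real \<Rightarrow> 'a \<Rightarrow> real) \<Rightarrow> real \<Rightarrow> 'a measure" where
  "natural_filtration M X t = sigma (space M) (events_upto M X t)"

text \<open>For a complete \<open>M\<close>, \<^term>\<open>null_sets M\<close> contains all subsets of null events.\<close>

definition augmented_filtration :: "'a measure \<Rightarrow> (real \<Rightarrow> 'a \<Rightarrow> real) \<Rightarrow> real \<Rightarrow> 'a measure" where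
  "augmented_filtration M X t = sigma (space M) (events_upto M X t \<union> null_sets M)"

lemma subalgebra_augmented_filtration:
  assumes "\<And>s. 0 \<le> s \<Longrightarrow> X s \<in> borel_measurable M"
  shows "subalgebra M (augmented_filtration M X t)"
proof -
  have "events_upto M X t \<union> null_sets M \<subseteq> sets M"
    using assms by (auto simp: events_upto_def)
  moreover from this have "events_upto M X t \<union> null_sets M \<subseteq> Pow (space M)"
    using sets.space_closed by blast
  ultimately show ?thesis
    by (simp add: subalgebra_def augmented_filtration_def space_measure_of
        sets_measure_of sets.sigma_sets_subset)
qed

definition continuous_paths :: "'a measure \<Rightarrow> (real \<Rightarrow> 'a \<Rightarrow> real) \<Rightarrow> bool" where
  "continuous_paths M X \<longleftrightarrow> (AE \<omega> in M. continuous_on {0..} (\<lambda>t. X t \<omega>))"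

definition brownian_motion :: "'a measure \<Rightarrow> (real \<Rightarrow> 'a \<Rightarrow> real) \<Rightarrow> bool" where
  "brownian_motion M W \<longleftrightarrow>
     (\<forall>t\<ge>0. W t \<in> borel_measurable M) \<and>
     (AE \<omega> in M. W 0 \<omega> = 0) \<and>
     continuous_paths M W \<and>
     (\<forall>s t. 0 \<le> s \<and> s < t \<longrightarrow>
        distributed M lborel (\<lambda>\<omega>. W t \<omega> - W s \<omega>) (normal_density 0 (sqrt (t - s))) \<and>
        prob_space.indep_set M (sets (natural_filtration M W s))
          {(\<lambda>\<omega>. W t \<omega> - W s \<omega>) -` B \<inter> space M | B. B \<in> sets borel})"

section \<open>The Ito integral over a bounded interval\<close>

text \<open>The data \<open>n\<close>, \<open>\<theta>\<close>, \<open>\<xi>\<close> encode the simple process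
  \<open>\<Sum>i<n. \<xi>\<^sub>i \<one>(\<theta>\<^sub>i, \<theta>\<^sub>i\<^sub>+\<^sub>1]\<close> on \<open>[0, T]\<close>; each \<open>\<xi>\<^sub>i\<close> is bounded and known at time \<open>\<theta>\<^sub>i\<close>.\<close>

definition simple_process ::
    "'a measure \<Rightarrow> (real \<Rightarrow> 'a measure) \<Rightarrow> real \<Rightarrow> nat \<Rightarrow> (nat \<Rightarrow> real) \<Rightarrow> (nat \<Rightarrow> 'a \<Rightarrow> real) \<Rightarrow> bool" where
  "simple_process M F T n \<theta> \<xi> \<longleftrightarrow>
     (\<forall>i\<le>n. 0 \<le> \<theta> i \<and> \<theta> i \<le> T) \<and>
     (\<forall>i<n. \<theta> i \<le> \<theta> (Suc i) \<and> \<xi> i \<in> borel_measurable (F (\<theta> i)) \<and>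
        (\<exists>C. \<forall>\<omega>\<in>space M. \<bar>\<xi> i \<omega>\<bar> \<le> C))"

definition simple_value :: "nat \<Rightarrow> (nat \<Rightarrow> real) \<Rightarrow> (nat \<Rightarrow> 'a \<Rightarrow> real) \<Rightarrow> real \<Rightarrow> 'a \<Rightarrow> real" where
  "simple_value n \<theta> \<xi> s \<omega> = (\<Sum>i<n. \<xi> i \<omega> * indicator {\<theta> i<..\<theta> (Suc i)} s)"

definition simple_integral ::
    "(real \<Rightarrow> 'a \<Rightarrow> real) \<Rightarrow> nat \<Rightarrow> (nat \<Rightarrow> real) \<Rightarrow> (nat \<Rightarrow> 'a \<Rightarrow> real) \<Rightarrow> 'a \<Rightarrow> real" where
  "simple_integral W n \<theta> \<xi> \<omega> = (\<Sum>i<n. \<xi> i \<omega> * (W (\<theta> (Suc i)) \<omega> - W (\<theta> i) \<omega>))"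

text \<open>\<open>has_ito_integral M F W T H X\<close>: the random variable \<open>X\<close> is a version of the Ito integral
  \<open>\<integral>\<^sub>0\<^sup>T H(s) dW(s)\<close>, i.e. the \<open>L\<^sup>2\<close>-limit of the integrals of simple processes that converge
  to \<open>H\<close> in \<open>L\<^sup>2(ds \<otimes> M)\<close> on \<open>[0, T]\<close>.\<close>

definition has_ito_integral ::
    "'a measure \<Rightarrow> (real \<Rightarrow> 'a measure) \<Rightarrow> (real \<Rightarrow> 'a \<Rightarrow> real) \<Rightarrow> real \<Rightarrow>
     (real \<Rightarrow> 'a \<Rightarrow> real) \<Rightarrow> ('a \<Rightarrow> real) \<Rightarrow> bool" where
  "has_ito_integral M F W T H X \<longleftrightarrow>
     X \<in> borel_measurable (F T) \<and>
     (\<lambda>(s, \<omega>). H s \<omega>) \<in> borel_measurable (restrict_space borel {0..T} \<Otimes>\<^sub>M M) \<and>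
     (\<exists>n \<theta> \<xi>. (\<forall>k. simple_process M F T (n k) (\<theta> k) (\<xi> k)) \<and>
        (\<lambda>k. \<integral>\<^sup>+s\<in>{0..T}. (\<integral>\<^sup>+\<omega>. ennreal ((simple_value (n k) (\<theta> k) (\<xi> k) s \<omega> - H s \<omega>)\<^sup>2) \<partial>M)
            \<partial>lborel) \<longlonglongrightarrow> 0 \<and>
        (\<lambda>k. \<integral>\<^sup>+\<omega>. ennreal ((simple_integral W (n k) (\<theta> k) (\<xi> k) \<omega> - X \<omega>)\<^sup>2) \<partial>M) \<longlonglongrightarrow> 0)"

section \<open>The short rate\<close>

definition l_fun :: "real \<Rightarrow> real \<Rightarrow> real \<Rightarrow> real" where
  "l_fun p q \<tau> = 1 - 2 * q * p / ((p + 2 * q)\<^sup>2 * exp (2 * q * \<tau>) - p\<^sup>2)"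

text \<open>Strong solution of \<open>dr = (a - b r) dt + \<sigma> dZ\<close>, \<open>r(0) = r\<^sub>0\<close>, with \<open>F\<close> the augmented
  filtration of the driving Brownian motion. As \<open>\<sigma>\<close> is constant, \<open>\<integral>\<^sub>0\<^sup>t \<sigma> dZ = \<sigma> (Z(t) - Z(0))\<close>.\<close>

definition strong_solution ::
    "'a measure \<Rightarrow> (real \<Rightarrow> 'a measure) \<Rightarrow> (real \<Rightarrow> 'a \<Rightarrow> real) \<Rightarrow> real \<Rightarrow> real \<Rightarrow> real \<Rightarrow> real \<Rightarrow>
     (real \<Rightarrow> 'a \<Rightarrow> real) \<Rightarrow> bool" where
  "strong_solution M F Z a b \<sigma> r0 r \<longleftrightarrow>
     (\<forall>t\<ge>0. r t \<in> borel_measurable (F t)) \<and>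
     continuous_paths M r \<and>
     (AE \<omega> in M. \<forall>t\<ge>0.
        r t \<omega> = r0 + (LINT s:{0..t}|lborel. a - b * r s \<omega>) + \<sigma> * (Z t \<omega> - Z 0 \<omega>))"

section \<open>The partial differential equation\<close>

text \<open>The derivative in \<open>t\<close> is one-sided at \<open>t = 0\<close>.\<close>

definition pd_t :: "(real \<Rightarrow> real \<Rightarrow> real \<Rightarrow> real) \<Rightarrow> real \<Rightarrow> real \<Rightarrow> real \<Rightarrow> real" where
  "pd_t G t x y = vector_derivative (\<lambda>s. G s x y) (at t within {0..})"

definition pd_x :: "(real \<Rightarrow> real \<Rightarrow> real \<Rightarrow> real) \<Rightarrow> real \<Rightarrow> real \<Rightarrow> real \<Rightarrow> real" where
  "pd_x G t x y = deriv (\<lambda>v. G t v y) x"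

definition pd_y :: "(real \<Rightarrow> real \<Rightarrow> real \<Rightarrow> real) \<Rightarrow> real \<Rightarrow> real \<Rightarrow> real \<Rightarrow> real" where
  "pd_y G t x y = deriv (\<lambda>v. G t x v) y"

text \<open>Class \<open>C\<^sup>1\<^sup>,\<^sup>2\<^sup>,\<^sup>2\<close> on \<open>[0, S) \<times> \<real> \<times> \<real>\<close>: once continuously differentiable in \<open>t\<close>, twice
  (mixed derivatives included) in \<open>(x, y)\<close>. Values of \<open>G\<close> at times outside \<open>[0, S)\<close> are irrelevant.\<close>

definition C122_on :: "real \<Rightarrow> (real \<Rightarrow> real \<Rightarrow> real \<Rightarrow> real) \<Rightarrow> bool" where
  "C122_on S G \<longleftrightarrow>
     (\<forall>t\<in>{0..<S}. \<forall>x y.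
        (\<lambda>s. G s x y) differentiable (at t within {0..}) \<and>
        (\<forall>f\<in>{G, pd_x G, pd_y G}.
           (\<lambda>v. f t v y) differentiable (at x) \<and> (\<lambda>v. f t x v) differentiable (at y))) \<and>
     (\<forall>f\<in>{G, pd_t G, pd_x G, pd_y G, pd_x (pd_x G), pd_x (pd_y G), pd_y (pd_x G), pd_y (pd_y G)}.
        continuous_on ({0..<S} \<times> UNIV \<times> UNIV) (\<lambda>(t, x, y). f t x y))"

definition L_op ::
    "real \<Rightarrow> real \<Rightarrow> real \<Rightarrow> real \<Rightarrow> real \<Rightarrow> (real \<Rightarrow> real \<Rightarrow> real \<Rightarrow> real) \<Rightarrow> real \<Rightarrow> real \<Rightarrow> real \<Rightarrow> real" where
  "L_op p q a b \<sigma> G t x y =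
     \<sigma>\<^sup>2 / 2 * pd_x (pd_x G) t x y
     + \<sigma> * exp ((p + q) * t) * l_fun p q t * pd_x (pd_y G) t x y
     + (exp ((p + q) * t) * l_fun p q t)\<^sup>2 / 2 * pd_y (pd_y G) t x y
     + (a - b * x - p * \<sigma> * exp (- (p + q) * t) * y) * pd_x G t x y
     - x * G t x y"

definition Delta_op ::
    "real \<Rightarrow> real \<Rightarrow> real \<Rightarrow> (real \<Rightarrow> real \<Rightarrow> real \<Rightarrow> real) \<Rightarrow> real \<Rightarrow> real \<Rightarrow> real \<Rightarrow> real" where
  "Delta_op p q \<sigma> G t x y =
     \<sigma> * pd_x G t x y + exp ((p + q) * t) * l_fun p q t * pd_y G t x y"

end

theory Submission
  imports Defs
begin

text \<open>Let \<open>z t\<close> be the integral of the short rate over \<open>[0, t]\<close>, and let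
  \<open>V t = exp (- z t) * G t (r t) (u t)\<close> be the discounted value. The differential equation says that the drift of \<open>V\<close>
  vanishes, and its volatility \<open>exp (- z t) * \<Delta>G\<close> is square integrable by hypothesis. So \<open>V\<close> ought to be a martingale up to
  maturity, and multiplying \<open>E[V S | F t] = V t\<close> by \<open>exp (z t)\<close> gives the assertion. Two points need care: \<open>G\<close> has
  no growth bound, and its derivatives need not be controlled near maturity.

  The proof avoids stochastic integrals of random integrands and stopping times.

  Firstly, the model is a pathwise functional of the Brownian motion \<open>W\<close>. By Ito's isometry the Wiener integral \<open>u\<close>
  equals \<open>\<phi> W - \<integral> \<phi>' W\<close> (\<open>ito_integral_deterministic\<close>), \<open>Y\<close> is a deterministic multiple of \<open>u\<close>, and \<open>r - \<sigma> W\<close> is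
  differentiable in time. Hence \<open>V\<close> is a random field, differentiable in time, evaluated at \<open>W\<close>. Every path functional that occurs
  is dominated by a multiple of \<open>1 + sup \<bar>W\<bar>\<close> (\<open>path_bound\<close>), and the supremum has all exponential moments by Doob's
  inequality (\<open>running_sup_exp_moments\<close>).

  Secondly, for bounded fields \<open>F\<close> Dynkin's formula (\<open>dynkin_formula\<close>) expresses the increment of \<open>E[1\<^sub>A F(t, W t)]\<close> through the
  generator. It is applied to \<open>sin (\<delta> V + c)\<close> times a cutoff that is a function of \<open>\<epsilon> ln (1 + r\<^sup>2 + u\<^sup>2 + z\<^sup>2)\<close>. The logarithm makes
  all derivatives of the cutoff of order \<open>\<epsilon>\<close>, uniformly in the state (\<open>generator_bound\<close>), and by the differential equation only the
  curvature of the sine survives. As \<open>\<epsilon>\<close> tends to \<open>0\<close>,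
  \<open>\<bar>E[1\<^sub>A sin (\<delta> V t + c)] - E[1\<^sub>A sin (\<delta> V s + c)]\<bar> \<le> \<delta>\<^sup>2 K / 2\<close> for events \<open>A\<close> of time \<open>s \<le> t\<close>, where \<open>K\<close> is the
  integral in the hypothesis (\<open>sin_discounted_increment\<close>). Since the sine is bounded, this extends to \<open>t = S\<close>.

  Finally, letting \<open>\<delta>\<close> tend to \<open>0\<close> in the cosine version bounds the second moment of \<open>V t\<close> (\<open>discounted_L2\<close>), and in
  the sine version, divided by \<open>\<delta>\<close>, yields the martingale property (\<open>discounted_martingale\<close>).\<close>

section \<open>Brownian motion and its augmented filtration\<close>

lemma AE_null_setE:
  assumes "AE x in M. P x"
  obtains N where "\<forall>x\<in>space M - N. P x" "N \<in> null_sets M"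
  using assms by (auto elim!: AE_E3)

locale brownian = prob_space M for M :: "'a measure" +
  fixes W :: "real \<Rightarrow> 'a \<Rightarrow> real"
  assumes complete: "complete_measure M"
    and brownian: "brownian_motion M W"
begin

abbreviation Fil :: "real \<Rightarrow> 'a measure" where
  "Fil \<equiv> augmented_filtration M W"

lemma W_measurable: "0 \<le> t \<Longrightarrow> W t \<in> borel_measurable M"
  using brownian by (simp add: brownian_motion_def)

lemma W_0: "AE \<omega> in M. W 0 \<omega> = 0"
  using brownian by (simp add: brownian_motion_def)

lemma W_paths: "AE \<omega> in M. continuous_on {0..} (\<lambda>t. W t \<omega>)"
  using brownian by (simp add: brownian_motion_def continuous_paths_def)

lemma Fil_subalgebra: "subalgebra M (Fil t)"
  by (rule subalgebra_augmented_filtration) (rule W_measurable)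

lemma space_Fil [simp]: "space (Fil t) = space M"
  using Fil_subalgebra[of t] by (simp add: subalgebra_def)

lemma sets_Fil: "sets (Fil t) = sigma_sets (space M) (events_upto M W t \<union> null_sets M)"
proof -
  have "events_upto M W t \<union> null_sets M \<subseteq> Pow (space M)"
    by (auto simp: events_upto_def dest: null_setsD2 sets.sets_into_space)
  then show ?thesis
    by (simp add: augmented_filtration_def sets_measure_of)
qed

lemma sets_Fil_subset: "A \<in> sets (Fil t) \<Longrightarrow> A \<in> sets M"
  using Fil_subalgebra[of t] by (auto simp: subalgebra_def)

lemma measurable_from_Fil: "f \<in> borel_measurable (Fil t) \<Longrightarrow> f \<in> borel_measurable M"
  by (rule measurable_from_subalg[OF Fil_subalgebra])

lemma Fil_mono: "s \<le> t \<Longrightarrow> sets (Fil s) \<subseteq> sets (Fil t)"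
  unfolding sets_Fil by (rule sigma_sets_mono') (fastforce simp: events_upto_def)

lemma Fil_measurable_mono:
  assumes "f \<in> borel_measurable (Fil s)" "s \<le> t" shows "f \<in> borel_measurable (Fil t)"
  using assms Fil_mono[OF assms(2)] by (auto simp: measurable_def)

lemma W_adapted: "0 \<le> s \<Longrightarrow> s \<le> t \<Longrightarrow> W s \<in> borel_measurable (Fil t)"
proof (rule measurableI)
  fix B :: "real set" assume "0 \<le> s" "s \<le> t" "B \<in> sets borel"
  then have "W s -` B \<inter> space M \<in> events_upto M W t"
    unfolding events_upto_def by (intro UN_I[of s]) auto
  then show "W s -` B \<inter> space (Fil t) \<in> sets (Fil t)"
    by (auto simp: sets_Fil)
qed auto

lemma null_sets_in_Fil: "N \<in> null_sets M \<Longrightarrow> N \<in> sets (Fil t)"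
  by (auto simp: sets_Fil)

text \<open>Completeness makes adaptedness a property of the almost sure equivalence class.\<close>

lemma Fil_measurable_AE_eq:
  fixes f g :: "'a \<Rightarrow> real"
  assumes f: "f \<in> borel_measurable (Fil t)" and eq: "AE \<omega> in M. f \<omega> = g \<omega>"
  shows "g \<in> borel_measurable (Fil t)"
proof (rule measurableI)
  fix B :: "real set" assume B: "B \<in> sets borel"
  from eq obtain N where N: "\<And>\<omega>. \<omega> \<in> space M - N \<Longrightarrow> f \<omega> = g \<omega>" "N \<in> null_sets M"
    by (auto elim!: AE_E3)
  have "g -` B \<inter> space M \<inter> N \<in> null_sets M"
    by (rule complete_measure.complete2[OF complete _ N(2)]) blast
  then have 1: "g -` B \<inter> space M \<inter> N \<in> sets (Fil t)" by (rule null_sets_in_Fil)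
  have 2: "f -` B \<inter> space (Fil t) - N \<in> sets (Fil t)"
    using measurable_sets[OF f B] null_sets_in_Fil[OF N(2)] by auto
  have "g -` B \<inter> space (Fil t) = (f -` B \<inter> space (Fil t) - N) \<union> (g -` B \<inter> space M \<inter> N)"
    using N(1) by auto
  then show "g -` B \<inter> space (Fil t) \<in> sets (Fil t)" using 1 2 by (simp only: sets.Un)
qed auto

lemma increment_normal:
  assumes "0 \<le> s" "s < t"
  shows "distributed M lborel (\<lambda>\<omega>. W t \<omega> - W s \<omega>) (normal_density 0 (sqrt (t - s)))"
  using brownian assms by (simp add: brownian_motion_def)

lemma sets_natural_filtration:
  "sets (natural_filtration M W t) = sigma_sets (space M) (events_upto M W t)"
proof -
  have "events_upto M W t \<subseteq> Pow (space M)" by (auto simp: events_upto_def)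
  then show ?thesis by (simp add: natural_filtration_def sets_measure_of)
qed

text \<open>The sets that agree with an event of the natural filtration up to a null set form a
  \<open>\<sigma>\<close>-algebra, which contains the generators of the augmentation.\<close>

lemma Fil_natural_upto_null:
  assumes "A \<in> sets (Fil t)" "0 \<le> t"
  shows "\<exists>A'\<in>sets (natural_filtration M W t). AE \<omega> in M. \<omega> \<in> A \<longleftrightarrow> \<omega> \<in> A'"
  using assms(1) unfolding sets_Fil
proof (induction rule: sigma_sets.induct)
  case (Basic A)
  then show ?case
  proof
    assume "A \<in> events_upto M W t"
    then show ?thesis by (auto simp: sets_natural_filtration intro!: bexI[of _ A])
  next
    assume "A \<in> null_sets M"
    then have "AE \<omega> in M. \<omega> \<in> A \<longleftrightarrow> \<omega> \<in> {}" by (auto dest: AE_not_in)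
    then show ?thesis by (intro bexI[of _ "{}"]) auto
  qed
next
  case Empty
  then show ?case by (intro bexI[of _ "{}"]) auto
next
  case (Compl A)
  then obtain A' where "A' \<in> sets (natural_filtration M W t)" "AE \<omega> in M. \<omega> \<in> A \<longleftrightarrow> \<omega> \<in> A'" by auto
  then show ?case
    by (intro bexI[of _ "space M - A'"]) (auto simp: sets_natural_filtration intro: sigma_sets.Compl)
next
  case (Union A)
  then obtain A' where A': "\<And>i::nat. A' i \<in> sets (natural_filtration M W t)"
      "\<And>i. AE \<omega> in M. \<omega> \<in> A i \<longleftrightarrow> \<omega> \<in> A' i" by metis
  have "AE \<omega> in M. \<forall>i. \<omega> \<in> A i \<longleftrightarrow> \<omega> \<in> A' i" using A'(2) by (simp add: AE_all_countable)
  then have "AE \<omega> in M. \<omega> \<in> (\<Union>i. A i) \<longleftrightarrow> \<omega> \<in> (\<Union>i. A' i)" by eventually_elim auto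
  then show ?case using A'(1) by (intro bexI[of _ "\<Union>i. A' i"]) auto
qed

text \<open>The defining independence concerns the natural filtration; a null set does not change a probability,
  so it passes to the augmentation.\<close>

lemma increment_prob_past:
  assumes st: "0 \<le> s" "s < t" and A: "A \<in> sets (Fil s)" and B: "B \<in> sets borel"
  shows "prob (A \<inter> ((\<lambda>\<omega>. W t \<omega> - W s \<omega>) -` B \<inter> space M))
    = prob A * prob ((\<lambda>\<omega>. W t \<omega> - W s \<omega>) -` B \<inter> space M)"
proof -
  let ?D = "(\<lambda>\<omega>. W t \<omega> - W s \<omega>) -` B \<inter> space M"
  have ind0: "indep_set (sets (natural_filtration M W s))
      {(\<lambda>\<omega>. W t \<omega> - W s \<omega>) -` B \<inter> space M | B. B \<in> sets borel}"
    using brownian st by (simp add: brownian_motion_def)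
  obtain A' where A': "A' \<in> sets (natural_filtration M W s)" "AE \<omega> in M. \<omega> \<in> A \<longleftrightarrow> \<omega> \<in> A'"
    using Fil_natural_upto_null[OF A st(1)] by auto
  have A'M: "A' \<in> sets M"
    using A'(1) W_measurable unfolding sets_natural_filtration
    by (rule_tac sets.sigma_sets_subset[THEN subsetD, rotated]) (auto simp: events_upto_def)
  have [measurable]: "(\<lambda>\<omega>. W t \<omega> - W s \<omega>) \<in> borel_measurable M" using W_measurable st by simp
  have AM: "A \<in> sets M" and BM: "?D \<in> sets M" using A B by (auto dest: sets_Fil_subset)
  have "prob (A \<inter> ?D) = prob (A' \<inter> ?D)"
    using A'(2) AM BM A'M by (intro finite_measure_eq_AE) auto
  also have "\<dots> = prob A' * prob ?D" using B by (intro indep_setD[OF ind0 A'(1)]) auto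
  also have "prob A' = prob A" using A'(2) AM A'M by (intro finite_measure_eq_AE) auto
  finally show ?thesis .
qed

lemma increment_indep_past:
  assumes st: "0 \<le> s" "s < t" and f: "f \<in> measurable (Fil s) N"
  shows "indep_var N f borel (\<lambda>\<omega>. W t \<omega> - W s \<omega>)"
proof -
  let ?D = "\<lambda>\<omega>. W t \<omega> - W s \<omega>"
  have D: "?D \<in> borel_measurable M" using W_measurable st by simp
  have fM: "f \<in> measurable M N" by (rule measurable_from_subalg[OF Fil_subalgebra f])
  let ?\<D> = "{?D -` B \<inter> space M | B. B \<in> sets borel}"
  have D_sets: "?\<D> \<subseteq> sets M" using D by (auto intro: measurable_sets)
  have prod: "prob (A \<inter> B) = prob A * prob B" if "A \<in> sets (Fil s)" "B \<in> ?\<D>" for A B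
    using increment_prob_past[OF st] that by auto
  let ?\<F> = "{f -` A \<inter> space M | A. A \<in> sets N}"
  have F_sets: "?\<F> \<subseteq> sets (Fil s)" using measurable_sets[OF f] by auto
  then have F_sets': "?\<F> \<subseteq> sets M" using sets_Fil_subset by blast
  have "indep_set ?\<F> ?\<D>"
    unfolding indep_set_def
  proof (rule indep_setsI)
    show "\<And>i. i \<in> UNIV \<Longrightarrow> (case i of True \<Rightarrow> ?\<F> | False \<Rightarrow> ?\<D>) \<subseteq> events"
    proof -
      fix i show "(case i of True \<Rightarrow> ?\<F> | False \<Rightarrow> ?\<D>) \<subseteq> events"
        using F_sets' D_sets by (cases i) simp_all
    qed
    fix A J assume J: "J \<noteq> {}" "J \<subseteq> (UNIV::bool set)" "finite J"
      and A: "\<forall>j\<in>J. A j \<in> (case j of True \<Rightarrow> ?\<F> | False \<Rightarrow> ?\<D>)"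
    have "J \<in> Pow {True, False}" using J(2) by (auto simp: UNIV_bool)
    then have "J = {True} \<or> J = {False} \<or> J = {True, False}"
      using J(1) unfolding Pow_insert by auto
    moreover have "prob (A True \<inter> A False) = prob (A True) * prob (A False)"
      if "J = {True, False}"
    proof (rule prod)
      show "A True \<in> sets (Fil s)" using A[rule_format, of True] F_sets that by (simp add: subset_iff)
      show "A False \<in> ?\<D>" using A[rule_format, of False] that by simp
    qed
    ultimately show "prob (\<Inter>j\<in>J. A j) = (\<Prod>j\<in>J. prob (A j))"
      by (elim disjE) simp_all
  qed
  moreover have "Int_stable {X -` A \<inter> space M | A. A \<in> sets K}" for X :: "'a \<Rightarrow> 'c" and K
  proof (rule Int_stableI, clarsimp)
    fix A B assume "A \<in> sets K" "B \<in> sets K"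
    then show "\<exists>C. X -` A \<inter> space M \<inter> (X -` B \<inter> space M) = X -` C \<inter> space M \<and> C \<in> sets K"
      by (intro exI[of _ "A \<inter> B"]) auto
  qed
  ultimately have "indep_set (sigma_sets (space M) ?\<F>) (sigma_sets (space M) ?\<D>)"
    by (intro indep_set_sigma_sets)
  then show ?thesis
    unfolding indep_var_eq using fM D by auto
qed

end

section \<open>Exponential moments and independence of increments\<close>

text \<open>Completing the square: an exponential weight only shifts the mean of a centred normal density. This
  gives the exponential moments of the increments.\<close>

lemma normal_density_exp_tilt:
  assumes "0 < \<sigma>"
  shows "exp (c * x) * normal_density 0 \<sigma> x = exp (c\<^sup>2 * \<sigma>\<^sup>2 / 2) * normal_density (c * \<sigma>\<^sup>2) \<sigma> x"
proof -
  have "c * x + - x\<^sup>2 / (2 * \<sigma>\<^sup>2) = c\<^sup>2 * \<sigma>\<^sup>2 / 2 + - (x - c * \<sigma>\<^sup>2)\<^sup>2 / (2 * \<sigma>\<^sup>2)"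
    using assms by (simp add: field_simps power2_eq_square)
  then show ?thesis
    unfolding normal_density_def by (simp add: exp_add[symmetric])
qed

lemma running_max_Suc: "Max (f ` {..Suc n}) = max (f (Suc n)) (Max (f ` {..n}))" for f :: "nat \<Rightarrow> real"
  by (simp add: atMost_Suc)

text \<open>A pathwise form of Doob's \<open>L\<^sup>2\<close> maximal inequality (Acciaio, Beiglboeck, Penkner, Schachermayer,
  Temme): the sum is a discrete stochastic integral of the running maximum, whose expectation is
  nonnegative for a submartingale. When a new maximum \<open>S (Suc n)\<close> is reached, the inequality gains
  \<open>(S (Suc n) - m n)\<^sup>2 / 2\<close>; otherwise both sides grow by the same amount.\<close>

lemma running_max_square_le:
  fixes S :: "nat \<Rightarrow> real"
  defines "m \<equiv> \<lambda>n. Max (S ` {..n})"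
  shows "(m n)\<^sup>2 / 2 + (\<Sum>i<n. m i * (S (Suc i) - S i)) \<le> m n * S n"
proof (induction n)
  case 0
  show ?case by (simp add: m_def power2_eq_square)
next
  case (Suc n)
  have m: "m (Suc n) = max (S (Suc n)) (m n)" unfolding m_def by (rule running_max_Suc)
  show ?case
  proof (cases "S (Suc n) \<le> m n")
    case True
    then show ?thesis using Suc by (simp add: m max_absorb2 algebra_simps)
  next
    case False
    have "0 \<le> (S (Suc n) - m n)\<^sup>2" by simp
    then show ?thesis using Suc False by (simp add: m max_absorb1 algebra_simps power2_eq_square)
  qed
qed

context brownian
begin

lemma exp_moment_increment:
  assumes "0 \<le> s" "s < t"
  shows "integrable M (\<lambda>\<omega>. exp (c * (W t \<omega> - W s \<omega>)))"
    and "expectation (\<lambda>\<omega>. exp (c * (W t \<omega> - W s \<omega>))) = exp (c\<^sup>2 * (t - s) / 2)"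
proof -
  have *: "has_bochner_integral lborel (\<lambda>x. normal_density 0 (sqrt (t - s)) x * exp (c * x)) (exp (c\<^sup>2 * (t - s) / 2))"
  proof -
    have "has_bochner_integral lborel (\<lambda>x. exp (c\<^sup>2 * (t - s) / 2) * normal_density (c * (t - s)) (sqrt (t - s)) x)
        (exp (c\<^sup>2 * (t - s) / 2) * 1)"
      using assms by (intro has_bochner_integral_mult_right) (simp add: has_bochner_integral_iff)
    moreover have "exp (c\<^sup>2 * (t - s) / 2) * normal_density (c * (t - s)) (sqrt (t - s)) x
        = normal_density 0 (sqrt (t - s)) x * exp (c * x)" for x
      using normal_density_exp_tilt[of "sqrt (t - s)" c x] assms by (simp add: mult.commute)
    ultimately show ?thesis by simp
  qed
  note D = increment_normal[OF assms]
  show "integrable M (\<lambda>\<omega>. exp (c * (W t \<omega> - W s \<omega>)))"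
    using distributed_integrable[OF D, of "\<lambda>x. exp (c * x)"] * by (auto simp: has_bochner_integral_iff)
  show "expectation (\<lambda>\<omega>. exp (c * (W t \<omega> - W s \<omega>))) = exp (c\<^sup>2 * (t - s) / 2)"
    using distributed_integral[OF D, of "\<lambda>x. exp (c * x)"] * by (auto simp: has_bochner_integral_iff)
qed

lemma exp_moment_W:
  assumes "0 \<le> t"
  shows "integrable M (\<lambda>\<omega>. exp (c * W t \<omega>))"
    and "expectation (\<lambda>\<omega>. exp (c * W t \<omega>)) = exp (c\<^sup>2 * t / 2)"
proof -
  have [measurable]: "W t \<in> borel_measurable M" "W 0 \<in> borel_measurable M" using W_measurable assms by auto
  have "integrable M (\<lambda>\<omega>. exp (c * W t \<omega>)) \<and> expectation (\<lambda>\<omega>. exp (c * W t \<omega>)) = exp (c\<^sup>2 * t / 2)"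
  proof (cases "t = 0")
    case True
    have "AE \<omega> in M. exp (c * W t \<omega>) = 1" using W_0 by eventually_elim (simp add: True)
    then show ?thesis using True
      by (subst integrable_cong_AE[of _ M "\<lambda>_. 1"]; (subst integral_cong_AE[of _ M "\<lambda>_. 1"])?) (auto simp: prob_space)
  next
    case False
    have "AE \<omega> in M. exp (c * W t \<omega>) = exp (c * (W t \<omega> - W 0 \<omega>))" using W_0 by eventually_elim simp
    then show ?thesis using exp_moment_increment[of 0 t c] False assms
      by (subst integrable_cong_AE[of _ M "\<lambda>\<omega>. exp (c * (W t \<omega> - W 0 \<omega>))"];
          (subst integral_cong_AE[of _ M "\<lambda>\<omega>. exp (c * (W t \<omega> - W 0 \<omega>))"])?) auto
  qed
  then show "integrable M (\<lambda>\<omega>. exp (c * W t \<omega>))"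
    and "expectation (\<lambda>\<omega>. exp (c * W t \<omega>)) = exp (c\<^sup>2 * t / 2)" by auto
qed

lemma past_times_increment:
  fixes \<xi> :: "'a \<Rightarrow> real" and h :: "real \<Rightarrow> real"
  assumes "0 \<le> s" "s < t" "\<xi> \<in> borel_measurable (Fil s)" "integrable M \<xi>"
    and [measurable]: "h \<in> borel_measurable borel"
    and "integrable M (\<lambda>\<omega>. h (W t \<omega> - W s \<omega>))"
  shows "integrable M (\<lambda>\<omega>. \<xi> \<omega> * h (W t \<omega> - W s \<omega>))"
    and "expectation (\<lambda>\<omega>. \<xi> \<omega> * h (W t \<omega> - W s \<omega>)) = expectation \<xi> * expectation (\<lambda>\<omega>. h (W t \<omega> - W s \<omega>))"
proof -
  have "indep_var borel (id \<circ> \<xi>) borel (h \<circ> (\<lambda>\<omega>. W t \<omega> - W s \<omega>))"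
    by (rule indep_var_compose[OF increment_indep_past[OF assms(1-3)]]) auto
  then have ind: "indep_var borel \<xi> borel (\<lambda>\<omega>. h (W t \<omega> - W s \<omega>))" by (simp add: o_def)
  show "integrable M (\<lambda>\<omega>. \<xi> \<omega> * h (W t \<omega> - W s \<omega>))"
    by (rule indep_var_integrable[OF ind assms(4,6)])
  show "expectation (\<lambda>\<omega>. \<xi> \<omega> * h (W t \<omega> - W s \<omega>)) = expectation \<xi> * expectation (\<lambda>\<omega>. h (W t \<omega> - W s \<omega>))"
    by (rule indep_var_lebesgue_integral[OF ind assms(4,6)])
qed

text \<open>Taking expectations in the pathwise inequality for the submartingale \<open>exp (c * W)\<close> on a grid, and
  absorbing \<open>m n * S n \<le> (m n)\<^sup>2 / 4 + (S n)\<^sup>2\<close>. All exponential moments exist, so no integrability question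
  arises.\<close>

lemma doob_maximal_exp:
  fixes c :: real and \<theta> :: "nat \<Rightarrow> real"
  assumes \<theta>: "mono \<theta>" "0 \<le> \<theta> 0"
  defines "S \<equiv> \<lambda>i \<omega>. exp (c * W (\<theta> i) \<omega>)"
  defines "m \<equiv> \<lambda>n \<omega>. Max ((\<lambda>i. S i \<omega>) ` {..n})"
  shows "integrable M (\<lambda>\<omega>. (m n \<omega>)\<^sup>2)" and "expectation (\<lambda>\<omega>. (m n \<omega>)\<^sup>2) \<le> 4 * exp (2 * c\<^sup>2 * \<theta> n)"
proof -
  have \<theta>_mono: "i \<le> j \<Longrightarrow> \<theta> i \<le> \<theta> j" for i j using \<theta>(1) by (simp add: monoD)
  have \<theta>_pos: "0 \<le> \<theta> i" for i by (rule order_trans[OF \<theta>(2) \<theta>_mono[OF le0]])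
  have S_ad: "S i \<in> borel_measurable (Fil (\<theta> j))" if "i \<le> j" for i j
    using W_adapted[OF \<theta>_pos \<theta>_mono[OF that]] unfolding S_def by measurable
  have m_ad: "m i \<in> borel_measurable (Fil (\<theta> i))" for i
    unfolding m_def using S_ad by (intro borel_measurable_Max) auto
  have [measurable]: "S i \<in> borel_measurable M" "m i \<in> borel_measurable M" for i
    using S_ad[of i i] m_ad[of i] by (auto dest: measurable_from_Fil)
  have S2: "integrable M (\<lambda>\<omega>. (S i \<omega>)\<^sup>2)" "expectation (\<lambda>\<omega>. (S i \<omega>)\<^sup>2) = exp (2 * c\<^sup>2 * \<theta> i)" for i
    using exp_moment_W[OF \<theta>_pos, of "2 * c" i]
    by (simp_all add: S_def exp_double[symmetric] power_mult_distrib mult.assoc)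
  have S_pos: "0 < S i \<omega>" for i \<omega> by (simp add: S_def)
  have m_ge: "S j \<omega> \<le> m i \<omega>" if "j \<le> i" for i j \<omega> unfolding m_def using that by (intro Max_ge) auto
  have m_eq: "\<exists>j\<le>i. m i \<omega> = S j \<omega>" for i \<omega>
  proof -
    have "m i \<omega> \<in> (\<lambda>i. S i \<omega>) ` {..i}" unfolding m_def by (rule Max_in) auto
    then show ?thesis by auto
  qed
  have m_pos: "0 < m i \<omega>" for i \<omega> using m_eq[of i \<omega>] S_pos by auto
  have m2_le: "(m i \<omega>)\<^sup>2 \<le> (\<Sum>j\<le>i. (S j \<omega>)\<^sup>2)" for i \<omega>
    using m_eq[of i \<omega>] by (auto intro!: member_le_sum)
  have m2_int: "integrable M (\<lambda>\<omega>. (m i \<omega>)\<^sup>2)" for i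
    by (rule Bochner_Integration.integrable_bound[of M "\<lambda>\<omega>. \<Sum>j\<le>i. (S j \<omega>)\<^sup>2"])
      (use S2 m2_le in \<open>auto intro!: AE_I2 order_trans[OF m2_le]\<close>)
  then show "integrable M (\<lambda>\<omega>. (m n \<omega>)\<^sup>2)" .
  have mS: "integrable M (\<lambda>\<omega>. m i \<omega> * S j \<omega>)" for i j
  proof (rule Bochner_Integration.integrable_bound[of M "\<lambda>\<omega>. (m i \<omega>)\<^sup>2 + (S j \<omega>)\<^sup>2"])
    have "\<bar>m i \<omega> * S j \<omega>\<bar> \<le> \<bar>(m i \<omega>)\<^sup>2 + (S j \<omega>)\<^sup>2\<bar>" for \<omega>
    proof -
      have "2 * (m i \<omega> * S j \<omega>) \<le> (m i \<omega>)\<^sup>2 + (S j \<omega>)\<^sup>2"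
        using sum_squares_bound[of "m i \<omega>" "S j \<omega>"] by (simp add: mult.assoc)
      moreover have "0 < m i \<omega> * S j \<omega>" using m_pos[of i \<omega>] S_pos[of j \<omega>] by simp
      ultimately show ?thesis by linarith
    qed
    then show "AE \<omega> in M. norm (m i \<omega> * S j \<omega>) \<le> norm ((m i \<omega>)\<^sup>2 + (S j \<omega>)\<^sup>2)" by simp
  qed (use m2_int S2 in auto)
  have step: "0 \<le> expectation (\<lambda>\<omega>. m i \<omega> * (S (Suc i) \<omega> - S i \<omega>))" for i
  proof (cases "\<theta> i = \<theta> (Suc i)")
    case True
    then show ?thesis by (simp add: S_def)
  next
    case False
    then have lt: "\<theta> i < \<theta> (Suc i)" using \<theta>_mono[of i "Suc i"] by simp
    let ?D = "\<lambda>\<omega>. W (\<theta> (Suc i)) \<omega> - W (\<theta> i) \<omega>"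
    have [simp]: "m i \<omega> * (S (Suc i) \<omega> - S i \<omega>) = (m i \<omega> * S i \<omega>) * (exp (c * ?D \<omega>) - 1)" for \<omega>
      by (simp add: S_def algebra_simps exp_add[symmetric] mult.assoc)
    note E = exp_moment_increment[OF \<theta>_pos lt, of c]
    have "expectation (\<lambda>\<omega>. (m i \<omega> * S i \<omega>) * (exp (c * ?D \<omega>) - 1))
        = expectation (\<lambda>\<omega>. m i \<omega> * S i \<omega>) * expectation (\<lambda>\<omega>. exp (c * ?D \<omega>) - 1)"
      using E(1) S_ad[of i i] m_ad[of i] mS[of i i]
      by (intro past_times_increment(2)[OF \<theta>_pos lt, where h = "\<lambda>x. exp (c * x) - 1"]) auto
    moreover have "0 \<le> expectation (\<lambda>\<omega>. m i \<omega> * S i \<omega>)"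
      using m_pos S_pos by (intro integral_nonneg_AE AE_I2) (simp add: less_imp_le)
    moreover have "0 \<le> expectation (\<lambda>\<omega>. exp (c * ?D \<omega>) - 1)"
      using E lt by (simp add: prob_space)
    ultimately show ?thesis by simp
  qed
  have path: "(m n \<omega>)\<^sup>2 / 4 + (\<Sum>i<n. m i \<omega> * (S (Suc i) \<omega> - S i \<omega>)) \<le> (S n \<omega>)\<^sup>2" for \<omega>
  proof -
    have "0 \<le> (m n \<omega> / 2 - S n \<omega>)\<^sup>2" by simp
    then show ?thesis
      using running_max_square_le[of "\<lambda>i. S i \<omega>" n] by (simp add: m_def power2_eq_square algebra_simps)
  qed
  have i2: "integrable M (\<lambda>\<omega>. m i \<omega> * (S (Suc i) \<omega> - S i \<omega>))" for i
    using mS by (simp add: right_diff_distrib)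
  have "expectation (\<lambda>\<omega>. (m n \<omega>)\<^sup>2) / 4 + (\<Sum>i<n. expectation (\<lambda>\<omega>. m i \<omega> * (S (Suc i) \<omega> - S i \<omega>)))
      = expectation (\<lambda>\<omega>. (m n \<omega>)\<^sup>2 / 4 + (\<Sum>i<n. m i \<omega> * (S (Suc i) \<omega> - S i \<omega>)))"
    using m2_int i2 by (simp add: Bochner_Integration.integral_add Bochner_Integration.integral_sum)
  also have "\<dots> \<le> expectation (\<lambda>\<omega>. (S n \<omega>)\<^sup>2)"
    using m2_int i2 S2(1) path by (intro integral_mono) auto
  finally have "expectation (\<lambda>\<omega>. (m n \<omega>)\<^sup>2) / 4 + (\<Sum>i<n. expectation (\<lambda>\<omega>. m i \<omega> * (S (Suc i) \<omega> - S i \<omega>))) \<le> exp (2 * c\<^sup>2 * \<theta> n)"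
    by (simp add: S2)
  moreover have "0 \<le> (\<Sum>i<n. expectation (\<lambda>\<omega>. m i \<omega> * (S (Suc i) \<omega> - S i \<omega>)))"
    by (intro sum_nonneg step)
  ultimately show "expectation (\<lambda>\<omega>. (m n \<omega>)\<^sup>2) \<le> 4 * exp (2 * c\<^sup>2 * \<theta> n)" by linarith
qed

text \<open>Conditioning on the past freezes a random field that is known at time \<open>s\<close>, while the normalised
  increment is averaged with the standard normal density. The joint law of past and increment is
  a product measure, whence the formula is an instance of Fubini.\<close>

lemma expectation_freezing:
  fixes H :: "'a \<Rightarrow> real \<Rightarrow> real"
  assumes st: "0 \<le> s" "s < t"
    and H: "(\<lambda>(\<omega>, x). H \<omega> x) \<in> borel_measurable (Fil s \<Otimes>\<^sub>M borel)"
    and B: "\<And>\<omega> x. \<omega> \<in> space M \<Longrightarrow> \<bar>H \<omega> x\<bar> \<le> B"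
  shows "expectation (\<lambda>\<omega>. H \<omega> ((W t \<omega> - W s \<omega>) / sqrt (t - s)))
     = expectation (\<lambda>\<omega>. \<integral>x. std_normal_density x * H \<omega> x \<partial>lborel)"
proof -
  let ?D = "\<lambda>\<omega>. (W t \<omega> - W s \<omega>) / sqrt (t - s)"
  let ?N = "density lborel std_normal_density"
  let ?R = "distr M (Fil s) (\<lambda>\<omega>. \<omega>)"
  have D: "?D \<in> borel_measurable M" using W_measurable st by (auto intro!: borel_measurable_divide borel_measurable_diff)
  have id: "(\<lambda>\<omega>. \<omega>) \<in> measurable M (Fil s)"
    using Fil_subalgebra[of s] by (auto simp: measurable_def subalgebra_def dest: sets_Fil_subset sets.sets_into_space)
  have "distributed M lborel (\<lambda>\<omega>. ((W t \<omega> - W s \<omega>) - 0) / sqrt (t - s)) std_normal_density"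
    using increment_normal[OF st] st by (subst normal_standard_normal_convert[symmetric]) auto
  then have "distr M lborel ?D = ?N" by (simp add: distributed_def)
  moreover have "distr M lborel ?D = distr M borel ?D" by (rule distr_cong) auto
  ultimately have N: "distr M borel ?D = ?N" by simp
  interpret R: prob_space ?R by (rule prob_space_distr[OF id])
  interpret N: prob_space ?N by (rule prob_space_normal_density) simp
  have joint: "?R \<Otimes>\<^sub>M ?N = distr M (Fil s \<Otimes>\<^sub>M borel) (\<lambda>\<omega>. (\<omega>, ?D \<omega>))"
  proof (rule pair_measure_eqI)
    show "sigma_finite_measure ?R" "sigma_finite_measure ?N" by unfold_locales
    show "sets (?R \<Otimes>\<^sub>M ?N) = sets (distr M (Fil s \<Otimes>\<^sub>M borel) (\<lambda>\<omega>. (\<omega>, ?D \<omega>)))"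
      by (simp cong: sets_pair_measure_cong)
    fix A B assume AB: "A \<in> sets ?R" "B \<in> sets ?N"
    then have A: "A \<in> sets (Fil s)" and B: "B \<in> sets borel" by simp_all
    let ?B = "(\<lambda>x. x / sqrt (t - s)) -` B"
    have "?B \<in> sets borel" using B by (rule measurable_sets_borel[rotated]) simp
    have A_sub: "A \<subseteq> space M" using A by (metis sets.sets_into_space space_Fil)
    have "emeasure ?R A = prob A"
      using A id A_sub by (subst emeasure_distr) (auto simp: emeasure_eq_measure intro!: arg_cong[where f = prob])
    moreover have "emeasure ?N B = prob ((\<lambda>\<omega>. W t \<omega> - W s \<omega>) -` ?B \<inter> space M)"
      using B D unfolding N[symmetric]
      by (subst emeasure_distr) (auto simp: emeasure_eq_measure vimage_def)
    moreover have "emeasure (distr M (Fil s \<Otimes>\<^sub>M borel) (\<lambda>\<omega>. (\<omega>, ?D \<omega>))) (A \<times> B)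
        = prob (A \<inter> ((\<lambda>\<omega>. W t \<omega> - W s \<omega>) -` ?B \<inter> space M))"
      using A B D id by (subst emeasure_distr)
        (auto simp: emeasure_eq_measure vimage_def intro!: arg_cong[where f = prob])
    ultimately show "emeasure ?R A * emeasure ?N B
        = emeasure (distr M (Fil s \<Otimes>\<^sub>M borel) (\<lambda>\<omega>. (\<omega>, ?D \<omega>))) (A \<times> B)"
      using increment_prob_past[OF st A \<open>?B \<in> sets borel\<close>] by (simp add: ennreal_mult)
  qed
  interpret RN: pair_sigma_finite ?R ?N ..
  interpret RN: pair_prob_space ?R ?N ..
  have H': "(\<lambda>(\<omega>, x). H \<omega> x) \<in> borel_measurable (?R \<Otimes>\<^sub>M ?N)"
    using H by (simp cong: measurable_cong_sets)
  have sR: "space ?R = space M" by simp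
  have int: "integrable (?R \<Otimes>\<^sub>M ?N) (\<lambda>(\<omega>, x). H \<omega> x)"
    by (rule RN.P.integrable_const_bound[where B = B]) (use B H' in \<open>auto intro!: AE_I2 simp: space_pair_measure\<close>)
  have "expectation (\<lambda>\<omega>. H \<omega> (?D \<omega>)) = (\<integral>z. (\<lambda>(\<omega>, x). H \<omega> x) z \<partial>distr M (Fil s \<Otimes>\<^sub>M borel) (\<lambda>\<omega>. (\<omega>, ?D \<omega>)))"
    using H id D by (subst integral_distr) auto
  also have "\<dots> = (\<integral>\<omega>. \<integral>x. H \<omega> x \<partial>?N \<partial>?R)"
    unfolding joint[symmetric] using RN.integral_fst'[OF int] by simp
  also have "\<dots> = expectation (\<lambda>\<omega>. \<integral>x. H \<omega> x \<partial>?N)"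
    using H' by (subst integral_distr[OF id]) (auto intro!: N.borel_measurable_lebesgue_integral simp: split_def cong: measurable_cong_sets)
  also have "\<dots> = expectation (\<lambda>\<omega>. \<integral>x. std_normal_density x * H \<omega> x \<partial>lborel)"
  proof (rule Bochner_Integration.integral_cong[OF refl])
    fix \<omega> assume w: "\<omega> \<in> space M"
    have "(\<lambda>x. H \<omega> x) \<in> borel_measurable borel"
      using measurable_Pair2[OF H, of \<omega>] w by (simp)
    then show "(\<integral>x. H \<omega> x \<partial>?N) = (\<integral>x. std_normal_density x * H \<omega> x \<partial>lborel)"
      by (subst integral_density) auto
  qed
  finally show ?thesis .
qed

end

section \<open>Exponential moments of the running supremum\<close>

context brownian
begin

text \<open>On the dyadic grids of \<open>[0, T]\<close> the grid maxima of \<open>\<bar>W\<bar>\<close> increase to the running supremum, because paths are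
  continuous. Doob's inequality bounds their exponential moments uniformly, and Fatou's lemma
  carries the bound to the limit. The random variable \<open>\<Lambda>\<close> dominates every path functional used
  below.\<close>

lemma running_sup_exp_moments_pos:
  assumes T: "0 < T"
  shows "\<exists>\<Lambda>\<in>borel_measurable M. (AE \<omega> in M. \<forall>t\<in>{0..T}. \<bar>W t \<omega>\<bar> \<le> \<Lambda> \<omega>)
    \<and> (\<forall>c\<ge>0. integrable M (\<lambda>\<omega>. exp (c * \<Lambda> \<omega>)))"
proof -
  define d where "d k j = T * real j / 2 ^ k" for k j :: nat
  define L where "L k \<omega> = Max ((\<lambda>j. \<bar>W (d k j) \<omega>\<bar>) ` {..(2::nat) ^ k})" for k :: nat and \<omega>
  have d_pos: "0 \<le> d k j" for k j using T by (simp add: d_def)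
  have d_le: "d k j \<le> T" if "j \<le> 2 ^ k" for k j
  proof -
    have "real j \<le> 2 ^ k" using that by (metis of_nat_le_iff of_nat_numeral of_nat_power)
    then show ?thesis using T by (simp add: d_def divide_le_eq)
  qed
  have [measurable]: "W (d k j) \<in> borel_measurable M" for k j by (rule W_measurable[OF d_pos])
  have [measurable]: "L k \<in> borel_measurable M" for k
    unfolding L_def by (intro borel_measurable_Max) auto
  have d_Suc: "d k j = d (Suc k) (2 * j)" for k j by (simp add: d_def)
  have L_mono: "L k \<omega> \<le> L (Suc k) \<omega>" for k \<omega>
    unfolding L_def
  proof (rule Max_mono)
    have "\<bar>W (d k j) \<omega>\<bar> \<in> (\<lambda>j. \<bar>W (d (Suc k) j) \<omega>\<bar>) ` {..2 ^ Suc k}" if "j \<le> 2 ^ k" for j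
      unfolding d_Suc[of k j] using that by (intro imageI) simp
    then show "(\<lambda>j. \<bar>W (d k j) \<omega>\<bar>) ` {..2 ^ k} \<subseteq> (\<lambda>j. \<bar>W (d (Suc k) j) \<omega>\<bar>) ` {..2 ^ Suc k}" by auto
  qed auto
  define \<Lambda> where "\<Lambda> \<omega> = lim (\<lambda>k. L k \<omega>)" for \<omega>
  have [measurable]: "\<Lambda> \<in> borel_measurable M" unfolding \<Lambda>_def by measurable
  have good: "(\<lambda>k. L k \<omega>) \<longlonglongrightarrow> \<Lambda> \<omega> \<and> (\<forall>t\<in>{0..T}. \<bar>W t \<omega>\<bar> \<le> \<Lambda> \<omega>)"
    if c: "continuous_on {0..} (\<lambda>t. W t \<omega>)" for \<omega>
  proof -
    have cT: "continuous_on {0..T} (\<lambda>t. W t \<omega>)" by (rule continuous_on_subset[OF c]) auto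
    then have "bounded ((\<lambda>t. W t \<omega>) ` {0..T})"
      by (intro compact_imp_bounded compact_continuous_image) auto
    then obtain K where "\<forall>x\<in>(\<lambda>t. W t \<omega>) ` {0..T}. norm x \<le> K" unfolding bounded_iff by (rule exE)
    then have K: "\<bar>W t \<omega>\<bar> \<le> K" if "t \<in> {0..T}" for t using that by simp
    have "L k \<omega> \<le> K" for k
      unfolding L_def using d_pos d_le by (intro Max.boundedI) (auto intro!: K)
    moreover have inc: "incseq (\<lambda>k. L k \<omega>)" using L_mono by (rule incseq_SucI)
    ultimately obtain l where l: "(\<lambda>k. L k \<omega>) \<longlonglongrightarrow> l" using incseq_convergent by blast
    then have lim: "(\<lambda>k. L k \<omega>) \<longlonglongrightarrow> \<Lambda> \<omega>" using limI[OF l] by (simp add: \<Lambda>_def)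
    have "\<bar>W t \<omega>\<bar> \<le> \<Lambda> \<omega>" if t: "t \<in> {0..T}" for t
    proof -
      define j where "j k = nat \<lfloor>t * 2 ^ k / T\<rfloor>" for k :: nat
      have j1: "real (j k) \<le> t * 2 ^ k / T" and j2: "t * 2 ^ k / T - 1 \<le> real (j k)" for k
        using t T by (auto simp: j_def)
      have "j k \<le> 2 ^ k" for k
      proof -
        have "real (j k) \<le> t * 2 ^ k / T" by (rule j1)
        also have "\<dots> \<le> T * 2 ^ k / T" using t T by (intro divide_right_mono mult_right_mono) auto
        finally have "real (j k) \<le> 2 ^ k" using T by simp
        then show ?thesis by (metis of_nat_le_iff of_nat_numeral of_nat_power)
      qed
      then have bd: "\<bar>W (d k (j k)) \<omega>\<bar> \<le> \<Lambda> \<omega>" for k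
        using incseq_le[OF inc lim, of k] by (auto simp: L_def intro!: order_trans[OF Max_ge])
      have lo: "t - T * (1 / 2) ^ k \<le> d k (j k)" and hi: "d k (j k) \<le> t" for k
      proof -
        have "T / 2 ^ k * (t * 2 ^ k / T - 1) \<le> T / 2 ^ k * real (j k)"
          "T / 2 ^ k * real (j k) \<le> T / 2 ^ k * (t * 2 ^ k / T)"
          using j1 j2 T by (intro mult_left_mono; simp)+
        then show "t - T * (1 / 2) ^ k \<le> d k (j k)" "d k (j k) \<le> t"
          using T by (simp_all add: d_def power_one_over right_diff_distrib)
      qed
      have "(\<lambda>k. t - T * (1 / 2) ^ k) \<longlonglongrightarrow> t - T * 0"
        by (intro tendsto_intros LIMSEQ_power_zero) simp
      then have tend: "(\<lambda>k. t - T * (1 / 2) ^ k) \<longlonglongrightarrow> t" by simp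
      have "(\<lambda>k. d k (j k)) \<longlonglongrightarrow> t"
      proof (rule tendsto_sandwich[OF _ _ tend tendsto_const])
        show "\<forall>\<^sub>F k in sequentially. t - T * (1 / 2) ^ k \<le> d k (j k)" by (intro always_eventually allI lo)
        show "\<forall>\<^sub>F k in sequentially. d k (j k) \<le> t" by (intro always_eventually allI hi)
      qed
      then have "(\<lambda>k. W (d k (j k)) \<omega>) \<longlonglongrightarrow> W t \<omega>"
        using d_pos t by (intro continuous_on_tendsto_compose[OF c]) auto
      then have "(\<lambda>k. \<bar>W (d k (j k)) \<omega>\<bar>) \<longlonglongrightarrow> \<bar>W t \<omega>\<bar>" by (rule tendsto_rabs)
      then show ?thesis by (rule LIMSEQ_le_const2) (use bd in auto)
    qed
    with lim show ?thesis by auto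
  qed
  have exp_L: "(\<integral>\<^sup>+\<omega>. ennreal (exp (c * L k \<omega>)) \<partial>M) \<le> ennreal (8 * exp (c\<^sup>2 * T / 2))" if "0 \<le> c" for c k
  proof -
    define m where "m \<epsilon> \<omega> = Max ((\<lambda>i. exp (\<epsilon> * (c / 2) * W (d k (min i (2 ^ k))) \<omega>)) ` {..2 ^ k})" for \<epsilon> :: real and \<omega>
    have mono: "mono (\<lambda>i. d k (min i (2 ^ k)))" using T by (auto simp: mono_def d_def intro!: divide_right_mono)
    have pow: "real (2 ^ k) / 2 ^ k = 1" by simp
    have dT: "d k (min (2 ^ k) (2 ^ k)) = T" by (simp add: d_def)
    have m: "integrable M (\<lambda>\<omega>. (m \<epsilon> \<omega>)\<^sup>2)" "expectation (\<lambda>\<omega>. (m \<epsilon> \<omega>)\<^sup>2) \<le> 4 * exp (c\<^sup>2 * T / 2)"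
      if "\<epsilon> = 1 \<or> \<epsilon> = - 1" for \<epsilon>
    proof -
      have "2 * (\<epsilon> * (c / 2))\<^sup>2 * T = c\<^sup>2 * T / 2"
        using that by (elim disjE) (simp_all add: power2_eq_square)
      note D = doob_maximal_exp[OF mono d_pos, of "\<epsilon> * (c / 2)" "2 ^ k", unfolded dT this, folded m_def]
      show "integrable M (\<lambda>\<omega>. (m \<epsilon> \<omega>)\<^sup>2)" "expectation (\<lambda>\<omega>. (m \<epsilon> \<omega>)\<^sup>2) \<le> 4 * exp (c\<^sup>2 * T / 2)"
        by (rule D)+
    qed
    have "exp (c * L k \<omega>) \<le> (m 1 \<omega>)\<^sup>2 + (m (- 1) \<omega>)\<^sup>2" for \<omega>
    proof -
      have "L k \<omega> \<in> (\<lambda>j. \<bar>W (d k j) \<omega>\<bar>) ` {..2 ^ k}" unfolding L_def by (rule Max_in) auto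
      then obtain j where j: "j \<le> 2 ^ k" "L k \<omega> = \<bar>W (d k j) \<omega>\<bar>" by auto
      have le: "exp (\<epsilon> * (c / 2) * W (d k j) \<omega>) \<le> m \<epsilon> \<omega>" for \<epsilon>
        unfolding m_def using j(1) by (intro Max_ge) (auto intro!: image_eqI[of _ _ j] simp: min_absorb1)
      have sq: "exp (\<epsilon> * c * W (d k j) \<omega>) \<le> (m \<epsilon> \<omega>)\<^sup>2" for \<epsilon>
      proof -
        have "exp (\<epsilon> * c * W (d k j) \<omega>) = (exp (\<epsilon> * (c / 2) * W (d k j) \<omega>))\<^sup>2"
          by (simp add: exp_double[symmetric])
        also have "\<dots> \<le> (m \<epsilon> \<omega>)\<^sup>2" by (intro power_mono le) simp
        finally show ?thesis .
      qed
      show ?thesis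
      proof (cases "0 \<le> W (d k j) \<omega>")
        case True
        then show ?thesis using sq[of 1] j(2) by (simp add: add_increasing2)
      next
        case False
        then show ?thesis using sq[of "- 1"] j(2) by (simp add: add_increasing)
      qed
    qed
    then have "(\<integral>\<^sup>+\<omega>. ennreal (exp (c * L k \<omega>)) \<partial>M) \<le> (\<integral>\<^sup>+\<omega>. ennreal ((m 1 \<omega>)\<^sup>2 + (m (- 1) \<omega>)\<^sup>2) \<partial>M)"
      by (intro nn_integral_mono ennreal_leI)
    also have "\<dots> = ennreal (expectation (\<lambda>\<omega>. (m 1 \<omega>)\<^sup>2 + (m (- 1) \<omega>)\<^sup>2))"
      using m by (intro nn_integral_eq_integral) auto
    also have "\<dots> \<le> ennreal (8 * exp (c\<^sup>2 * T / 2))"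
      using m[of 1] m[of "-1"] by (intro ennreal_leI) simp
    finally show ?thesis .
  qed
  have "integrable M (\<lambda>\<omega>. exp (c * \<Lambda> \<omega>))" if c: "0 \<le> c" for c
  proof (rule integrableI_bounded)
    have "(\<integral>\<^sup>+\<omega>. ennreal (norm (exp (c * \<Lambda> \<omega>))) \<partial>M) = (\<integral>\<^sup>+\<omega>. liminf (\<lambda>k. ennreal (exp (c * L k \<omega>))) \<partial>M)"
    proof (rule nn_integral_cong_AE)
      show "AE \<omega> in M. ennreal (norm (exp (c * \<Lambda> \<omega>))) = liminf (\<lambda>k. ennreal (exp (c * L k \<omega>)))"
        using W_paths
      proof eventually_elim
        case (elim \<omega>)
        then have "(\<lambda>k. ennreal (exp (c * L k \<omega>))) \<longlonglongrightarrow> ennreal (exp (c * \<Lambda> \<omega>))"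
          using good[OF elim] by (intro tendsto_intros tendsto_ennrealI) auto
        from lim_imp_Liminf[OF _ this] show ?case by simp
      qed
    qed
    also have "\<dots> \<le> liminf (\<lambda>k. \<integral>\<^sup>+\<omega>. ennreal (exp (c * L k \<omega>)) \<partial>M)"
      by (intro nn_integral_liminf) measurable
    also have "\<dots> \<le> liminf (\<lambda>k::nat. ennreal (8 * exp (c\<^sup>2 * T / 2)))"
      by (intro Liminf_mono always_eventually allI exp_L c)
    also have "\<dots> < \<infinity>" by (simp add: Liminf_const)
    finally show "(\<integral>\<^sup>+\<omega>. ennreal (norm (exp (c * \<Lambda> \<omega>))) \<partial>M) < \<infinity>" .
  qed measurable
  moreover have "AE \<omega> in M. \<forall>t\<in>{0..T}. \<bar>W t \<omega>\<bar> \<le> \<Lambda> \<omega>"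
    using W_paths by eventually_elim (use good in blast)
  ultimately show ?thesis by (intro bexI[of _ \<Lambda>] conjI allI impI) auto
qed

lemma running_sup_exp_moments:
  obtains \<Lambda> where "\<Lambda> \<in> borel_measurable M" "AE \<omega> in M. \<forall>t\<in>{0..T}. \<bar>W t \<omega>\<bar> \<le> \<Lambda> \<omega>"
    "\<forall>c\<ge>0. integrable M (\<lambda>\<omega>. exp (c * \<Lambda> \<omega>))"
proof -
  have "0 < max T 1" by simp
  from running_sup_exp_moments_pos[OF this]
  obtain \<Lambda> where \<Lambda>: "\<Lambda> \<in> borel_measurable M" "AE \<omega> in M. \<forall>t\<in>{0..max T 1}. \<bar>W t \<omega>\<bar> \<le> \<Lambda> \<omega>"
    "\<forall>c\<ge>0. integrable M (\<lambda>\<omega>. exp (c * \<Lambda> \<omega>))" by (elim bexE conjE)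
  have "AE \<omega> in M. \<forall>t\<in>{0..T}. \<bar>W t \<omega>\<bar> \<le> \<Lambda> \<omega>" using \<Lambda>(2) by eventually_elim auto
  with \<Lambda> that show ?thesis by blast
qed

end

section \<open>Measurability of continuous processes\<close>

text \<open>A continuous process is the limit of its values at the grid points \<open>\<lfloor>s k\<rfloor> / k\<close>, and these depend on \<open>s\<close>
  through a countable variable only. Time is clamped to \<open>[0, t]\<close> so that only values known by time
  \<open>t\<close> enter.\<close>

lemma continuous_process_measurable_pair:
  fixes X :: "real \<Rightarrow> 'a \<Rightarrow> real"
  assumes X: "\<And>s. 0 \<le> s \<Longrightarrow> s \<le> t \<Longrightarrow> X s \<in> borel_measurable N"
    and cont: "\<And>\<omega>. \<omega> \<in> space N \<Longrightarrow> continuous_on {0..t} (\<lambda>s. X s \<omega>)" and t: "0 \<le> t"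
  shows "(\<lambda>(\<omega>, s). X (max 0 (min t s)) \<omega>) \<in> borel_measurable (N \<Otimes>\<^sub>M borel)"
proof (rule borel_measurable_LIMSEQ_real)
  let ?c = "\<lambda>s. max 0 (min t s)"
  let ?g = "\<lambda>k s. real_of_int \<lfloor>s * real (Suc k)\<rfloor> / real (Suc k)"
  show "(\<lambda>k. (\<lambda>(\<omega>, s). X (?c (?g k s)) \<omega>) z) \<longlonglongrightarrow> (\<lambda>(\<omega>, s). X (?c s) \<omega>) z"
    if "z \<in> space (N \<Otimes>\<^sub>M borel)" for z
  proof -
    obtain \<omega> s where z1: "z = (\<omega>, s)" by (cases z)
    with that have z: "z = (\<omega>, s)" "\<omega> \<in> space N" by (simp_all add: space_pair_measure)
    have "\<bar>?g k s - s\<bar> \<le> inverse (real (Suc k))" for k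
    proof -
      have "\<bar>real_of_int \<lfloor>s * real (Suc k)\<rfloor> - s * real (Suc k)\<bar> \<le> 1" by linarith
      then have "\<bar>real_of_int \<lfloor>s * real (Suc k)\<rfloor> - s * real (Suc k)\<bar> / real (Suc k) \<le> 1 / real (Suc k)"
        by (intro divide_right_mono) auto
      also have "\<bar>real_of_int \<lfloor>s * real (Suc k)\<rfloor> - s * real (Suc k)\<bar> / real (Suc k) = \<bar>?g k s - s\<bar>"
        by (simp add: field_simps abs_if del: of_nat_Suc)
      finally show ?thesis by (simp add: inverse_eq_divide)
    qed
    then have "(\<lambda>k. ?g k s) \<longlonglongrightarrow> s"
      by (intro LIM_zero_cancel[of "\<lambda>k. ?g k s"] Lim_null_comparison[OF _ LIMSEQ_inverse_real_of_nat]) auto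
    then have "(\<lambda>k. ?c (?g k s)) \<longlonglongrightarrow> ?c s" by (intro tendsto_intros)
    then have "(\<lambda>k. X (?c (?g k s)) \<omega>) \<longlonglongrightarrow> X (?c s) \<omega>"
      by (intro continuous_on_tendsto_compose[OF cont[OF z(2)]]) (use t in auto)
    then show ?thesis by (simp add: z)
  qed
  fix k :: nat
  let ?f = "\<lambda>i z. X (?c (real_of_int i / real (Suc k))) (fst z)"
  have "(\<lambda>z. ?f \<lfloor>snd z * real (Suc k)\<rfloor> z) \<in> borel_measurable (N \<Otimes>\<^sub>M borel)"
  proof (rule measurable_compose_countable[where f = ?f])
    show "?f i \<in> borel_measurable (N \<Otimes>\<^sub>M borel)" for i
      by (rule measurable_compose[OF measurable_fst X]) (use t in auto)
  qed measurable
  then show "(\<lambda>(\<omega>, s). X (?c (?g k s)) \<omega>) \<in> borel_measurable (N \<Otimes>\<^sub>M borel)" by (simp add: split_def)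
qed

section \<open>Dynkin's formula for random fields\<close>

context brownian
begin

text \<open>Let \<open>F t \<omega> w\<close> be a random field, known at time \<open>t\<close>, with bounded values and bounded second derivative in \<open>w\<close>, whose
  time derivative along the path has an integrable majorant. Dynkin's formula says that
  \<open>E[1\<^sub>A F(t, W t)]\<close> has the derivative \<open>E[1\<^sub>A (Ft + Fww / 2)(t, W t)]\<close> after time \<open>s\<close> for each event \<open>A\<close> of
  time \<open>s\<close>. No stochastic integral is needed: the derivative is computed directly by dominated
  convergence.\<close>

context
  fixes F Ft Fw Fww :: "real \<Rightarrow> 'a \<Rightarrow> real \<Rightarrow> real"
    and s T B :: real and D :: "'a \<Rightarrow> real"
  assumes s: "0 \<le> s"
    and F_meas: "\<And>t. t \<in> {s..T} \<Longrightarrow> (\<lambda>(\<omega>, w). F t \<omega> w) \<in> borel_measurable (Fil t \<Otimes>\<^sub>M borel)"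
    and lim_meas: "\<And>t. t \<in> {s..T} \<Longrightarrow> (\<lambda>\<omega>. Ft t \<omega> (W t \<omega>)) \<in> borel_measurable M"
      "\<And>t. t \<in> {s..T} \<Longrightarrow> (\<lambda>\<omega>. Fww t \<omega> (W t \<omega>)) \<in> borel_measurable M"
    and bounds: "\<And>t \<omega> w. t \<in> {s..T} \<Longrightarrow> \<omega> \<in> space M \<Longrightarrow> \<bar>F t \<omega> w\<bar> \<le> B"
      "\<And>t \<omega> w. t \<in> {s..T} \<Longrightarrow> \<omega> \<in> space M \<Longrightarrow> \<bar>Fww t \<omega> w\<bar> \<le> B"
    and deriv: "AE \<omega> in M. \<forall>t\<in>{s..T}. \<forall>w.
        ((\<lambda>t. F t \<omega> w) has_real_derivative Ft t \<omega> w) (at t within {s..T}) \<and>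
        (F t \<omega> has_real_derivative Fw t \<omega> w) (at w) \<and>
        (Fw t \<omega> has_real_derivative Fww t \<omega> w) (at w)"
    and cont: "AE \<omega> in M. continuous_on ({s..T} \<times> UNIV) (\<lambda>(t, w). Ft t \<omega> w)"
      "AE \<omega> in M. continuous_on ({s..T} \<times> UNIV) (\<lambda>(t, w). Fww t \<omega> w)"
    and dom: "AE \<omega> in M. \<forall>t\<in>{s..T}. \<forall>t'\<in>{s..T}. \<bar>Ft t \<omega> (W t' \<omega>)\<bar> \<le> D \<omega>" "integrable M D"
begin

text \<open>The increment over \<open>[lo, hi]\<close> is split into a change of time at fixed position \<open>W hi\<close>, which the mean
  value theorem turns into \<open>Ft\<close>, and a change of position at the fixed time \<open>lo\<close>. In the latter the field is frozen, so that
  the increment of \<open>W\<close> may be replaced by \<open>sqrt h * x\<close> with a standard normal \<open>x\<close>. The first-order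
  Taylor term then integrates to \<open>0\<close>, and the second-order term to \<open>h / 2\<close> times a value of \<open>Fww\<close> near \<open>W t\<close>. Two
  moving end points are used so that left and right derivatives come from one statement.\<close>

lemma dynkin_difference_quotient:
  assumes A: "A \<in> sets (Fil s)"
    and t: "t \<in> {s..T}" and lo: "\<And>k::nat. lo k \<in> {s..T}" "lo \<longlonglongrightarrow> t"
    and hi: "\<And>k. hi k \<in> {s..T}" "hi \<longlonglongrightarrow> t" and lo_hi: "\<And>k. lo k < hi k"
  defines "m \<equiv> \<lambda>t. expectation (\<lambda>\<omega>. indicator A \<omega> * F t \<omega> (W t \<omega>))"
  shows "(\<lambda>k. (m (hi k) - m (lo k)) / (hi k - lo k))
    \<longlonglongrightarrow> expectation (\<lambda>\<omega>. indicator A \<omega> * (Ft t \<omega> (W t \<omega>) + Fww t \<omega> (W t \<omega>) / 2))"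
proof -
  have pos: "0 \<le> r" if "r \<in> {s..T}" for r using that s by auto
  have [measurable]: "W r \<in> borel_measurable M" if "r \<in> {s..T}" for r using W_measurable pos that by auto
  have A_M [measurable]: "A \<in> sets M" by (rule sets_Fil_subset[OF A])
  have A_Fil: "A \<in> sets (Fil r)" if "r \<in> {s..T}" for r using A Fil_mono[of s r] that by auto
  have id: "(\<lambda>\<omega>. \<omega>) \<in> measurable M (Fil r)" for r
    by (rule measurable_from_subalg[OF Fil_subalgebra[of r]]) simp
  have F_comp: "(\<lambda>\<omega>. F r \<omega> (W r' \<omega>)) \<in> borel_measurable M" if "r \<in> {s..T}" "r' \<in> {s..T}" for r r'
  proof -
    have "(\<lambda>\<omega>. (\<omega>, W r' \<omega>)) \<in> measurable M (Fil r \<Otimes>\<^sub>M borel)"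
      using id W_measurable[OF pos[OF that(2)]] by (intro measurable_Pair) auto
    from measurable_compose[OF this F_meas[OF that(1)]] show ?thesis by simp
  qed
  have F_int: "integrable M (\<lambda>\<omega>. indicator A \<omega> * F r \<omega> (W r' \<omega>))" if "r \<in> {s..T}" "r' \<in> {s..T}" for r r'
    using F_comp[OF that] bounds(1)[OF that(1)] A_M
    by (intro integrable_const_bound[where B = "\<bar>B\<bar>"] AE_I2)
      (auto simp: indicator_def intro: order_trans[OF _ abs_ge_self])
  define time_part where "time_part k \<omega> = indicator A \<omega> * ((F (hi k) \<omega> (W (hi k) \<omega>) - F (lo k) \<omega> (W (hi k) \<omega>)) / (hi k - lo k))" for k \<omega>
  define h where "h k = hi k - lo k" for k
  have h_pos: "0 < h k" for k using lo_hi by (simp add: h_def)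
  \<comment> \<open>the increment in space, divided by the length of the time interval\<close>
  define rem where "rem k \<omega> x = (F (lo k) \<omega> (W (lo k) \<omega> + sqrt (h k) * x) - F (lo k) \<omega> (W (lo k) \<omega>)) / h k" for k \<omega> x
  define space_part where "space_part k \<omega> = indicator A \<omega> * (\<integral>x. std_normal_density x * rem k \<omega> x \<partial>lborel)" for k \<omega>
  have freeze: "expectation (\<lambda>\<omega>. indicator A \<omega> * (F (lo k) \<omega> (W (hi k) \<omega>) - F (lo k) \<omega> (W (lo k) \<omega>))) / h k
      = expectation (space_part k)" for k
  proof -
    have meas: "(\<lambda>(\<omega>, x). indicator A \<omega> * rem k \<omega> x) \<in> borel_measurable (Fil (lo k) \<Otimes>\<^sub>M borel)"
    proof -
      have [measurable]: "W (lo k) \<in> borel_measurable (Fil (lo k))"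
        using W_adapted[OF pos[OF lo(1)] order_refl] .
      have [measurable]: "A \<in> sets (Fil (lo k))" by (rule A_Fil[OF lo(1)])
      have p1: "(\<lambda>(\<omega>, x). (\<omega>, W (lo k) \<omega> + sqrt (h k) * x)) \<in> measurable (Fil (lo k) \<Otimes>\<^sub>M borel) (Fil (lo k) \<Otimes>\<^sub>M borel)"
        and p2: "(\<lambda>(\<omega>, x). (\<omega>, W (lo k) \<omega>)) \<in> measurable (Fil (lo k) \<Otimes>\<^sub>M (borel :: real measure)) (Fil (lo k) \<Otimes>\<^sub>M borel)"
        by measurable
      have [measurable]: "(\<lambda>(\<omega>, x). F (lo k) \<omega> (W (lo k) \<omega> + sqrt (h k) * x)) \<in> borel_measurable (Fil (lo k) \<Otimes>\<^sub>M borel)"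
        "(\<lambda>(\<omega>, x::real). F (lo k) \<omega> (W (lo k) \<omega>)) \<in> borel_measurable (Fil (lo k) \<Otimes>\<^sub>M borel)"
        using measurable_compose[OF p1 F_meas[OF lo(1)]] measurable_compose[OF p2 F_meas[OF lo(1)]]
        by (simp_all add: split_def)
      show ?thesis unfolding rem_def split_def by (measurable; simp add: split_def[symmetric])
    qed
    have "expectation (\<lambda>\<omega>. indicator A \<omega> * (F (lo k) \<omega> (W (hi k) \<omega>) - F (lo k) \<omega> (W (lo k) \<omega>))) / h k
        = expectation (\<lambda>\<omega>. indicator A \<omega> * rem k \<omega> ((W (hi k) \<omega> - W (lo k) \<omega>) / sqrt (hi k - lo k)))"
      using h_pos[of k] by (simp add: rem_def h_def flip: Bochner_Integration.integral_divide_zero)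
    also have "\<dots> = expectation (\<lambda>\<omega>. \<integral>x. std_normal_density x * (indicator A \<omega> * rem k \<omega> x) \<partial>lborel)"
    proof (rule expectation_freezing[OF pos[OF lo(1)] lo_hi meas])
      fix \<omega> x assume w: "\<omega> \<in> space M"
      have "\<bar>F (lo k) \<omega> (W (lo k) \<omega> + sqrt (h k) * x) - F (lo k) \<omega> (W (lo k) \<omega>)\<bar> \<le> 2 * B"
        using bounds(1)[OF lo(1) w, of k "W (lo k) \<omega> + sqrt (h k) * x"] bounds(1)[OF lo(1) w, of k "W (lo k) \<omega>"] by linarith
      then have "\<bar>rem k \<omega> x\<bar> \<le> 2 * B / h k"
        unfolding rem_def abs_divide using h_pos[of k] by (simp add: divide_right_mono)
      then show "\<bar>indicator A \<omega> * rem k \<omega> x\<bar> \<le> 2 * B / h k"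
        by (auto simp: indicator_def)
    qed
    also have "\<dots> = expectation (space_part k)"
      unfolding space_part_def by (simp add: mult.left_commute)
    finally show ?thesis .
  qed
  have split: "(m (hi k) - m (lo k)) / (hi k - lo k) = expectation (time_part k) + expectation (space_part k)" for k
  proof -
    have "m (hi k) - m (lo k) = expectation (\<lambda>\<omega>. indicator A \<omega> * F (hi k) \<omega> (W (hi k) \<omega>) - indicator A \<omega> * F (lo k) \<omega> (W (hi k) \<omega>))
       + expectation (\<lambda>\<omega>. indicator A \<omega> * (F (lo k) \<omega> (W (hi k) \<omega>) - F (lo k) \<omega> (W (lo k) \<omega>)))"
      unfolding m_def right_diff_distrib using F_int[OF hi(1) hi(1)] F_int[OF lo(1) hi(1)] F_int[OF lo(1) lo(1)]
      by (subst (1 2) Bochner_Integration.integral_diff) auto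
    then show ?thesis
      unfolding freeze[symmetric] time_part_def
      by (simp add: add_divide_distrib h_def right_diff_distrib diff_divide_distrib flip: Bochner_Integration.integral_divide_zero)
  qed
  have h_lim: "h \<longlonglongrightarrow> 0" unfolding h_def using tendsto_diff[OF hi(2) lo(2)] by simp
  have path: "AE \<omega> in M. (\<lambda>k. W (hi k) \<omega>) \<longlonglongrightarrow> W t \<omega> \<and> (\<lambda>k. W (lo k) \<omega>) \<longlonglongrightarrow> W t \<omega>"
    using W_paths
  proof eventually_elim
    case (elim \<omega>)
    show ?case
      using pos[OF t] pos[OF hi(1)] pos[OF lo(1)]
      by (intro conjI continuous_on_tendsto_compose[OF elim] hi(2) lo(2)) auto
  qed
  have time_lim: "(\<lambda>k. expectation (time_part k)) \<longlonglongrightarrow> expectation (\<lambda>\<omega>. indicator A \<omega> * Ft t \<omega> (W t \<omega>))"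
  proof (rule integral_dominated_convergence)
    show "(\<lambda>\<omega>. indicator A \<omega> * Ft t \<omega> (W t \<omega>)) \<in> borel_measurable M"
      using lim_meas(1)[OF t] by simp
    show "time_part k \<in> borel_measurable M" for k
      unfolding time_part_def using F_comp[OF hi(1) hi(1)] F_comp[OF lo(1) hi(1)] by simp
    show "integrable M D" by fact
    have mv: "AE \<omega> in M. \<forall>k. \<exists>\<xi>\<in>{lo k<..<hi k}. time_part k \<omega> = indicator A \<omega> * Ft \<xi> \<omega> (W (hi k) \<omega>)"
      using deriv
    proof eventually_elim
      case (elim \<omega>)
      show ?case
      proof
        fix k
        have "\<exists>\<xi>\<in>{lo k<..<hi k}. F (hi k) \<omega> (W (hi k) \<omega>) - F (lo k) \<omega> (W (hi k) \<omega>) = Ft \<xi> \<omega> (W (hi k) \<omega>) * (hi k - lo k)"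
        proof (rule mvt_simple[OF lo_hi])
          fix x assume x: "lo k \<le> x" "x \<le> hi k"
          have "x \<in> {s..T}" "{lo k..hi k} \<subseteq> {s..T}" using x lo(1)[of k] hi(1)[of k] by auto
          then show "((\<lambda>r. F r \<omega> (W (hi k) \<omega>)) has_derivative (*) (Ft x \<omega> (W (hi k) \<omega>))) (at x within {lo k..hi k})"
            using elim unfolding has_field_derivative_def[symmetric] by (blast intro: DERIV_subset)
        qed
        then show "\<exists>\<xi>\<in>{lo k<..<hi k}. time_part k \<omega> = indicator A \<omega> * Ft \<xi> \<omega> (W (hi k) \<omega>)"
          unfolding time_part_def using lo_hi[of k] by (auto intro!: bexI)
      qed
    qed
    show "AE \<omega> in M. (\<lambda>k. time_part k \<omega>) \<longlonglongrightarrow> indicator A \<omega> * Ft t \<omega> (W t \<omega>)"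
      using mv path cont(1)
    proof eventually_elim
      case (elim \<omega>)
      from elim(1) obtain \<xi> where \<xi>: "\<And>k. \<xi> k \<in> {lo k<..<hi k}" "\<And>k. time_part k \<omega> = indicator A \<omega> * Ft (\<xi> k) \<omega> (W (hi k) \<omega>)"
        by metis
      have "\<xi> \<longlonglongrightarrow> t"
      proof (rule tendsto_sandwich[OF _ _ lo(2) hi(2)])
        show "\<forall>\<^sub>F k in sequentially. lo k \<le> \<xi> k" "\<forall>\<^sub>F k in sequentially. \<xi> k \<le> hi k"
          using \<xi>(1) by (auto intro!: always_eventually simp: less_imp_le)
      qed
      then have "(\<lambda>k. (\<xi> k, W (hi k) \<omega>)) \<longlonglongrightarrow> (t, W t \<omega>)" using elim(2) by (intro tendsto_Pair) auto
      moreover have "\<xi> k \<in> {s..T}" for k using \<xi>(1)[of k] lo(1)[of k] hi(1)[of k] by auto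
      ultimately have "(\<lambda>k. (\<lambda>(t, w). Ft t \<omega> w) (\<xi> k, W (hi k) \<omega>)) \<longlonglongrightarrow> (\<lambda>(t, w). Ft t \<omega> w) (t, W t \<omega>)"
        using t by (intro continuous_on_tendsto_compose[OF elim(3)]) auto
      then show ?case unfolding \<xi>(2) by (intro tendsto_mult tendsto_const) simp
    qed
    show "AE \<omega> in M. norm (time_part k \<omega>) \<le> D \<omega>" for k
      using mv dom(1)
    proof eventually_elim
      case (elim \<omega>)
      then obtain \<xi> where \<xi>: "\<xi> \<in> {lo k<..<hi k}" "time_part k \<omega> = indicator A \<omega> * Ft \<xi> \<omega> (W (hi k) \<omega>)" by blast
      have "\<xi> \<in> {s..T}" using \<xi>(1) lo(1)[of k] hi(1)[of k] by auto
      then have "\<bar>Ft \<xi> \<omega> (W (hi k) \<omega>)\<bar> \<le> D \<omega>" using elim(2) hi(1) by blast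
      then show ?case using \<xi>(2) by (auto simp: indicator_def)
    qed
  qed
  have taylor: "AE \<omega> in M. \<forall>k x. x \<noteq> 0 \<longrightarrow> (\<exists>\<xi>. \<bar>\<xi> - W (lo k) \<omega>\<bar> \<le> sqrt (h k) * \<bar>x\<bar> \<and>
      rem k \<omega> x = Fw (lo k) \<omega> (W (lo k) \<omega>) * x / sqrt (h k) + Fww (lo k) \<omega> \<xi> / 2 * x\<^sup>2)"
    using deriv
  proof eventually_elim
    case (elim \<omega>)
    show ?case
    proof (intro allI impI)
      fix k and x :: real assume x: "x \<noteq> 0"
      let ?w = "W (lo k) \<omega>" and ?d = "sqrt (h k) * x"
      let ?diff = "\<lambda>n::nat. if n = 0 then F (lo k) \<omega> else if n = 1 then Fw (lo k) \<omega> else Fww (lo k) \<omega>"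
      have d0: "?d \<noteq> 0" using x h_pos[of k] by simp
      have "\<exists>\<xi>. (if ?w + ?d < ?w then ?w + ?d < \<xi> \<and> \<xi> < ?w else ?w < \<xi> \<and> \<xi> < ?w + ?d) \<and>
          F (lo k) \<omega> (?w + ?d) = (\<Sum>m<2. ?diff m ?w / fact m * (?w + ?d - ?w) ^ m) + ?diff 2 \<xi> / fact 2 * (?w + ?d - ?w)\<^sup>2"
        by (rule Taylor[where a = "min ?w (?w + ?d)" and b = "max ?w (?w + ?d)"])
          (use elim lo(1)[of k] d0 in \<open>auto simp: less_2_cases_iff\<close>)
      then obtain \<xi> where \<xi>: "if ?w + ?d < ?w then ?w + ?d < \<xi> \<and> \<xi> < ?w else ?w < \<xi> \<and> \<xi> < ?w + ?d"
        "F (lo k) \<omega> (?w + ?d) = F (lo k) \<omega> ?w + Fw (lo k) \<omega> ?w * ?d + Fww (lo k) \<omega> \<xi> / 2 * ?d\<^sup>2"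
        by (auto simp: numeral_2_eq_2)
      have "\<bar>\<xi> - ?w\<bar> \<le> \<bar>?d\<bar>" using \<xi>(1) by (auto split: if_splits)
      then have 1: "\<bar>\<xi> - ?w\<bar> \<le> sqrt (h k) * \<bar>x\<bar>" using h_pos[of k] by (simp add: abs_mult)
      have "rem k \<omega> x = Fw (lo k) \<omega> ?w * ?d / h k + Fww (lo k) \<omega> \<xi> / 2 * ?d\<^sup>2 / h k"
        unfolding rem_def \<xi>(2) by (simp add: add_divide_distrib)
      moreover have "?d\<^sup>2 = h k * x\<^sup>2" using h_pos[of k] by (simp add: power_mult_distrib)
      moreover have "Fw (lo k) \<omega> ?w * ?d / h k = Fw (lo k) \<omega> ?w * x / sqrt (h k)"
      proof -
        have "sqrt (h k) / h k = 1 / sqrt (h k)"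
          using h_pos[of k] by (simp add: field_simps)
        then show ?thesis by (metis (no_types, lifting) mult.assoc mult.commute mult.right_neutral times_divide_eq_left)
      qed
      ultimately have "rem k \<omega> x = Fw (lo k) \<omega> ?w * x / sqrt (h k) + Fww (lo k) \<omega> \<xi> / 2 * x\<^sup>2"
        using h_pos[of k] by simp
      with 1 show "\<exists>\<xi>. \<bar>\<xi> - ?w\<bar> \<le> sqrt (h k) * \<bar>x\<bar> \<and> rem k \<omega> x = Fw (lo k) \<omega> ?w * x / sqrt (h k) + Fww (lo k) \<omega> \<xi> / 2 * x\<^sup>2"
        by blast
    qed
  qed
  have N1: "has_bochner_integral lborel (\<lambda>x. std_normal_density x * x) 0"
    using std_normal_moment_odd[of 0] by simp
  have N2: "has_bochner_integral lborel (\<lambda>x. std_normal_density x * x\<^sup>2) 1"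
    using std_normal_moment_even[of 1] by (simp add: numeral_2_eq_2)
  \<comment> \<open>subtracting the first-order term does not change the normal average and leaves a bounded quotient\<close>
  define q where "q k \<omega> x = rem k \<omega> x - Fw (lo k) \<omega> (W (lo k) \<omega>) * x / sqrt (h k)" for k \<omega> x
  have F_sec: "F (lo k) \<omega> \<in> borel_measurable borel" if "\<omega> \<in> space M" for k \<omega>
    using measurable_Pair2[OF F_meas[OF lo(1)], of \<omega>] that by simp
  have rem_sec: "rem k \<omega> \<in> borel_measurable borel" if "\<omega> \<in> space M" for k \<omega>
    using F_sec[OF that] unfolding rem_def by measurable
  have q_bound: "AE \<omega> in M. \<forall>k x. x \<noteq> 0 \<longrightarrow> \<bar>q k \<omega> x\<bar> \<le> B / 2 * x\<^sup>2"
    using taylor AE_space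
  proof eventually_elim
    case (elim \<omega>)
    show ?case
    proof (intro allI impI)
      fix k and x :: real assume "x \<noteq> 0"
      with elim(1) obtain \<xi> where "rem k \<omega> x = Fw (lo k) \<omega> (W (lo k) \<omega>) * x / sqrt (h k) + Fww (lo k) \<omega> \<xi> / 2 * x\<^sup>2"
        by blast
      then have "q k \<omega> x = Fww (lo k) \<omega> \<xi> / 2 * x\<^sup>2" by (simp add: q_def)
      moreover have "\<bar>Fww (lo k) \<omega> \<xi> / 2\<bar> \<le> B / 2" using bounds(2)[OF lo(1) elim(2), of k \<xi>] by simp
      ultimately show "\<bar>q k \<omega> x\<bar> \<le> B / 2 * x\<^sup>2" by (simp only: abs_mult abs_power2 mult_right_mono zero_le_power2)
    qed
  qed
  have q_int: "AE \<omega> in M. \<forall>k. integrable lborel (\<lambda>x. std_normal_density x * q k \<omega> x) \<and>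
      space_part k \<omega> = indicator A \<omega> * (\<integral>x. std_normal_density x * q k \<omega> x \<partial>lborel) \<and>
      \<bar>space_part k \<omega>\<bar> \<le> B / 2"
    using q_bound AE_space
  proof eventually_elim
    case (elim \<omega>)
    show ?case
    proof
      fix k
      have meas: "q k \<omega> \<in> borel_measurable borel" using rem_sec[OF elim(2), of k] unfolding q_def by measurable
      have bd_int: "has_bochner_integral lborel (\<lambda>x. B / 2 * (std_normal_density x * x\<^sup>2)) (B / 2 * 1)"
        by (rule has_bochner_integral_mult_right[OF N2])
      have bd: "AE x in lborel. \<bar>std_normal_density x * q k \<omega> x\<bar> \<le> B / 2 * (std_normal_density x * x\<^sup>2)"
        using AE_lborel_singleton[of 0]
      proof eventually_elim
        case x: (elim x)
        then have "std_normal_density x * \<bar>q k \<omega> x\<bar> \<le> std_normal_density x * (B / 2 * x\<^sup>2)"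
          using elim(1) by (intro mult_left_mono) auto
        then show ?case by (simp add: abs_mult mult.left_commute)
      qed
      have int: "integrable lborel (\<lambda>x. std_normal_density x * q k \<omega> x)"
        by (rule Bochner_Integration.integrable_bound[of lborel "\<lambda>x. B / 2 * (std_normal_density x * x\<^sup>2)"])
          (use bd_int meas bd in \<open>auto simp: has_bochner_integral_iff elim!: eventually_mono\<close>)
      have "(\<integral>x. std_normal_density x * rem k \<omega> x \<partial>lborel)
          = (\<integral>x. std_normal_density x * q k \<omega> x + Fw (lo k) \<omega> (W (lo k) \<omega>) / sqrt (h k) * (std_normal_density x * x) \<partial>lborel)"
        by (simp add: q_def algebra_simps)
      also have "\<dots> = (\<integral>x. std_normal_density x * q k \<omega> x \<partial>lborel)"
        using int N1 by (subst Bochner_Integration.integral_add) (auto simp: has_bochner_integral_iff)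
      finally have eq: "space_part k \<omega> = indicator A \<omega> * (\<integral>x. std_normal_density x * q k \<omega> x \<partial>lborel)"
        by (simp add: space_part_def)
      have "\<bar>\<integral>x. std_normal_density x * q k \<omega> x \<partial>lborel\<bar> \<le> (\<integral>x. \<bar>std_normal_density x * q k \<omega> x\<bar> \<partial>lborel)"
        by (rule integral_abs_bound)
      also have "\<dots> \<le> (\<integral>x. B / 2 * (std_normal_density x * x\<^sup>2) \<partial>lborel)"
        using int bd_int bd by (intro integral_mono_AE) (auto simp: has_bochner_integral_iff)
      also have "\<dots> = B / 2" using bd_int by (simp add: has_bochner_integral_iff)
      finally have "\<bar>space_part k \<omega>\<bar> \<le> B / 2"
        unfolding eq by (auto simp: indicator_def)
      with int eq show "integrable lborel (\<lambda>x. std_normal_density x * q k \<omega> x) \<and>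
        space_part k \<omega> = indicator A \<omega> * (\<integral>x. std_normal_density x * q k \<omega> x \<partial>lborel) \<and> \<bar>space_part k \<omega>\<bar> \<le> B / 2" by blast
    qed
  qed
  have space_lim: "(\<lambda>k. expectation (space_part k)) \<longlonglongrightarrow> expectation (\<lambda>\<omega>. indicator A \<omega> * (Fww t \<omega> (W t \<omega>) / 2))"
  proof (rule integral_dominated_convergence)
    show "(\<lambda>\<omega>. indicator A \<omega> * (Fww t \<omega> (W t \<omega>) / 2)) \<in> borel_measurable M"
      using lim_meas(2)[OF t] by simp
    show "space_part k \<in> borel_measurable M" for k
    proof -
      have W_lo: "W (lo k) \<in> borel_measurable M" by (rule W_measurable[OF pos[OF lo(1)]])
      have id': "(\<lambda>\<omega>. \<omega>) \<in> measurable M (Fil (lo k))" by (rule id)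
      have "(\<lambda>z. (fst z, W (lo k) (fst z) + sqrt (h k) * snd z)) \<in> measurable (M \<Otimes>\<^sub>M lborel) (Fil (lo k) \<Otimes>\<^sub>M borel)"
        "(\<lambda>z. (fst z, W (lo k) (fst z))) \<in> measurable (M \<Otimes>\<^sub>M (lborel :: real measure)) (Fil (lo k) \<Otimes>\<^sub>M borel)"
        using W_lo id' by (auto intro!: measurable_Pair borel_measurable_add intro: measurable_compose[OF measurable_fst])
      from measurable_compose[OF this(1) F_meas[OF lo(1)]] measurable_compose[OF this(2) F_meas[OF lo(1)]]
      have "(\<lambda>z. std_normal_density (snd z) * rem k (fst z) (snd z)) \<in> borel_measurable (M \<Otimes>\<^sub>M lborel)"
        unfolding rem_def by (intro borel_measurable_times borel_measurable_divide borel_measurable_diff) simp_all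
      then show ?thesis unfolding space_part_def
        by (intro borel_measurable_times lborel.borel_measurable_lebesgue_integral) (simp_all add: split_def)
    qed
    show "integrable M (\<lambda>_. B / 2)" by simp
    show "AE \<omega> in M. norm (space_part k \<omega>) \<le> B / 2" for k
      using q_int unfolding real_norm_def by eventually_elim blast
    show "AE \<omega> in M. (\<lambda>k. space_part k \<omega>) \<longlonglongrightarrow> indicator A \<omega> * (Fww t \<omega> (W t \<omega>) / 2)"
      using q_int q_bound taylor path cont(2) AE_space
    proof eventually_elim
      case (elim \<omega>)
      have "(\<lambda>k. \<integral>x. std_normal_density x * q k \<omega> x \<partial>lborel)
          \<longlonglongrightarrow> (\<integral>x. std_normal_density x * (Fww t \<omega> (W t \<omega>) / 2 * x\<^sup>2) \<partial>lborel)"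
      proof (rule integral_dominated_convergence)
        show "(\<lambda>x. std_normal_density x * (Fww t \<omega> (W t \<omega>) / 2 * x\<^sup>2)) \<in> borel_measurable lborel" by measurable
        show "(\<lambda>x. std_normal_density x * q k \<omega> x) \<in> borel_measurable lborel" for k using elim(1)[rule_format, of k] by (intro borel_measurable_integrable) blast
        show "integrable lborel (\<lambda>x. B / 2 * (std_normal_density x * x\<^sup>2))"
          using N2 by (auto simp: has_bochner_integral_iff)
        show "AE x in lborel. norm (std_normal_density x * q k \<omega> x) \<le> B / 2 * (std_normal_density x * x\<^sup>2)" for k
          using AE_lborel_singleton[of 0]
        proof eventually_elim
          case x: (elim x)
          then have "std_normal_density x * \<bar>q k \<omega> x\<bar> \<le> std_normal_density x * (B / 2 * x\<^sup>2)"
            using elim(2) by (intro mult_left_mono) auto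
          then show ?case by (simp add: abs_mult mult.left_commute)
        qed
        show "AE x in lborel. (\<lambda>k. std_normal_density x * q k \<omega> x) \<longlonglongrightarrow> std_normal_density x * (Fww t \<omega> (W t \<omega>) / 2 * x\<^sup>2)"
          using AE_lborel_singleton[of 0]
        proof eventually_elim
          case x: (elim x)
          then have "\<forall>k. \<exists>\<xi>. \<bar>\<xi> - W (lo k) \<omega>\<bar> \<le> sqrt (h k) * \<bar>x\<bar> \<and> q k \<omega> x = Fww (lo k) \<omega> \<xi> / 2 * x\<^sup>2"
            using elim(3) by (fastforce simp: q_def)
          then obtain \<xi> where \<xi>: "\<And>k. \<bar>\<xi> k - W (lo k) \<omega>\<bar> \<le> sqrt (h k) * \<bar>x\<bar>" "\<And>k. q k \<omega> x = Fww (lo k) \<omega> (\<xi> k) / 2 * x\<^sup>2"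
            by metis
          have "(\<lambda>k. sqrt (h k) * \<bar>x\<bar>) \<longlonglongrightarrow> 0"
            using tendsto_mult[OF tendsto_real_sqrt[OF h_lim] tendsto_const[of "\<bar>x\<bar>"]] by simp
          then have "(\<lambda>k. \<xi> k - W (lo k) \<omega>) \<longlonglongrightarrow> 0"
            by (rule Lim_null_comparison[rotated]) (simp add: \<xi>(1))
          from tendsto_add[OF this, of "\<lambda>k. W (lo k) \<omega>" "W t \<omega>"] have "\<xi> \<longlonglongrightarrow> W t \<omega>"
            using elim(4) by simp
          then have "(\<lambda>k. (lo k, \<xi> k)) \<longlonglongrightarrow> (t, W t \<omega>)" by (intro tendsto_Pair lo(2))
          then have "(\<lambda>k. (\<lambda>(t, w). Fww t \<omega> w) (lo k, \<xi> k)) \<longlonglongrightarrow> (\<lambda>(t, w). Fww t \<omega> w) (t, W t \<omega>)"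
            using t lo(1) by (intro continuous_on_tendsto_compose[OF elim(5)]) auto
          then have "(\<lambda>k. Fww (lo k) \<omega> (\<xi> k)) \<longlonglongrightarrow> Fww t \<omega> (W t \<omega>)" by simp
          then show ?case unfolding \<xi>(2) by (intro tendsto_intros) simp_all
        qed
      qed
      moreover have "(\<integral>x. std_normal_density x * (Fww t \<omega> (W t \<omega>) / 2 * x\<^sup>2) \<partial>lborel) = Fww t \<omega> (W t \<omega>) / 2"
        using has_bochner_integral_mult_right[OF N2, of "Fww t \<omega> (W t \<omega>) / 2"]
        by (simp add: has_bochner_integral_iff mult.left_commute)
      moreover have "space_part k \<omega> = indicator A \<omega> * (\<integral>x. std_normal_density x * q k \<omega> x \<partial>lborel)" for k
        using elim(1) by blast
      ultimately show ?case by (simp only: tendsto_mult tendsto_const)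
    qed
  qed
  have "expectation (\<lambda>\<omega>. indicator A \<omega> * Ft t \<omega> (W t \<omega>)) + expectation (\<lambda>\<omega>. indicator A \<omega> * (Fww t \<omega> (W t \<omega>) / 2))
      = expectation (\<lambda>\<omega>. indicator A \<omega> * (Ft t \<omega> (W t \<omega>) + Fww t \<omega> (W t \<omega>) / 2))"
  proof -
    have "integrable M (\<lambda>\<omega>. indicator A \<omega> * Ft t \<omega> (W t \<omega>))"
    proof (rule Bochner_Integration.integrable_bound[OF dom(2)])
      show "AE \<omega> in M. norm (indicator A \<omega> * Ft t \<omega> (W t \<omega>)) \<le> norm (D \<omega>)"
        using dom(1)
      proof eventually_elim
        case (elim \<omega>)
        then have "\<bar>Ft t \<omega> (W t \<omega>)\<bar> \<le> D \<omega>" using t by blast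
        then show ?case by (auto simp: indicator_def)
      qed
    qed (use lim_meas(1)[OF t] in simp)
    moreover have "integrable M (\<lambda>\<omega>. indicator A \<omega> * (Fww t \<omega> (W t \<omega>) / 2))"
    proof (rule integrable_const_bound[where B = "\<bar>B\<bar>"])
      show "AE \<omega> in M. norm (indicator A \<omega> * (Fww t \<omega> (W t \<omega>) / 2)) \<le> \<bar>B\<bar>"
        using AE_space
      proof eventually_elim
        case (elim \<omega>)
        show ?case using bounds(2)[OF t elim, of "W t \<omega>"] by (auto simp: indicator_def)
      qed
    qed (use lim_meas(2)[OF t] in simp)
    ultimately show ?thesis by (simp add: distrib_left)
  qed
  then show ?thesis unfolding split using tendsto_add[OF time_lim space_lim] by simp
qed

lemma dynkin_formula:
  assumes A: "A \<in> sets (Fil s)" and sT: "s \<le> T"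
  defines "d \<equiv> \<lambda>t. expectation (\<lambda>\<omega>. indicator A \<omega> * (Ft t \<omega> (W t \<omega>) + Fww t \<omega> (W t \<omega>) / 2))"
  shows "continuous_on {s..T} d"
    and "expectation (\<lambda>\<omega>. indicator A \<omega> * F T \<omega> (W T \<omega>)) - expectation (\<lambda>\<omega>. indicator A \<omega> * F s \<omega> (W s \<omega>))
      = (LINT t:{s..T}|lborel. d t)"
proof -
  define m where "m t = expectation (\<lambda>\<omega>. indicator A \<omega> * F t \<omega> (W t \<omega>))" for t
  have A_M [measurable]: "A \<in> sets M" by (rule sets_Fil_subset[OF A])
  have pos: "0 \<le> r" if "r \<in> {s..T}" for r using that s by auto
  show cont_d: "continuous_on {s..T} d"
  proof (rule continuous_on_sequentiallyI)
    fix u t assume u: "\<forall>k::nat. u k \<in> {s..T}" and t: "t \<in> {s..T}" and lim: "u \<longlonglongrightarrow> t"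
    show "(\<lambda>k. d (u k)) \<longlonglongrightarrow> d t"
      unfolding d_def
    proof (rule integral_dominated_convergence)
      show "(\<lambda>\<omega>. indicator A \<omega> * (Ft t \<omega> (W t \<omega>) + Fww t \<omega> (W t \<omega>) / 2)) \<in> borel_measurable M"
        using lim_meas(1,2)[OF t] by simp
      show "(\<lambda>\<omega>. indicator A \<omega> * (Ft (u k) \<omega> (W (u k) \<omega>) + Fww (u k) \<omega> (W (u k) \<omega>) / 2)) \<in> borel_measurable M" for k
        using lim_meas(1,2)[OF u[rule_format, of k]] by simp
      show "integrable M (\<lambda>\<omega>. D \<omega> + \<bar>B\<bar>)" using dom(2) by simp
      show "AE \<omega> in M. norm (indicator A \<omega> * (Ft (u k) \<omega> (W (u k) \<omega>) + Fww (u k) \<omega> (W (u k) \<omega>) / 2)) \<le> D \<omega> + \<bar>B\<bar>" for k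
        using dom(1) AE_space
      proof eventually_elim
        case (elim \<omega>)
        have "\<bar>Ft (u k) \<omega> (W (u k) \<omega>)\<bar> \<le> D \<omega>" using elim(1) u by blast
        moreover have "\<bar>Fww (u k) \<omega> (W (u k) \<omega>)\<bar> \<le> B" by (rule bounds(2)[OF u[rule_format] elim(2)])
        ultimately show ?case by (auto simp: indicator_def)
      qed
      show "AE \<omega> in M. (\<lambda>k. indicator A \<omega> * (Ft (u k) \<omega> (W (u k) \<omega>) + Fww (u k) \<omega> (W (u k) \<omega>) / 2))
          \<longlonglongrightarrow> indicator A \<omega> * (Ft t \<omega> (W t \<omega>) + Fww t \<omega> (W t \<omega>) / 2)"
        using W_paths cont
      proof eventually_elim
        case (elim \<omega>)
        have "(\<lambda>k. W (u k) \<omega>) \<longlonglongrightarrow> W t \<omega>"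
          using pos t u by (intro continuous_on_tendsto_compose[OF elim(1)] lim) auto
        with lim have p: "(\<lambda>k. (u k, W (u k) \<omega>)) \<longlonglongrightarrow> (t, W t \<omega>)" by (rule tendsto_Pair)
        have "(\<lambda>k. (\<lambda>(t, w). Ft t \<omega> w) (u k, W (u k) \<omega>)) \<longlonglongrightarrow> (\<lambda>(t, w). Ft t \<omega> w) (t, W t \<omega>)"
          "(\<lambda>k. (\<lambda>(t, w). Fww t \<omega> w) (u k, W (u k) \<omega>)) \<longlonglongrightarrow> (\<lambda>(t, w). Fww t \<omega> w) (t, W t \<omega>)"
          using t u by (intro continuous_on_tendsto_compose[OF elim(2) p] continuous_on_tendsto_compose[OF elim(3) p]; auto)+
        then show ?case by (intro tendsto_intros) simp_all
      qed
    qed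
  qed
  have "(m has_real_derivative d t) (at t within {s..T})" if t: "t \<in> {s..T}" for t
    unfolding has_field_derivative_iff tendsto_at_iff_sequentially comp_def
  proof (intro allI impI)
    fix X assume X: "\<forall>k::nat. X k \<in> {s..T} - {t}" and lim: "X \<longlonglongrightarrow> t"
    let ?lo = "\<lambda>k. min (X k) t" and ?hi = "\<lambda>k. max (X k) t"
    have "(\<lambda>k. (m (?hi k) - m (?lo k)) / (?hi k - ?lo k)) \<longlonglongrightarrow> d t"
      unfolding m_def d_def
    proof (rule dynkin_difference_quotient[OF A t])
      show "?lo k \<in> {s..T}" "?hi k \<in> {s..T}" "?lo k < ?hi k" for k
        using X[rule_format, of k] t by (auto simp: min_def max_def)
      show "?lo \<longlonglongrightarrow> t" "?hi \<longlonglongrightarrow> t"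
        using tendsto_min[OF lim tendsto_const[of t]] tendsto_max[OF lim tendsto_const[of t]] by auto
    qed
    moreover have "(m (?hi k) - m (?lo k)) / (?hi k - ?lo k) = (m (X k) - m t) / (X k - t)" for k
      using minus_divide_divide[of "m (X k) - m t" "X k - t"] by (auto simp: min_def max_def)
    ultimately show "(\<lambda>k. (m (X k) - m t) / (X k - t)) \<longlonglongrightarrow> d t" by simp
  qed
  then have "(d has_integral m T - m s) {s..T}"
    using sT by (intro fundamental_theorem_of_calculus) (auto simp: has_real_derivative_iff_has_vector_derivative)
  moreover have "set_integrable lborel {s..T} d"
    by (rule borel_integrable_atLeastAtMost'[OF cont_d])
  ultimately show "expectation (\<lambda>\<omega>. indicator A \<omega> * F T \<omega> (W T \<omega>)) - expectation (\<lambda>\<omega>. indicator A \<omega> * F s \<omega> (W s \<omega>))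
      = (LINT t:{s..T}|lborel. d t)"
    using set_borel_integral_eq_integral(2) by (metis integral_unique m_def)
qed

end

end

section \<open>Ito integrals of deterministic integrands\<close>

lemma integrable_mult_L2:
  fixes f g :: "'a \<Rightarrow> real"
  assumes "f \<in> borel_measurable M" "g \<in> borel_measurable M"
    "integrable M (\<lambda>x. (f x)\<^sup>2)" "integrable M (\<lambda>x. (g x)\<^sup>2)"
  shows "integrable M (\<lambda>x. f x * g x)"
proof (rule Bochner_Integration.integrable_bound[of M "\<lambda>x. (f x)\<^sup>2 + (g x)\<^sup>2"])
  have "\<bar>f x * g x\<bar> \<le> (f x)\<^sup>2 + (g x)\<^sup>2" for x
  proof -
    have "0 \<le> (\<bar>f x\<bar> - \<bar>g x\<bar>)\<^sup>2" by simp
    then have "2 * (\<bar>f x\<bar> * \<bar>g x\<bar>) \<le> (f x)\<^sup>2 + (g x)\<^sup>2" by (simp add: power2_diff mult.assoc)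
    moreover have "0 \<le> \<bar>f x\<bar> * \<bar>g x\<bar>" by simp
    ultimately have "\<bar>f x\<bar> * \<bar>g x\<bar> \<le> (f x)\<^sup>2 + (g x)\<^sup>2" by linarith
    then show ?thesis by (simp add: abs_mult)
  qed
  then show "AE x in M. norm (f x * g x) \<le> norm ((f x)\<^sup>2 + (g x)\<^sup>2)" by simp
qed (use assms in auto)

lemma integrable_add_L2:
  fixes f g :: "'a \<Rightarrow> real"
  assumes "f \<in> borel_measurable M" "g \<in> borel_measurable M"
    "integrable M (\<lambda>x. (f x)\<^sup>2)" "integrable M (\<lambda>x. (g x)\<^sup>2)"
  shows "integrable M (\<lambda>x. (f x + g x)\<^sup>2)"
  using assms integrable_mult_L2[OF assms] by (simp add: power2_sum mult.assoc)

lemma square_add_le: "(x + y)\<^sup>2 \<le> 2 * x\<^sup>2 + 2 * (y::real)\<^sup>2"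
  using sum_squares_bound[of x y] by (simp add: power2_sum)

context brownian
begin

lemma Fil_integral_measurable:
  fixes X :: "real \<Rightarrow> 'a \<Rightarrow> real"
  assumes t: "0 \<le> t" and X: "\<And>s. 0 \<le> s \<Longrightarrow> s \<le> t \<Longrightarrow> X s \<in> borel_measurable (Fil t)"
    and cont: "AE \<omega> in M. continuous_on {0..t} (\<lambda>s. X s \<omega>)"
  shows "(\<lambda>\<omega>. LINT s:{0..t}|lborel. X s \<omega>) \<in> borel_measurable (Fil t)"
proof -
  obtain N where N: "\<forall>\<omega>\<in>space M - N. continuous_on {0..t} (\<lambda>s. X s \<omega>)" "N \<in> null_sets M"
    by (rule AE_null_setE[OF cont])
  define X' where "X' s \<omega> = (if \<omega> \<in> N then 0 else X s \<omega>)" for s \<omega>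
  have "(\<lambda>(\<omega>, s). X' (max 0 (min t s)) \<omega>) \<in> borel_measurable (Fil t \<Otimes>\<^sub>M borel)"
  proof (rule continuous_process_measurable_pair[OF _ _ t])
    show "X' s \<in> borel_measurable (Fil t)" if "0 \<le> s" "s \<le> t" for s
      unfolding X'_def using X[OF that] null_sets_in_Fil[OF N(2)] sets.Int_space_eq2[OF null_sets_in_Fil[OF N(2), of t]] by (intro measurable_If_set) auto
    show "continuous_on {0..t} (\<lambda>s. X' s \<omega>)" if "\<omega> \<in> space (Fil t)" for \<omega>
      using N(1)[rule_format, of \<omega>] that by (cases "\<omega> \<in> N") (auto simp: X'_def)
  qed
  then have "(\<lambda>(\<omega>, s). indicator {0..t} s * X' (max 0 (min t s)) \<omega>) \<in> borel_measurable (Fil t \<Otimes>\<^sub>M lborel)"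
    by (simp add: split_def)
  from lborel.borel_measurable_lebesgue_integral[OF this]
  have meas: "(\<lambda>\<omega>. \<integral>s. indicator {0..t} s * X' (max 0 (min t s)) \<omega> \<partial>lborel) \<in> borel_measurable (Fil t)" by simp
  show ?thesis
  proof (rule Fil_measurable_AE_eq[OF meas])
    show "AE \<omega> in M. (\<integral>s. indicator {0..t} s * X' (max 0 (min t s)) \<omega> \<partial>lborel) = (LINT s:{0..t}|lborel. X s \<omega>)"
      using AE_not_in[OF N(2)]
    proof eventually_elim
      case (elim \<omega>)
      then show ?case unfolding set_lebesgue_integral_def
        by (intro Bochner_Integration.integral_cong) (auto simp: X'_def indicator_def)
    qed
  qed
qed

lemma increment_L2:
  assumes "0 \<le> s" "s \<le> t"
  shows "integrable M (\<lambda>\<omega>. (W t \<omega> - W s \<omega>)\<^sup>2)" "integrable M (\<lambda>\<omega>. W t \<omega> - W s \<omega>)"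
    "expectation (\<lambda>\<omega>. W t \<omega> - W s \<omega>) = 0" "expectation (\<lambda>\<omega>. (W t \<omega> - W s \<omega>)\<^sup>2) = t - s"
proof -
  have "integrable M (\<lambda>\<omega>. (W t \<omega> - W s \<omega>)\<^sup>2) \<and> integrable M (\<lambda>\<omega>. W t \<omega> - W s \<omega>) \<and>
    expectation (\<lambda>\<omega>. W t \<omega> - W s \<omega>) = 0 \<and> expectation (\<lambda>\<omega>. (W t \<omega> - W s \<omega>)\<^sup>2) = t - s"
  proof (cases "s = t")
    case False
    with assms have st: "s < t" by simp
    note D = increment_normal[OF assms(1) st]
    have sq: "0 < sqrt (t - s)" using st by simp
    have 1: "integrable M (\<lambda>\<omega>. (W t \<omega> - W s \<omega>)\<^sup>2)"
      using distributed_integrable[OF D, of "\<lambda>x. x\<^sup>2"] integrable_normal_moment[OF sq, of 0 2] by simp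
    have 2: "integrable M (\<lambda>\<omega>. W t \<omega> - W s \<omega>)"
      using distributed_integrable[OF D, of "\<lambda>x. x"] integrable_normal_moment[OF sq, of 0 1] by simp
    have 3: "expectation (\<lambda>\<omega>. W t \<omega> - W s \<omega>) = 0" by (rule normal_distributed_expectation[OF sq D])
    have "variance (\<lambda>\<omega>. W t \<omega> - W s \<omega>) = t - s"
      using normal_distributed_variance[OF sq D] st by simp
    then show ?thesis using 1 2 3 by simp
  qed auto
  then show "integrable M (\<lambda>\<omega>. (W t \<omega> - W s \<omega>)\<^sup>2)" "integrable M (\<lambda>\<omega>. W t \<omega> - W s \<omega>)"
    "expectation (\<lambda>\<omega>. W t \<omega> - W s \<omega>) = 0" "expectation (\<lambda>\<omega>. (W t \<omega> - W s \<omega>)\<^sup>2) = t - s" by auto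
qed

lemma W_L2:
  assumes "0 \<le> t" shows "integrable M (\<lambda>\<omega>. (W t \<omega>)\<^sup>2)"
proof (subst integrable_cong_AE)
  show "AE \<omega> in M. (W t \<omega>)\<^sup>2 = (W t \<omega> - W 0 \<omega>)\<^sup>2" using W_0 by eventually_elim simp
  show "integrable M (\<lambda>\<omega>. (W t \<omega> - W 0 \<omega>)\<^sup>2)" using increment_L2[of 0 t] assms by simp
qed (use W_measurable assms in auto)

lemma past_times_increment_zero:
  assumes "0 \<le> s" "s \<le> t" "\<eta> \<in> borel_measurable (Fil s)" "integrable M \<eta>"
  shows "integrable M (\<lambda>\<omega>. \<eta> \<omega> * (W t \<omega> - W s \<omega>))" "expectation (\<lambda>\<omega>. \<eta> \<omega> * (W t \<omega> - W s \<omega>)) = 0"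
  using past_times_increment[OF assms(1) _ assms(3,4), of t "\<lambda>x. x"] increment_L2[OF assms(1,2)] assms(2)
  by (cases "s = t"; simp)+

lemma past_times_increment_square:
  assumes "0 \<le> s" "s \<le> t" "\<eta> \<in> borel_measurable (Fil s)" "integrable M \<eta>"
  shows "integrable M (\<lambda>\<omega>. \<eta> \<omega> * (W t \<omega> - W s \<omega>)\<^sup>2)"
    "expectation (\<lambda>\<omega>. \<eta> \<omega> * (W t \<omega> - W s \<omega>)\<^sup>2) = expectation \<eta> * (t - s)"
  using past_times_increment[OF assms(1) _ assms(3,4), of t "\<lambda>x. x\<^sup>2"] increment_L2[OF assms(1,2)] assms(2)
  by (cases "s = t"; simp)+

text \<open>The increment \<open>W b - W a\<close> or the value \<open>W d\<close> is split at the end point that lies between; increments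
  after it are orthogonal to the past. The last factor is the length of \<open>(a, b] \<inter> (0, d]\<close>.\<close>

lemma weighted_increment_times_W:
  assumes ab: "0 \<le> a" "a \<le> b" and d: "0 \<le> d"
    and \<xi>: "\<xi> \<in> borel_measurable (Fil a)" "\<And>\<omega>. \<omega> \<in> space M \<Longrightarrow> \<bar>\<xi> \<omega>\<bar> \<le> C"
  shows "expectation (\<lambda>\<omega>. \<xi> \<omega> * (W b \<omega> - W a \<omega>) * W d \<omega>) = expectation \<xi> * (min d b - min d a)"
proof -
  have \<xi>_L2: "integrable M (\<lambda>\<omega>. \<xi> \<omega> * X \<omega>)" if "integrable M X" for X
  proof (rule Bochner_Integration.integrable_bound[of M "\<lambda>\<omega>. \<bar>C\<bar> * X \<omega>"])
    show "AE \<omega> in M. norm (\<xi> \<omega> * X \<omega>) \<le> norm (\<bar>C\<bar> * X \<omega>)"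
    proof (rule AE_I2)
      fix \<omega> assume "\<omega> \<in> space M"
      then have "\<bar>\<xi> \<omega>\<bar> \<le> \<bar>C\<bar>" using \<xi>(2)[of \<omega>] by linarith
      then show "norm (\<xi> \<omega> * X \<omega>) \<le> norm (\<bar>C\<bar> * X \<omega>)" by (simp add: abs_mult mult_right_mono)
    qed
  qed (use that measurable_from_Fil[OF \<xi>(1)] in auto)
  have W_ad: "W r \<in> borel_measurable (Fil r')" if "0 \<le> r" "r \<le> r'" for r r' using W_adapted[OF that] .
  have WM: "W r \<in> borel_measurable M" if "0 \<le> r" for r using W_measurable[OF that] .
  have W_int: "integrable M (W r)" if "0 \<le> r" for r
    using square_integrable_imp_integrable[OF WM[OF that] W_L2[OF that]] .
  have D2: "integrable M (\<lambda>\<omega>. (W r \<omega> - W r' \<omega>)\<^sup>2)" if "0 \<le> r'" "r' \<le> r" for r r'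
    using increment_L2[OF that] by simp
  have upto: "integrable M (\<lambda>\<omega>. \<xi> \<omega> * (W e \<omega> - W a \<omega>) * W e \<omega>) \<and>
     expectation (\<lambda>\<omega>. \<xi> \<omega> * (W e \<omega> - W a \<omega>) * W e \<omega>) = expectation \<xi> * (e - a)" if e: "a \<le> e" for e
  proof -
    have \<xi>1: "integrable M \<xi>" using \<xi>_L2[of "\<lambda>_. 1"] by simp
    have "integrable M (\<lambda>\<omega>. \<xi> \<omega> * W a \<omega>)" by (rule \<xi>_L2[OF W_int[OF ab(1)]])
    moreover have "(\<lambda>\<omega>. \<xi> \<omega> * W a \<omega>) \<in> borel_measurable (Fil a)" using \<xi>(1) W_ad[of a a] ab by simp
    ultimately have "integrable M (\<lambda>\<omega>. \<xi> \<omega> * W a \<omega> * (W e \<omega> - W a \<omega>))" "expectation (\<lambda>\<omega>. \<xi> \<omega> * W a \<omega> * (W e \<omega> - W a \<omega>)) = 0"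
      using past_times_increment_zero[OF ab(1) e] by blast+
    moreover note past_times_increment_square[OF ab(1) e \<xi>(1) \<xi>1]
    moreover have "\<xi> \<omega> * (W e \<omega> - W a \<omega>) * W e \<omega> = \<xi> \<omega> * (W e \<omega> - W a \<omega>)\<^sup>2 + \<xi> \<omega> * W a \<omega> * (W e \<omega> - W a \<omega>)" for \<omega>
      by (simp add: power2_eq_square algebra_simps)
    ultimately show ?thesis by simp
  qed
  consider "d \<le> a" | "a \<le> d" "d \<le> b" | "b \<le> d" by linarith
  then show ?thesis
  proof cases
    case 1
    have "integrable M (\<lambda>\<omega>. \<xi> \<omega> * W d \<omega>)" by (rule \<xi>_L2[OF W_int[OF d]])
    moreover have "(\<lambda>\<omega>. \<xi> \<omega> * W d \<omega>) \<in> borel_measurable (Fil a)" using \<xi>(1) W_ad[OF d 1] by simp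
    ultimately have "expectation (\<lambda>\<omega>. \<xi> \<omega> * W d \<omega> * (W b \<omega> - W a \<omega>)) = 0"
      using past_times_increment_zero(2)[OF ab] by blast
    then show ?thesis using 1 ab by (simp add: mult.assoc mult.commute[of "W d _"])
  next
    case 2
    have "integrable M (\<lambda>\<omega>. \<xi> \<omega> * W d \<omega>)" by (rule \<xi>_L2[OF W_int[OF d]])
    moreover have "(\<lambda>\<omega>. \<xi> \<omega> * W d \<omega>) \<in> borel_measurable (Fil d)"
      using Fil_measurable_mono[OF \<xi>(1) 2(1)] W_ad[OF d order_refl] by simp
    ultimately have "integrable M (\<lambda>\<omega>. \<xi> \<omega> * W d \<omega> * (W b \<omega> - W d \<omega>))" "expectation (\<lambda>\<omega>. \<xi> \<omega> * W d \<omega> * (W b \<omega> - W d \<omega>)) = 0"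
      using past_times_increment_zero[OF d 2(2)] by blast+
    moreover note upto[OF 2(1)]
    moreover have "\<xi> \<omega> * (W b \<omega> - W a \<omega>) * W d \<omega> = \<xi> \<omega> * (W d \<omega> - W a \<omega>) * W d \<omega> + \<xi> \<omega> * W d \<omega> * (W b \<omega> - W d \<omega>)" for \<omega>
      by (simp add: algebra_simps)
    ultimately show ?thesis using 2 by simp
  next
    case 3
    have b: "0 \<le> b" using ab by simp
    have "integrable M (\<lambda>\<omega>. \<xi> \<omega> * (W b \<omega> - W a \<omega>))" by (rule \<xi>_L2) (use W_int ab b in auto)
    moreover have "(\<lambda>\<omega>. \<xi> \<omega> * (W b \<omega> - W a \<omega>)) \<in> borel_measurable (Fil b)"
      using Fil_measurable_mono[OF \<xi>(1) ab(2)] W_ad[OF b order_refl] W_ad[OF ab] by simp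
    ultimately have "integrable M (\<lambda>\<omega>. \<xi> \<omega> * (W b \<omega> - W a \<omega>) * (W d \<omega> - W b \<omega>))" "expectation (\<lambda>\<omega>. \<xi> \<omega> * (W b \<omega> - W a \<omega>) * (W d \<omega> - W b \<omega>)) = 0"
      using past_times_increment_zero[OF b 3] by blast+
    moreover note upto[OF ab(2)]
    moreover have "\<xi> \<omega> * (W b \<omega> - W a \<omega>) * W d \<omega> = \<xi> \<omega> * (W b \<omega> - W a \<omega>) * W b \<omega> + \<xi> \<omega> * (W b \<omega> - W a \<omega>) * (W d \<omega> - W b \<omega>)" for \<omega>
      by (simp add: algebra_simps)
    ultimately show ?thesis using 3 ab by simp
  qed
qed

lemma has_bochner_integral_half_open:
  fixes g :: "real \<Rightarrow> real"
  assumes "continuous_on {a..b} g"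
  shows "has_bochner_integral lborel (\<lambda>s. indicator {a<..b} s * g s) (integral {a..b} g)"
proof -
  have "set_integrable lborel {a..b} g" by (rule borel_integrable_atLeastAtMost'[OF assms])
  then have "has_bochner_integral lborel (\<lambda>s. indicator {a..b} s * g s) (integral {a..b} g)"
    using set_borel_integral_eq_integral(2)[of "{a..b}" g]
    by (simp add: has_bochner_integral_iff set_integrable_def set_lebesgue_integral_def)
  moreover have m: "(\<lambda>s. indicator {a<..b} s * g s) \<in> borel_measurable lborel"
  proof -
    have "continuous_on {a<..b} g" by (rule continuous_on_subset[OF assms]) auto
    from borel_measurable_continuous_on_indicator[OF _ this] show ?thesis by simp
  qed
  moreover have "AE s in lborel. indicator {a..b} s * g s = indicator {a<..b} s * g s"
    using AE_lborel_singleton[of a] by eventually_elim (auto simp: indicator_def)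
  ultimately show ?thesis
    by (subst (asm) has_bochner_integral_cong_AE[OF _ m]) (use borel_measurable_continuous_on_indicator[OF _ assms] in auto)
qed

context
  fixes T :: real and \<phi> \<phi>' :: "real \<Rightarrow> real"
  assumes T: "0 \<le> T"
    and \<phi>: "\<And>s. s \<in> {0..T} \<Longrightarrow> (\<phi> has_real_derivative \<phi>' s) (at s within {0..T})"
    and \<phi>': "continuous_on {0..T} \<phi>'"
begin

text \<open>The Wiener integral of \<open>\<phi>\<close> over \<open>[0, T]\<close>, written pathwise by integration by parts.\<close>

definition wiener_version :: "'a \<Rightarrow> real" where
  "wiener_version \<omega> = \<phi> T * W T \<omega> - (LINT s:{0..T}|lborel. \<phi>' s * W s \<omega>)"

lemma wiener_version_measurable: "wiener_version \<in> borel_measurable (Fil T)"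
proof -
  have "(\<lambda>\<omega>. LINT s:{0..T}|lborel. \<phi>' s * W s \<omega>) \<in> borel_measurable (Fil T)"
  proof (rule Fil_integral_measurable[OF T])
    show "(\<lambda>\<omega>. \<phi>' s * W s \<omega>) \<in> borel_measurable (Fil T)" if "0 \<le> s" "s \<le> T" for s
      using W_adapted[OF that] by simp
    show "AE \<omega> in M. continuous_on {0..T} (\<lambda>s. \<phi>' s * W s \<omega>)"
      using W_paths by eventually_elim (auto intro!: continuous_on_mult \<phi>' elim: continuous_on_subset)
  qed
  then show ?thesis unfolding wiener_version_def using W_adapted[OF T order_refl] by simp
qed

lemma \<phi>'_bound: obtains K where "\<forall>s\<in>{0..T}. \<bar>\<phi>' s\<bar> \<le> K" "0 \<le> K"
proof -
  have "bounded (\<phi>' ` {0..T})" by (intro compact_imp_bounded compact_continuous_image \<phi>' compact_Icc)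
  then obtain K where "\<forall>x\<in>\<phi>' ` {0..T}. norm x \<le> K" unfolding bounded_iff by (rule exE)
  then have "\<forall>s\<in>{0..T}. \<bar>\<phi>' s\<bar> \<le> K" by simp
  moreover from this T have "0 \<le> K" by force
  ultimately show ?thesis by (rule that)
qed

lemma wiener_version_bound:
  obtains C \<Lambda> where "0 \<le> C" "\<Lambda> \<in> borel_measurable M" "AE \<omega> in M. \<forall>t\<in>{0..T}. \<bar>W t \<omega>\<bar> \<le> \<Lambda> \<omega>"
    "integrable M (\<lambda>\<omega>. (\<Lambda> \<omega>)\<^sup>2)" "AE \<omega> in M. \<bar>wiener_version \<omega>\<bar> \<le> C * \<Lambda> \<omega>"
proof -
  obtain \<Lambda> where \<Lambda>: "\<Lambda> \<in> borel_measurable M" "AE \<omega> in M. \<forall>t\<in>{0..T}. \<bar>W t \<omega>\<bar> \<le> \<Lambda> \<omega>"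
    "\<forall>c\<ge>0. integrable M (\<lambda>\<omega>. exp (c * \<Lambda> \<omega>))"
    by (rule running_sup_exp_moments[of T])
  obtain K where K: "\<forall>s\<in>{0..T}. \<bar>\<phi>' s\<bar> \<le> K" "0 \<le> K" by (rule \<phi>'_bound)
  have "integrable M (\<lambda>\<omega>. (\<Lambda> \<omega>)\<^sup>2)"
  proof (rule Bochner_Integration.integrable_bound[OF \<Lambda>(3)[rule_format, of 2]])
    show "AE \<omega> in M. norm ((\<Lambda> \<omega>)\<^sup>2) \<le> norm (exp (2 * \<Lambda> \<omega>))"
      using \<Lambda>(2)
    proof eventually_elim
      case (elim \<omega>)
      then have "0 \<le> \<Lambda> \<omega>" using T by force
      moreover have "\<Lambda> \<omega> \<le> exp (\<Lambda> \<omega>)" using exp_ge_add_one_self[of "\<Lambda> \<omega>"] by linarith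
      ultimately have "(\<Lambda> \<omega>)\<^sup>2 \<le> (exp (\<Lambda> \<omega>))\<^sup>2" by (intro power_mono)
      then show ?case by (simp add: exp_double)
    qed
  qed (use \<Lambda>(1) in auto)
  moreover have "AE \<omega> in M. \<bar>wiener_version \<omega>\<bar> \<le> (\<bar>\<phi> T\<bar> + T * K) * \<Lambda> \<omega>"
    using \<Lambda>(2) W_paths
  proof eventually_elim
    case (elim \<omega>)
    have c: "continuous_on {0..T} (\<lambda>s. \<phi>' s * W s \<omega>)"
      by (intro continuous_on_mult \<phi>' continuous_on_subset[OF elim(2)]) auto
    have "\<bar>LINT s:{0..T}|lborel. \<phi>' s * W s \<omega>\<bar> = norm (integral {0..T} (\<lambda>s. \<phi>' s * W s \<omega>))"
      using set_borel_integral_eq_integral(2)[OF borel_integrable_atLeastAtMost'[OF c]] by simp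
    also have "\<dots> \<le> (K * \<Lambda> \<omega>) * (T - 0)"
    proof (rule integral_bound[OF T c])
      fix s assume s: "s \<in> {0..T}"
      show "norm (\<phi>' s * W s \<omega>) \<le> K * \<Lambda> \<omega>"
        unfolding real_norm_def abs_mult using K s elim(1) by (intro mult_mono) auto
    qed
    finally have 1: "\<bar>LINT s:{0..T}|lborel. \<phi>' s * W s \<omega>\<bar> \<le> T * K * \<Lambda> \<omega>" by (simp add: mult.commute mult.left_commute)
    have "\<bar>W T \<omega>\<bar> \<le> \<Lambda> \<omega>" using elim(1) T by simp
    then have "\<bar>\<phi> T * W T \<omega>\<bar> \<le> \<bar>\<phi> T\<bar> * \<Lambda> \<omega>" unfolding abs_mult by (intro mult_left_mono) auto
    with 1 show ?case unfolding wiener_version_def distrib_right by linarith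
  qed
  moreover have "0 \<le> \<bar>\<phi> T\<bar> + T * K" using T K(2) by simp
  ultimately show ?thesis using \<Lambda>(1,2) by (intro that)
qed

lemma wiener_version_L2: "integrable M (\<lambda>\<omega>. (wiener_version \<omega>)\<^sup>2)"
proof -
  obtain C \<Lambda> where C: "0 \<le> C" "\<Lambda> \<in> borel_measurable M" "AE \<omega> in M. \<forall>t\<in>{0..T}. \<bar>W t \<omega>\<bar> \<le> \<Lambda> \<omega>"
    "integrable M (\<lambda>\<omega>. (\<Lambda> \<omega>)\<^sup>2)" "AE \<omega> in M. \<bar>wiener_version \<omega>\<bar> \<le> C * \<Lambda> \<omega>" by (rule wiener_version_bound)
  show ?thesis
  proof (rule Bochner_Integration.integrable_bound[of M "\<lambda>\<omega>. C\<^sup>2 * (\<Lambda> \<omega>)\<^sup>2"])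
    show "AE \<omega> in M. norm ((wiener_version \<omega>)\<^sup>2) \<le> norm (C\<^sup>2 * (\<Lambda> \<omega>)\<^sup>2)"
      using C(5)
    proof eventually_elim
      case (elim \<omega>)
      from power_mono[OF elim, of 2] show ?case by (simp add: power_mult_distrib)
    qed
  qed (use C measurable_from_Fil[OF wiener_version_measurable] in auto)
qed

text \<open>Fubini, applied to the modification \<open>V\<close> of \<open>W\<close> that vanishes on the null set where the path is not
  continuous: only the modification is jointly measurable.\<close>

lemma expectation_times_wiener_version:
  assumes Y: "Y \<in> borel_measurable M" "integrable M (\<lambda>\<omega>. (Y \<omega>)\<^sup>2)"
  shows "expectation (\<lambda>\<omega>. Y \<omega> * wiener_version \<omega>)
    = \<phi> T * expectation (\<lambda>\<omega>. Y \<omega> * W T \<omega>) - (LINT s:{0..T}|lborel. \<phi>' s * expectation (\<lambda>\<omega>. Y \<omega> * W s \<omega>))"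
proof -
  obtain C \<Lambda> where C: "0 \<le> C" "\<Lambda> \<in> borel_measurable M" "AE \<omega> in M. \<forall>t\<in>{0..T}. \<bar>W t \<omega>\<bar> \<le> \<Lambda> \<omega>"
    "integrable M (\<lambda>\<omega>. (\<Lambda> \<omega>)\<^sup>2)" "AE \<omega> in M. \<bar>wiener_version \<omega>\<bar> \<le> C * \<Lambda> \<omega>" by (rule wiener_version_bound)
  obtain K where K: "\<forall>s\<in>{0..T}. \<bar>\<phi>' s\<bar> \<le> K" "0 \<le> K" by (rule \<phi>'_bound)
  have "AE \<omega> in M. continuous_on {0..} (\<lambda>t. W t \<omega>) \<and> (\<forall>t\<in>{0..T}. \<bar>W t \<omega>\<bar> \<le> \<Lambda> \<omega>)"
    using W_paths C(3) by eventually_elim auto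
  then obtain N where N: "\<forall>\<omega>\<in>space M - N. continuous_on {0..} (\<lambda>t. W t \<omega>) \<and> (\<forall>t\<in>{0..T}. \<bar>W t \<omega>\<bar> \<le> \<Lambda> \<omega>)" "N \<in> null_sets M"
    by (rule AE_null_setE)
  define V where "V s \<omega> = (if \<omega> \<in> N then 0 else W s \<omega>)" for s \<omega>
  have V_meas: "(\<lambda>(\<omega>, s). V (max 0 (min T s)) \<omega>) \<in> borel_measurable (M \<Otimes>\<^sub>M borel)"
  proof (rule continuous_process_measurable_pair[OF _ _ T])
    show "V s \<in> borel_measurable M" if "0 \<le> s" "s \<le> T" for s
      unfolding V_def using W_measurable[OF that(1)] N(2) by (intro measurable_If_set) auto
    show "continuous_on {0..T} (\<lambda>s. V s \<omega>)" if "\<omega> \<in> space M" for \<omega>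
      using N(1)[rule_format, of \<omega>] that by (cases "\<omega> \<in> N") (auto simp: V_def elim: continuous_on_subset)
  qed
  let ?\<psi> = "\<lambda>s. indicator {0..T} s * \<phi>' s"
  have \<psi>_meas: "?\<psi> \<in> borel_measurable borel"
    using borel_measurable_continuous_on_indicator[OF _ \<phi>'] by simp
  define f where "f \<omega> s = Y \<omega> * (?\<psi> s * V (max 0 (min T s)) \<omega>)" for \<omega> s
  have f_meas: "case_prod f \<in> borel_measurable (M \<Otimes>\<^sub>M lborel)"
    unfolding f_def using V_meas \<psi>_meas Y(1) by (simp add: split_def)
  interpret P: pair_sigma_finite M lborel ..
  have Y\<Lambda>: "integrable M (\<lambda>\<omega>. \<bar>Y \<omega>\<bar> * \<Lambda> \<omega>)" using C(2,4) Y by (intro integrable_mult_L2) auto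
  have f_bound: "\<bar>f \<omega> s\<bar> \<le> \<bar>Y \<omega>\<bar> * \<Lambda> \<omega> * K * indicator {0..T} s" if "\<omega> \<in> space M - N" for \<omega> s
  proof (cases "s \<in> {0..T}")
    case True
    then have "\<bar>W s \<omega>\<bar> \<le> \<Lambda> \<omega>" using N(1)[rule_format, OF that] by auto
    then have "\<bar>\<phi>' s\<bar> * \<bar>W s \<omega>\<bar> \<le> K * \<Lambda> \<omega>" using K True by (intro mult_mono) auto
    then have "\<bar>Y \<omega>\<bar> * (\<bar>\<phi>' s\<bar> * \<bar>W s \<omega>\<bar>) \<le> \<bar>Y \<omega>\<bar> * (K * \<Lambda> \<omega>)" by (intro mult_left_mono) auto
    then show ?thesis using True that by (simp add: f_def V_def abs_mult mult_ac)
  qed (simp add: f_def)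
  have int_ind: "integrable lborel (\<lambda>s. c * indicator {0..T} s :: real)" for c
    by (intro integrable_mult_right integrable_real_indicator) (auto simp: emeasure_lborel_Icc_eq)
  have f_int: "integrable (M \<Otimes>\<^sub>M lborel) (case_prod f)"
  proof (rule P.Fubini_integrable[OF f_meas])
    have f_sec: "(\<lambda>s. f \<omega> s) \<in> borel_measurable lborel" if "\<omega> \<in> space M" for \<omega>
      using measurable_Pair2[OF f_meas that] by simp
    have sec: "integrable lborel (f \<omega>)" if "\<omega> \<in> space M - N" for \<omega>
      using f_sec[of \<omega>] that f_bound[OF that]
      by (intro Bochner_Integration.integrable_bound[OF int_ind[of "\<bar>Y \<omega>\<bar> * \<Lambda> \<omega> * K"]])
        (auto intro!: AE_I2 intro: order_trans[OF _ abs_ge_self])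
    show "AE \<omega> in M. integrable lborel (\<lambda>s. case_prod f (\<omega>, s))"
      using AE_not_in[OF N(2)] AE_space by eventually_elim (simp add: sec)
    show "integrable M (\<lambda>\<omega>. \<integral>s. norm (case_prod f (\<omega>, s)) \<partial>lborel)"
    proof (rule Bochner_Integration.integrable_bound[of M "\<lambda>\<omega>. \<bar>Y \<omega>\<bar> * \<Lambda> \<omega> * (K * T)"])
      show "(\<lambda>\<omega>. \<integral>s. norm (case_prod f (\<omega>, s)) \<partial>lborel) \<in> borel_measurable M"
        using f_meas by (intro lborel.borel_measurable_lebesgue_integral) (simp add: split_def)
      show "AE \<omega> in M. norm (\<integral>s. norm (case_prod f (\<omega>, s)) \<partial>lborel) \<le> norm (\<bar>Y \<omega>\<bar> * \<Lambda> \<omega> * (K * T))"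
        using AE_not_in[OF N(2)] AE_space
      proof eventually_elim
        case (elim \<omega>)
        have "(\<integral>s. norm (f \<omega> s) \<partial>lborel) \<le> (\<integral>s. \<bar>Y \<omega>\<bar> * \<Lambda> \<omega> * K * indicator {0..T} s \<partial>lborel)"
          using sec[of \<omega>] f_bound[of \<omega>] elim int_ind by (intro integral_mono) auto
        also have "\<dots> = \<bar>Y \<omega>\<bar> * \<Lambda> \<omega> * (K * T)" using T by simp
        finally show ?case by (simp add: abs_of_nonneg)
      qed
    qed (use Y\<Lambda> in simp)
  qed
  have Wint: "integrable M (\<lambda>\<omega>. Y \<omega> * W s \<omega>)" if "0 \<le> s" for s
    using integrable_mult_L2[OF Y(1) W_measurable[OF that] Y(2) W_L2[OF that]] .
  have V_AE: "AE \<omega> in M. V s \<omega> = W s \<omega>" for s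
    using AE_not_in[OF N(2)] by eventually_elim (simp add: V_def)
  have V_M: "V s \<in> borel_measurable M" if "0 \<le> s" for s
      unfolding V_def using W_measurable[OF that(1)] N(2) by (intro measurable_If_set) auto
  have "expectation (\<lambda>\<omega>. \<integral>s. f \<omega> s \<partial>lborel) = (\<integral>s. expectation (\<lambda>\<omega>. f \<omega> s) \<partial>lborel)"
    using P.Fubini_integral[OF f_int] by simp
  also have "\<dots> = (LINT s:{0..T}|lborel. \<phi>' s * expectation (\<lambda>\<omega>. Y \<omega> * W s \<omega>))"
    unfolding set_lebesgue_integral_def
  proof (rule Bochner_Integration.integral_cong[OF refl])
    fix s
    have "expectation (\<lambda>\<omega>. f \<omega> s) = ?\<psi> s * expectation (\<lambda>\<omega>. Y \<omega> * V (max 0 (min T s)) \<omega>)"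
    proof -
      have "f \<omega> s = ?\<psi> s * (Y \<omega> * V (max 0 (min T s)) \<omega>)" for \<omega> by (simp add: f_def)
      then show ?thesis by simp
    qed
    also have "expectation (\<lambda>\<omega>. Y \<omega> * V (max 0 (min T s)) \<omega>) = expectation (\<lambda>\<omega>. Y \<omega> * W (max 0 (min T s)) \<omega>)"
      using V_AE[of "max 0 (min T s)"] Y(1) V_M W_measurable by (intro integral_cong_AE) auto
    finally show "expectation (\<lambda>\<omega>. f \<omega> s) = indicat_real {0..T} s *\<^sub>R (\<phi>' s * expectation (\<lambda>\<omega>. Y \<omega> * W s \<omega>))"
      by (auto simp: indicator_def max_def min_def)
  qed
  finally have fub: "expectation (\<lambda>\<omega>. \<integral>s. f \<omega> s \<partial>lborel) = \<dots>" .
  have fY: "AE \<omega> in M. Y \<omega> * wiener_version \<omega> = \<phi> T * (Y \<omega> * W T \<omega>) - (\<integral>s. f \<omega> s \<partial>lborel)"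
    using AE_not_in[OF N(2)]
  proof eventually_elim
    case (elim \<omega>)
    have "(\<integral>s. f \<omega> s \<partial>lborel) = Y \<omega> * (\<integral>s. ?\<psi> s * V (max 0 (min T s)) \<omega> \<partial>lborel)" by (simp add: f_def)
    also have "(\<integral>s. ?\<psi> s * V (max 0 (min T s)) \<omega> \<partial>lborel) = (LINT s:{0..T}|lborel. \<phi>' s * W s \<omega>)"
      unfolding set_lebesgue_integral_def using elim
      by (intro Bochner_Integration.integral_cong) (auto simp: V_def indicator_def)
    finally show ?case by (simp add: wiener_version_def algebra_simps)
  qed
  have If: "integrable M (\<lambda>\<omega>. \<integral>s. f \<omega> s \<partial>lborel)" using P.integrable_fst'[OF f_int] by simp
  have "expectation (\<lambda>\<omega>. Y \<omega> * wiener_version \<omega>) = expectation (\<lambda>\<omega>. \<phi> T * (Y \<omega> * W T \<omega>) - (\<integral>s. f \<omega> s \<partial>lborel))"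
    using fY Y(1) measurable_from_Fil[OF wiener_version_measurable] If Wint[OF T] W_measurable[OF T]
    by (intro integral_cong_AE) auto
  also have "\<dots> = \<phi> T * expectation (\<lambda>\<omega>. Y \<omega> * W T \<omega>) - expectation (\<lambda>\<omega>. \<integral>s. f \<omega> s \<partial>lborel)"
    using If Wint[OF T] by simp
  finally show ?thesis unfolding fub .
qed

lemma \<phi>_continuous: "continuous_on {0..T} \<phi>"
  by (rule DERIV_continuous_on[OF \<phi>])

text \<open>Integration by parts; the integrand has a kink at \<open>d\<close>, so the interval is split there.\<close>

lemma integral_\<phi>'_min:
  assumes d: "0 \<le> d" "d \<le> T"
  shows "\<phi> T * d - (LINT s:{0..T}|lborel. \<phi>' s * min s d) = integral {0..d} \<phi>"
proof -
  have 1: "((\<lambda>s. \<phi>' s * s) has_integral (\<phi> d * d - integral {0..d} \<phi>) - (\<phi> 0 * 0 - integral {0..0} \<phi>)) {0..d}"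
  proof (rule fundamental_theorem_of_calculus[OF d(1)])
    fix s assume s: "s \<in> {0..d}"
    have "((\<lambda>s. \<phi> s * s - integral {0..s} \<phi>) has_real_derivative \<phi>' s * s + 1 * \<phi> s - \<phi> s) (at s within {0..T})"
      using s d by (intro derivative_intros DERIV_mult' \<phi> integral_has_real_derivative[OF \<phi>_continuous])
        (auto intro!: derivative_eq_intros \<phi>)
    then have "((\<lambda>s. \<phi> s * s - integral {0..s} \<phi>) has_real_derivative \<phi>' s * s) (at s within {0..d})"
      using d by (auto intro: DERIV_subset)
    then show "((\<lambda>s. \<phi> s * s - integral {0..s} \<phi>) has_vector_derivative \<phi>' s * s) (at s within {0..d})"
      by (simp add: has_real_derivative_iff_has_vector_derivative)
  qed
  have 2: "((\<lambda>s. \<phi>' s * d) has_integral \<phi> T * d - \<phi> d * d) {d..T}"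
  proof (rule fundamental_theorem_of_calculus[OF d(2)])
    fix s assume s: "s \<in> {d..T}"
    have "(\<phi> has_real_derivative \<phi>' s) (at s within {d..T})"
      using \<phi>[of s] s d by (auto intro: DERIV_subset)
    then have "((\<lambda>s. \<phi> s * d) has_real_derivative \<phi>' s * d) (at s within {d..T})"
      by (auto intro!: derivative_eq_intros)
    then show "((\<lambda>s. \<phi> s * d) has_vector_derivative \<phi>' s * d) (at s within {d..T})"
      by (simp add: has_real_derivative_iff_has_vector_derivative)
  qed
  have "((\<lambda>s. \<phi>' s * min s d) has_integral (\<phi> d * d - integral {0..d} \<phi>) + (\<phi> T * d - \<phi> d * d)) {0..T}"
  proof (rule has_integral_combine[OF d])
    show "((\<lambda>s. \<phi>' s * min s d) has_integral (\<phi> d * d - integral {0..d} \<phi>)) {0..d}"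
      using 1 by (subst has_integral_cong[of _ _ "\<lambda>s. \<phi>' s * s"]) (auto simp: min_def)
    show "((\<lambda>s. \<phi>' s * min s d) has_integral (\<phi> T * d - \<phi> d * d)) {d..T}"
      using 2 by (subst has_integral_cong[of _ _ "\<lambda>s. \<phi>' s * d"]) (auto simp: min_def)
  qed
  moreover have "set_integrable lborel {0..T} (\<lambda>s. \<phi>' s * min s d)"
    by (intro borel_integrable_atLeastAtMost' continuous_intros \<phi>')
  ultimately show ?thesis
    using set_borel_integral_eq_integral(2)[of "{0..T}" "\<lambda>s. \<phi>' s * min s d"] by (simp add: integral_unique)
qed

lemma weighted_increment_times_wiener_version:
  assumes ab: "0 \<le> a" "a \<le> b" "b \<le> T"
    and \<xi>: "\<xi> \<in> borel_measurable (Fil a)" "\<And>\<omega>. \<omega> \<in> space M \<Longrightarrow> \<bar>\<xi> \<omega>\<bar> \<le> C"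
  shows "integrable M (\<lambda>\<omega>. (\<xi> \<omega> * (W b \<omega> - W a \<omega>))\<^sup>2)"
    and "integrable M (\<lambda>\<omega>. \<xi> \<omega> * (W b \<omega> - W a \<omega>) * wiener_version \<omega>)"
    and "expectation (\<lambda>\<omega>. \<xi> \<omega> * (W b \<omega> - W a \<omega>) * wiener_version \<omega>) = expectation \<xi> * integral {a..b} \<phi>"
proof -
  have [measurable]: "\<xi> \<in> borel_measurable M" "W a \<in> borel_measurable M" "W b \<in> borel_measurable M"
    using measurable_from_Fil[OF \<xi>(1)] W_measurable ab by auto
  have "integrable M (\<lambda>\<omega>. (\<xi> \<omega>)\<^sup>2)"
  proof (rule integrable_const_bound[where B = "C\<^sup>2"])
    show "AE \<omega> in M. norm ((\<xi> \<omega>)\<^sup>2) \<le> C\<^sup>2"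
    proof (rule AE_I2)
      fix \<omega> assume "\<omega> \<in> space M"
      from power_mono[OF \<xi>(2)[OF this], of 2] show "norm ((\<xi> \<omega>)\<^sup>2) \<le> C\<^sup>2" by simp
    qed
  qed simp
  from past_times_increment_square(1)[OF ab(1,2) _ this] \<xi>(1)
  show L2: "integrable M (\<lambda>\<omega>. (\<xi> \<omega> * (W b \<omega> - W a \<omega>))\<^sup>2)" by (simp add: power_mult_distrib)
  show "integrable M (\<lambda>\<omega>. \<xi> \<omega> * (W b \<omega> - W a \<omega>) * wiener_version \<omega>)"
    using L2 wiener_version_L2 measurable_from_Fil[OF wiener_version_measurable]
    by (intro integrable_mult_L2) auto
  let ?J = "\<lambda>d. LINT s:{0..T}|lborel. \<phi>' s * min s d"
  have J_int: "set_integrable lborel {0..T} (\<lambda>s. \<phi>' s * min s d)" for d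
    by (intro borel_integrable_atLeastAtMost' continuous_intros \<phi>')
  note cov = weighted_increment_times_W[OF ab(1,2) _ \<xi>]
  have "expectation (\<lambda>\<omega>. \<xi> \<omega> * (W b \<omega> - W a \<omega>) * wiener_version \<omega>)
      = \<phi> T * expectation (\<lambda>\<omega>. \<xi> \<omega> * (W b \<omega> - W a \<omega>) * W T \<omega>)
        - (LINT s:{0..T}|lborel. \<phi>' s * expectation (\<lambda>\<omega>. \<xi> \<omega> * (W b \<omega> - W a \<omega>) * W s \<omega>))"
    using L2 by (intro expectation_times_wiener_version) auto
  also have "expectation (\<lambda>\<omega>. \<xi> \<omega> * (W b \<omega> - W a \<omega>) * W T \<omega>) = expectation \<xi> * (b - a)"
    using cov[OF T] ab by simp
  also have "(LINT s:{0..T}|lborel. \<phi>' s * expectation (\<lambda>\<omega>. \<xi> \<omega> * (W b \<omega> - W a \<omega>) * W s \<omega>))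
      = (LINT s:{0..T}|lborel. expectation \<xi> * (\<phi>' s * min s b - \<phi>' s * min s a))"
  proof (intro set_lebesgue_integral_cong allI impI)
    fix s assume s: "s \<in> {0..T}"
    have "0 \<le> s" using s by simp
    show "\<phi>' s * expectation (\<lambda>\<omega>. \<xi> \<omega> * (W b \<omega> - W a \<omega>) * W s \<omega>) = expectation \<xi> * (\<phi>' s * min s b - \<phi>' s * min s a)"
    proof -
      have "expectation (\<lambda>\<omega>. \<xi> \<omega> * (W b \<omega> - W a \<omega>) * W s \<omega>) = expectation \<xi> * (min s b - min s a)"
        by (rule cov[OF \<open>0 \<le> s\<close>])
      then show ?thesis by (simp only:) (simp only: right_diff_distrib mult_ac)
    qed
  qed simp
  also have "\<dots> = expectation \<xi> * (?J b - ?J a)"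
    using J_int by simp
  also have "\<phi> T * (expectation \<xi> * (b - a)) - \<dots> = expectation \<xi> * ((\<phi> T * b - ?J b) - (\<phi> T * a - ?J a))"
    by (simp add: algebra_simps)
  also have "\<dots> = expectation \<xi> * (integral {0..b} \<phi> - integral {0..a} \<phi>)"
    using ab by (simp add: integral_\<phi>'_min)
  also have "integral {0..b} \<phi> - integral {0..a} \<phi> = integral {a..b} \<phi>"
    using Henstock_Kurzweil_Integration.integral_combine[of 0 a b \<phi>] ab \<phi>_continuous
    by (simp add: integrable_continuous_interval continuous_on_subset)
  finally show "expectation (\<lambda>\<omega>. \<xi> \<omega> * (W b \<omega> - W a \<omega>) * wiener_version \<omega>) = expectation \<xi> * integral {a..b} \<phi>" .
qed

lemma expectation_wiener_version_square:
  "expectation (\<lambda>\<omega>. (wiener_version \<omega>)\<^sup>2) = integral {0..T} (\<lambda>s. (\<phi> s)\<^sup>2)"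
proof -
  let ?\<Phi> = "\<lambda>s. integral {0..s} \<phi>"
  have RM [measurable]: "wiener_version \<in> borel_measurable M" by (rule measurable_from_Fil[OF wiener_version_measurable])
  have cov: "expectation (\<lambda>\<omega>. wiener_version \<omega> * W s \<omega>) = ?\<Phi> s" if s: "s \<in> {0..T}" for s
  proof -
    have [measurable]: "W s \<in> borel_measurable M" "W 0 \<in> borel_measurable M" using W_measurable s by auto
    have "expectation (\<lambda>\<omega>. wiener_version \<omega> * W s \<omega>) = expectation (\<lambda>\<omega>. 1 * (W s \<omega> - W 0 \<omega>) * wiener_version \<omega>)"
      using W_0 by (intro integral_cong_AE) auto
    also have "\<dots> = ?\<Phi> s"
      using s weighted_increment_times_wiener_version(3)[of 0 s "\<lambda>_. 1" 1] by (simp add: prob_space)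
    finally show ?thesis .
  qed
  have \<Phi>': "(?\<Phi> has_real_derivative \<phi> s) (at s within {0..T})" if "s \<in> {0..T}" for s
    by (rule integral_has_real_derivative[OF \<phi>_continuous that])
  have c\<Phi>: "continuous_on {0..T} ?\<Phi>" using \<Phi>' by (intro DERIV_continuous_on)
  have i1: "set_integrable lborel {0..T} (\<lambda>s. \<phi>' s * ?\<Phi> s)"
    by (intro borel_integrable_atLeastAtMost' continuous_intros \<phi>' c\<Phi>)
  have "expectation (\<lambda>\<omega>. (wiener_version \<omega>)\<^sup>2) = \<phi> T * expectation (\<lambda>\<omega>. wiener_version \<omega> * W T \<omega>)
      - (LINT s:{0..T}|lborel. \<phi>' s * expectation (\<lambda>\<omega>. wiener_version \<omega> * W s \<omega>))"
    unfolding power2_eq_square by (rule expectation_times_wiener_version[OF RM wiener_version_L2])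
  also have "\<dots> = \<phi> T * ?\<Phi> T - (LINT s:{0..T}|lborel. \<phi>' s * ?\<Phi> s)"
    using cov T by (simp add: set_lebesgue_integral_cong[of "{0..T}"])
  also have "(LINT s:{0..T}|lborel. \<phi>' s * ?\<Phi> s) = integral {0..T} (\<lambda>s. \<phi>' s * ?\<Phi> s)"
    by (rule set_borel_integral_eq_integral(2)[OF i1])
  also have "\<phi> T * ?\<Phi> T - \<dots> = integral {0..T} (\<lambda>s. (\<phi> s)\<^sup>2)"
  proof -
    have "((\<lambda>s. \<phi> s * \<phi> s + \<phi>' s * ?\<Phi> s) has_integral \<phi> T * ?\<Phi> T - \<phi> 0 * ?\<Phi> 0) {0..T}"
    proof (rule fundamental_theorem_of_calculus[OF T])
      fix s assume s: "s \<in> {0..T}"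
      show "((\<lambda>s. \<phi> s * ?\<Phi> s) has_vector_derivative \<phi> s * \<phi> s + \<phi>' s * ?\<Phi> s) (at s within {0..T})"
        using DERIV_mult'[OF \<phi>[OF s] \<Phi>'[OF s]] by (simp add: has_real_derivative_iff_has_vector_derivative)
    qed
    then have "integral {0..T} (\<lambda>s. \<phi> s * \<phi> s + \<phi>' s * ?\<Phi> s) = \<phi> T * ?\<Phi> T" by (simp add: integral_unique)
    moreover have "integral {0..T} (\<lambda>s. \<phi> s * \<phi> s + \<phi>' s * ?\<Phi> s) = integral {0..T} (\<lambda>s. \<phi> s * \<phi> s) + integral {0..T} (\<lambda>s. \<phi>' s * ?\<Phi> s)"
      by (intro Henstock_Kurzweil_Integration.integral_add integrable_continuous_interval continuous_intros \<phi>' \<phi>_continuous c\<Phi>)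
    ultimately show ?thesis by (simp add: power2_eq_square)
  qed
  finally show ?thesis .
qed

lemma simple_process_times_mono:
  assumes "simple_process M Fil T n \<theta> \<xi>" "i \<le> j" "j \<le> n"
  shows "\<theta> i \<le> \<theta> j"
  using assms(2,3)
proof (induction j)
  case (Suc j)
  show ?case
  proof (cases "i = Suc j")
    case False
    with Suc have "\<theta> i \<le> \<theta> j" by simp
    also have "\<theta> j \<le> \<theta> (Suc j)" using assms(1) Suc.prems by (simp add: simple_process_def)
    finally show ?thesis .
  qed simp
qed simp

text \<open>Ito's isometry for the difference of a simple integral and the pathwise Wiener integral. Both sides are expanded along the
  partition of the simple process: on the left each step adds \<open>E[\<xi>\<^sub>i\<^sup>2] (\<theta>\<^sub>i\<^sub>+\<^sub>1 - \<theta>\<^sub>i)\<close> and the cross term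
  \<open>- 2 E[\<xi>\<^sub>i] \<integral> \<phi>\<close> computed above, while the product with the earlier steps has mean zero. Thus no
  common refinement of two partitions is needed.\<close>

lemma simple_integral_isometry:
  assumes sp: "simple_process M Fil T n \<theta> \<xi>"
  defines "I \<equiv> simple_integral W n \<theta> \<xi>"
  shows "(\<integral>\<^sup>+\<omega>. ennreal ((I \<omega> - wiener_version \<omega>)\<^sup>2) \<partial>M)
    = (\<integral>\<^sup>+s\<in>{0..T}. (\<integral>\<^sup>+\<omega>. ennreal ((simple_value n \<theta> \<xi> s \<omega> - \<phi> s)\<^sup>2) \<partial>M) \<partial>lborel)"
proof -
  note mono = simple_process_times_mono[OF sp]
  have \<theta>: "0 \<le> \<theta> i" "\<theta> i \<le> T" if "i \<le> n" for i using sp that by (auto simp: simple_process_def)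
  have \<theta>_Suc: "\<theta> i \<le> \<theta> (Suc i)" and \<xi>_ad: "\<xi> i \<in> borel_measurable (Fil (\<theta> i))" if "i < n" for i
    using sp that by (auto simp: simple_process_def)
  have "\<exists>C. \<forall>\<omega>\<in>space M. \<bar>\<xi> i \<omega>\<bar> \<le> C" if "i < n" for i using sp that by (auto simp: simple_process_def)
  then obtain C where C: "\<forall>i<n. \<forall>\<omega>\<in>space M. \<bar>\<xi> i \<omega>\<bar> \<le> C i" by metis
  have \<xi>_bd: "\<bar>\<xi> i \<omega>\<bar> \<le> C i" if "i < n" "\<omega> \<in> space M" for i \<omega> using C that by blast
  have \<xi>_M: "\<xi> i \<in> borel_measurable M" if "i < n" for i by (rule measurable_from_Fil[OF \<xi>_ad[OF that]])
  have \<xi>_int: "integrable M (\<xi> i)" if "i < n" for i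
    using \<xi>_M[OF that] \<xi>_bd[OF that] by (intro integrable_const_bound[where B = "C i"] AE_I2) auto
  have \<xi>2_int: "integrable M (\<lambda>\<omega>. (\<xi> i \<omega>)\<^sup>2)" if "i < n" for i
  proof (rule integrable_const_bound[where B = "(C i)\<^sup>2"])
    show "AE \<omega> in M. norm ((\<xi> i \<omega>)\<^sup>2) \<le> (C i)\<^sup>2"
      using \<xi>_bd[OF that] by (intro AE_I2) (metis abs_ge_zero norm_power power_mono real_norm_def)
  qed (use \<xi>_M[OF that] in simp)
  define c where "c i = expectation (\<lambda>\<omega>. (\<xi> i \<omega>)\<^sup>2) * (\<theta> (Suc i) - \<theta> i) - 2 * expectation (\<xi> i) * integral {\<theta> i..\<theta> (Suc i)} \<phi>" for i
  \<comment> \<open>the common value of both sides when only the first \<open>m\<close> steps are used\<close>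
  define V where "V m = integral {0..T} (\<lambda>s. (\<phi> s)\<^sup>2) + (\<Sum>i<m. c i)" for m
  let ?R = wiener_version
  have RM: "?R \<in> borel_measurable M" by (rule measurable_from_Fil[OF wiener_version_measurable])
  have S: "simple_integral W (Suc m) \<theta> \<xi> \<omega> = simple_integral W m \<theta> \<xi> \<omega> + \<xi> m \<omega> * (W (\<theta> (Suc m)) \<omega> - W (\<theta> m) \<omega>)" for m \<omega>
    by (simp add: simple_integral_def)
  have "m \<le> n \<Longrightarrow> simple_integral W m \<theta> \<xi> \<in> borel_measurable (Fil (\<theta> m)) \<and>
     integrable M (\<lambda>\<omega>. (simple_integral W m \<theta> \<xi> \<omega>)\<^sup>2) \<and>
     expectation (\<lambda>\<omega>. (simple_integral W m \<theta> \<xi> \<omega> - ?R \<omega>)\<^sup>2) = V m" for m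
  proof (induction m)
    case 0
    show ?case by (simp add: simple_integral_def[abs_def] V_def expectation_wiener_version_square)
  next
    case (Suc m)
    then have m: "m < n" and IH: "simple_integral W m \<theta> \<xi> \<in> borel_measurable (Fil (\<theta> m))"
      "integrable M (\<lambda>\<omega>. (simple_integral W m \<theta> \<xi> \<omega>)\<^sup>2)"
      "expectation (\<lambda>\<omega>. (simple_integral W m \<theta> \<xi> \<omega> - ?R \<omega>)\<^sup>2) = V m" by auto
    let ?I = "simple_integral W m \<theta> \<xi>" and ?\<Delta> = "\<lambda>\<omega>. W (\<theta> (Suc m)) \<omega> - W (\<theta> m) \<omega>"
    have \<theta>m: "0 \<le> \<theta> m" "\<theta> m \<le> \<theta> (Suc m)" "\<theta> (Suc m) \<le> T" "0 \<le> \<theta> (Suc m)"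
      using \<theta>[of m] \<theta>[of "Suc m"] \<theta>_Suc[OF m] m by auto
    have IM: "?I \<in> borel_measurable M" by (rule measurable_from_Fil[OF IH(1)])
    have \<Delta>M: "?\<Delta> \<in> borel_measurable M" using W_measurable \<theta>m by simp
    note wi = weighted_increment_times_wiener_version[OF \<theta>m(1,2,3) \<xi>_ad[OF m] \<xi>_bd[OF m]]
    have m1: "simple_integral W (Suc m) \<theta> \<xi> \<in> borel_measurable (Fil (\<theta> (Suc m)))"
      unfolding S[abs_def]
      using Fil_measurable_mono[OF IH(1) \<theta>m(2)] Fil_measurable_mono[OF \<xi>_ad[OF m] \<theta>m(2)]
        W_adapted[OF \<theta>m(1,2)] W_adapted[OF \<theta>m(4) order_refl] by simp
    have m2: "integrable M (\<lambda>\<omega>. (simple_integral W (Suc m) \<theta> \<xi> \<omega>)\<^sup>2)"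
      unfolding S using wi(1) IH(2) IM \<Delta>M \<xi>_M[OF m] by (intro integrable_add_L2) auto
    have I\<xi>: "integrable M (\<lambda>\<omega>. ?I \<omega> * \<xi> m \<omega>)"
      using IM IH(2) \<xi>_M[OF m] \<xi>2_int[OF m] by (intro integrable_mult_L2)
    have "(\<lambda>\<omega>. ?I \<omega> * \<xi> m \<omega>) \<in> borel_measurable (Fil (\<theta> m))" using IH(1) \<xi>_ad[OF m] by simp
    note z = past_times_increment_zero[OF \<theta>m(1,2) this I\<xi>]
    have "(\<lambda>\<omega>. (\<xi> m \<omega>)\<^sup>2) \<in> borel_measurable (Fil (\<theta> m))" using \<xi>_ad[OF m] by simp
    note q = past_times_increment_square[OF \<theta>m(1,2) this \<xi>2_int[OF m]]
    have IR: "integrable M (\<lambda>\<omega>. (?I \<omega> - ?R \<omega>)\<^sup>2)"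
      using integrable_add_L2[OF IM _ IH(2), of "\<lambda>\<omega>. - ?R \<omega>"] RM wiener_version_L2 by simp
    have "expectation (\<lambda>\<omega>. (simple_integral W (Suc m) \<theta> \<xi> \<omega> - ?R \<omega>)\<^sup>2)
      = expectation (\<lambda>\<omega>. (?I \<omega> - ?R \<omega>)\<^sup>2 + 2 * (?I \<omega> * \<xi> m \<omega> * ?\<Delta> \<omega>) - 2 * (\<xi> m \<omega> * ?\<Delta> \<omega> * ?R \<omega>) + (\<xi> m \<omega>)\<^sup>2 * (?\<Delta> \<omega>)\<^sup>2)"
      unfolding S by (intro Bochner_Integration.integral_cong refl) (simp add: power2_eq_square algebra_simps)
    also have "\<dots> = V m + 0 - 2 * (expectation (\<xi> m) * integral {\<theta> m..\<theta> (Suc m)} \<phi>) + expectation (\<lambda>\<omega>. (\<xi> m \<omega>)\<^sup>2) * (\<theta> (Suc m) - \<theta> m)"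
      using IR z q wi(2,3) IH(3) by simp
    also have "\<dots> = V (Suc m)" by (simp add: V_def c_def)
    finally show ?case using m1 m2 by blast
  qed
  from this[of n] have In: "I \<in> borel_measurable (Fil (\<theta> n))" "integrable M (\<lambda>\<omega>. (I \<omega>)\<^sup>2)"
    "expectation (\<lambda>\<omega>. (I \<omega> - ?R \<omega>)\<^sup>2) = V n" by (simp_all add: I_def)
  have "integrable M (\<lambda>\<omega>. (I \<omega> - ?R \<omega>)\<^sup>2)"
    using integrable_add_L2[OF measurable_from_Fil[OF In(1)] _ In(2), of "\<lambda>\<omega>. - ?R \<omega>"] RM wiener_version_L2 by simp
  then have left: "(\<integral>\<^sup>+\<omega>. ennreal ((I \<omega> - ?R \<omega>)\<^sup>2) \<partial>M) = ennreal (V n)"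
    using In(3) by (subst nn_integral_eq_integral) auto
  let ?ind = "\<lambda>i. indicator {\<theta> i<..\<theta> (Suc i)} :: real \<Rightarrow> real"
  define Q where "Q m s \<omega> = (\<Sum>i<m. ?ind i s * ((\<xi> i \<omega>)\<^sup>2 - 2 * \<phi> s * \<xi> i \<omega>))" for m s \<omega>
  have Q_Suc: "Q (Suc m) s \<omega> = Q m s \<omega> + ?ind m s * ((\<xi> m \<omega>)\<^sup>2 - 2 * \<phi> s * \<xi> m \<omega>)" for m s \<omega>
    by (simp only: Q_def sum.lessThan_Suc)
  have sv_Suc: "simple_value (Suc m) \<theta> \<xi> s \<omega> = simple_value m \<theta> \<xi> s \<omega> + \<xi> m \<omega> * ?ind m s" for m s \<omega>
    by (simp only: simple_value_def sum.lessThan_Suc)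
  have sq: "m \<le> n \<Longrightarrow> (simple_value m \<theta> \<xi> s \<omega> - \<phi> s)\<^sup>2 = (\<phi> s)\<^sup>2 + Q m s \<omega>" for m s \<omega>
  proof (induction m)
    case 0
    show ?case by (simp add: simple_value_def Q_def)
  next
    case (Suc m)
    show ?case
    proof (cases "s \<in> {\<theta> m<..\<theta> (Suc m)}")
      case True
      have "indicator {\<theta> i<..\<theta> (Suc i)} s = (0::real)" if "i < m" for i
        using mono[of "Suc i" m] that Suc.prems True by auto
      then have "simple_value m \<theta> \<xi> s \<omega> = 0" unfolding simple_value_def by (intro sum.neutral) auto
      moreover have "?ind m s = 1" using True by simp
      ultimately show ?thesis using Suc unfolding Q_Suc sv_Suc
        by (simp add: power2_eq_square algebra_simps)
    next
      case False
      then have "?ind m s = 0" by simp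
      then show ?thesis using Suc unfolding Q_Suc sv_Suc by simp
    qed
  qed
  define e where "e s = (\<phi> s)\<^sup>2 + (\<Sum>i<n. ?ind i s * (expectation (\<lambda>\<omega>. (\<xi> i \<omega>)\<^sup>2) - 2 * \<phi> s * expectation (\<xi> i)))" for s
  have sv_int: "integrable M (\<lambda>\<omega>. (simple_value n \<theta> \<xi> s \<omega> - \<phi> s)\<^sup>2)"
    and sv_E: "expectation (\<lambda>\<omega>. (simple_value n \<theta> \<xi> s \<omega> - \<phi> s)\<^sup>2) = e s" for s
  proof -
    have t: "integrable M (\<lambda>\<omega>. ?ind i s * ((\<xi> i \<omega>)\<^sup>2 - 2 * \<phi> s * \<xi> i \<omega>))"
      "expectation (\<lambda>\<omega>. ?ind i s * ((\<xi> i \<omega>)\<^sup>2 - 2 * \<phi> s * \<xi> i \<omega>))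
        = ?ind i s * (expectation (\<lambda>\<omega>. (\<xi> i \<omega>)\<^sup>2) - 2 * \<phi> s * expectation (\<xi> i))" if "i \<in> {..<n}" for i
      using \<xi>_int[of i] \<xi>2_int[of i] that by simp_all
    have Q_int: "integrable M (Q n s)" unfolding Q_def[abs_def] by (intro Bochner_Integration.integrable_sum t)
    have "expectation (Q n s) = (\<Sum>i<n. expectation (\<lambda>\<omega>. ?ind i s * ((\<xi> i \<omega>)\<^sup>2 - 2 * \<phi> s * \<xi> i \<omega>)))"
      unfolding Q_def[abs_def] by (intro Bochner_Integration.integral_sum t(1))
    also have "\<dots> = (\<Sum>i<n. ?ind i s * (expectation (\<lambda>\<omega>. (\<xi> i \<omega>)\<^sup>2) - 2 * \<phi> s * expectation (\<xi> i)))"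
      by (intro sum.cong refl t(2))
    finally have Q_E: "expectation (Q n s) = e s - (\<phi> s)\<^sup>2" by (simp only: e_def add_diff_cancel_left')
    show "integrable M (\<lambda>\<omega>. (simple_value n \<theta> \<xi> s \<omega> - \<phi> s)\<^sup>2)"
      "expectation (\<lambda>\<omega>. (simple_value n \<theta> \<xi> s \<omega> - \<phi> s)\<^sup>2) = e s"
      unfolding sq[OF order_refl] using Q_int Q_E by (simp_all add: prob_space)
  qed
  have inner: "(\<integral>\<^sup>+\<omega>. ennreal ((simple_value n \<theta> \<xi> s \<omega> - \<phi> s)\<^sup>2) \<partial>M) = ennreal (e s)" for s
    using sv_int[of s] sv_E[of s] by (subst nn_integral_eq_integral) auto
  have e_nonneg: "0 \<le> e s" for s unfolding sv_E[symmetric] by simp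
  have e_int: "has_bochner_integral lborel (\<lambda>s. indicator {0<..T} s * e s) (V n)"
  proof -
    have piece: "has_bochner_integral lborel (\<lambda>s. ?ind i s * (expectation (\<lambda>\<omega>. (\<xi> i \<omega>)\<^sup>2) - 2 * \<phi> s * expectation (\<xi> i))) (c i)" if i: "i < n" for i
    proof -
      have sub: "{\<theta> i..\<theta> (Suc i)} \<subseteq> {0..T}" using \<theta>[of i] \<theta>[of "Suc i"] i by auto
      have c\<phi>: "continuous_on {\<theta> i..\<theta> (Suc i)} \<phi>" by (rule continuous_on_subset[OF \<phi>_continuous sub])
      have "integral {\<theta> i..\<theta> (Suc i)} (\<lambda>s. expectation (\<lambda>\<omega>. (\<xi> i \<omega>)\<^sup>2) - 2 * \<phi> s * expectation (\<xi> i))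
        = integral {\<theta> i..\<theta> (Suc i)} (\<lambda>s. expectation (\<lambda>\<omega>. (\<xi> i \<omega>)\<^sup>2)) - integral {\<theta> i..\<theta> (Suc i)} (\<lambda>s. 2 * \<phi> s * expectation (\<xi> i))"
        by (intro Henstock_Kurzweil_Integration.integral_diff integrable_continuous_interval continuous_intros c\<phi>)
      also have "integral {\<theta> i..\<theta> (Suc i)} (\<lambda>s. 2 * \<phi> s * expectation (\<xi> i)) = integral {\<theta> i..\<theta> (Suc i)} \<phi> * (2 * expectation (\<xi> i))"
        by (subst Henstock_Kurzweil_Integration.integral_mult_left[symmetric]) (simp_all add: mult_ac)
      finally have "integral {\<theta> i..\<theta> (Suc i)} (\<lambda>s. expectation (\<lambda>\<omega>. (\<xi> i \<omega>)\<^sup>2) - 2 * \<phi> s * expectation (\<xi> i)) = c i"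
        using \<theta>_Suc[OF i] by (simp add: c_def algebra_simps)
      then show ?thesis
        using has_bochner_integral_half_open[of "\<theta> i" "\<theta> (Suc i)" "\<lambda>s. expectation (\<lambda>\<omega>. (\<xi> i \<omega>)\<^sup>2) - 2 * \<phi> s * expectation (\<xi> i)"] c\<phi>
        by (simp add: continuous_intros)
    qed
    have first: "has_bochner_integral lborel (\<lambda>s. indicator {0<..T} s * (\<phi> s)\<^sup>2) (integral {0..T} (\<lambda>s. (\<phi> s)\<^sup>2))"
      by (intro has_bochner_integral_half_open continuous_intros \<phi>_continuous)
    have "indicator {0<..T} s * e s = indicator {0<..T} s * (\<phi> s)\<^sup>2 + (\<Sum>i<n. ?ind i s * (expectation (\<lambda>\<omega>. (\<xi> i \<omega>)\<^sup>2) - 2 * \<phi> s * expectation (\<xi> i)))" for s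
    proof -
      have "indicator {0<..T} s * ?ind i s = ?ind i s" if "i < n" for i
        using \<theta>[of i] \<theta>[of "Suc i"] that by (auto simp: indicator_def)
      then show ?thesis unfolding e_def distrib_left sum_distrib_left mult.assoc[symmetric]
        by (intro arg_cong2[where f = "(+)"] refl sum.cong) simp_all
    qed
    then show ?thesis unfolding V_def using first piece
      by (simp only:) (intro has_bochner_integral_add has_bochner_integral_sum; simp)
  qed
  have "(\<integral>\<^sup>+s\<in>{0..T}. (\<integral>\<^sup>+\<omega>. ennreal ((simple_value n \<theta> \<xi> s \<omega> - \<phi> s)\<^sup>2) \<partial>M) \<partial>lborel)
      = (\<integral>\<^sup>+s. ennreal (indicator {0<..T} s * e s) \<partial>lborel)"
    unfolding inner
  proof (rule nn_integral_cong_AE)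
    show "AE s in lborel. ennreal (e s) * indicator {0..T} s = ennreal (indicator {0<..T} s * e s)"
      using AE_lborel_singleton[of 0] by eventually_elim (auto simp: indicator_def)
  qed
  also have "\<dots> = ennreal (V n)"
    using e_int e_nonneg by (subst nn_integral_eq_integral) (auto simp: has_bochner_integral_iff)
  finally show ?thesis using left by simp
qed

text \<open>By the isometry the approximating simple integrals converge in \<open>L\<^sup>2\<close> both to the given version and to the
  pathwise expression.\<close>

lemma ito_integral_deterministic:
  assumes ito: "has_ito_integral M Fil W T (\<lambda>s \<omega>. \<phi> s) X"
  shows "AE \<omega> in M. X \<omega> = wiener_version \<omega>"
proof -
  let ?R = wiener_version
  have X: "X \<in> borel_measurable M" using ito measurable_from_Fil by (auto simp: has_ito_integral_def)
  have R: "?R \<in> borel_measurable M" by (rule measurable_from_Fil[OF wiener_version_measurable])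
  obtain n \<theta> \<xi> where sp: "\<forall>k. simple_process M Fil T (n k) (\<theta> k) (\<xi> k)"
    and 1: "(\<lambda>k. \<integral>\<^sup>+s\<in>{0..T}. (\<integral>\<^sup>+\<omega>. ennreal ((simple_value (n k) (\<theta> k) (\<xi> k) s \<omega> - \<phi> s)\<^sup>2) \<partial>M) \<partial>lborel) \<longlonglongrightarrow> 0"
    and 2: "(\<lambda>k. \<integral>\<^sup>+\<omega>. ennreal ((simple_integral W (n k) (\<theta> k) (\<xi> k) \<omega> - X \<omega>)\<^sup>2) \<partial>M) \<longlonglongrightarrow> 0"
    using ito unfolding has_ito_integral_def by blast
  let ?I = "\<lambda>k. simple_integral W (n k) (\<theta> k) (\<xi> k)"
  have IM: "?I k \<in> borel_measurable M" for k
  proof -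
    have "\<xi> k i \<in> borel_measurable M" "W (\<theta> k i) \<in> borel_measurable M" "W (\<theta> k (Suc i)) \<in> borel_measurable M" if "i < n k" for i
      using sp[rule_format, of k] that by (auto simp: simple_process_def intro: measurable_from_Fil intro!: W_measurable)
    then show ?thesis unfolding simple_integral_def[abs_def] by (intro borel_measurable_sum borel_measurable_times borel_measurable_diff) auto
  qed
  have 3: "(\<lambda>k. \<integral>\<^sup>+\<omega>. ennreal ((?I k \<omega> - ?R \<omega>)\<^sup>2) \<partial>M) \<longlonglongrightarrow> 0"
    using 1 simple_integral_isometry sp by simp
  have "(\<integral>\<^sup>+\<omega>. ennreal ((X \<omega> - ?R \<omega>)\<^sup>2) \<partial>M) \<le>
      2 * (\<integral>\<^sup>+\<omega>. ennreal ((?I k \<omega> - X \<omega>)\<^sup>2) \<partial>M) + 2 * (\<integral>\<^sup>+\<omega>. ennreal ((?I k \<omega> - ?R \<omega>)\<^sup>2) \<partial>M)" for k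
  proof -
    have "ennreal ((X \<omega> - ?R \<omega>)\<^sup>2) \<le> 2 * ennreal ((?I k \<omega> - X \<omega>)\<^sup>2) + 2 * ennreal ((?I k \<omega> - ?R \<omega>)\<^sup>2)" for \<omega>
    proof -
      have "(X \<omega> - ?R \<omega>)\<^sup>2 \<le> 2 * (?I k \<omega> - X \<omega>)\<^sup>2 + 2 * (?I k \<omega> - ?R \<omega>)\<^sup>2"
        using square_add_le[of "X \<omega> - ?I k \<omega>" "?I k \<omega> - ?R \<omega>"] by (simp add: power2_commute)
      then have "ennreal ((X \<omega> - ?R \<omega>)\<^sup>2) \<le> ennreal (2 * (?I k \<omega> - X \<omega>)\<^sup>2 + 2 * (?I k \<omega> - ?R \<omega>)\<^sup>2)" by (rule ennreal_leI)
      then show ?thesis by (simp add: ennreal_plus ennreal_mult)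
    qed
    then have "(\<integral>\<^sup>+\<omega>. ennreal ((X \<omega> - ?R \<omega>)\<^sup>2) \<partial>M) \<le> (\<integral>\<^sup>+\<omega>. 2 * ennreal ((?I k \<omega> - X \<omega>)\<^sup>2) + 2 * ennreal ((?I k \<omega> - ?R \<omega>)\<^sup>2) \<partial>M)"
      by (rule nn_integral_mono)
    also have "\<dots> = 2 * (\<integral>\<^sup>+\<omega>. ennreal ((?I k \<omega> - X \<omega>)\<^sup>2) \<partial>M) + 2 * (\<integral>\<^sup>+\<omega>. ennreal ((?I k \<omega> - ?R \<omega>)\<^sup>2) \<partial>M)"
      using IM[of k] X R by (subst nn_integral_add) (auto simp: nn_integral_cmult)
    finally show ?thesis .
  qed
  moreover have "(\<lambda>k. 2 * (\<integral>\<^sup>+\<omega>. ennreal ((?I k \<omega> - X \<omega>)\<^sup>2) \<partial>M) + 2 * (\<integral>\<^sup>+\<omega>. ennreal ((?I k \<omega> - ?R \<omega>)\<^sup>2) \<partial>M)) \<longlonglongrightarrow> 2 * 0 + 2 * 0"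
    by (intro tendsto_add ennreal_tendsto_cmult 2 3) simp_all
  ultimately have "(\<integral>\<^sup>+\<omega>. ennreal ((X \<omega> - ?R \<omega>)\<^sup>2) \<partial>M) \<le> 0"
    by (intro LIMSEQ_le_const[of _ 0]) auto
  then have "AE \<omega> in M. ennreal ((X \<omega> - ?R \<omega>)\<^sup>2) = 0"
    using X R by (subst nn_integral_0_iff_AE[symmetric]) auto
  then show ?thesis by eventually_elim simp
qed

end

end

section \<open>Multivariable calculus and a logarithmic cutoff\<close>

text \<open>The second difference over a square of side \<open>h\<close> equals \<open>h\<^sup>2\<close> times a value of either mixed derivative, by two
  applications of the mean value theorem in either order. The generator contains only one of the two
  mixed derivatives, whereas the second derivative along a line contains both.\<close>

lemma mixed_partials_eq:
  fixes f fx fy fxy fyx :: "real \<Rightarrow> real \<Rightarrow> real"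
  assumes fx: "\<And>x y. ((\<lambda>x. f x y) has_real_derivative fx x y) (at x)"
    and fy: "\<And>x y. ((\<lambda>y. f x y) has_real_derivative fy x y) (at y)"
    and fxy: "\<And>x y. ((\<lambda>y. fx x y) has_real_derivative fxy x y) (at y)"
    and fyx: "\<And>x y. ((\<lambda>x. fy x y) has_real_derivative fyx x y) (at x)"
    and cont: "continuous_on UNIV (\<lambda>(x, y). fxy x y)" "continuous_on UNIV (\<lambda>(x, y). fyx x y)"
  shows "fxy x y = fyx x y"
proof -
  define h where "h n = inverse (real (Suc n))" for n
  have h: "0 < h n" for n by (simp add: h_def)
  have h_lim: "h \<longlonglongrightarrow> 0" unfolding h_def by (rule LIMSEQ_inverse_real_of_nat)
  have mvt: "\<exists>z. v < z \<and> z < v + d \<and> g (v + d) - g v = (v + d - v) * g' z"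
    if "\<And>v. (g has_real_derivative g' v) (at v)" "0 < d" for g g' :: "real \<Rightarrow> real" and v d
    using MVT2[of v "v + d" g g'] that by auto
  have 1: "\<exists>\<xi>. \<exists>\<eta>. x < \<xi> \<and> \<xi> < x + h n \<and> y < \<eta> \<and> \<eta> < y + h n \<and>
      f (x + h n) (y + h n) - f (x + h n) y - (f x (y + h n) - f x y) = h n * (h n * fxy \<xi> \<eta>)" for n
  proof -
    obtain \<xi> where \<xi>: "x < \<xi>" "\<xi> < x + h n"
      "(f (x + h n) (y + h n) - f (x + h n) y) - (f x (y + h n) - f x y) = (x + h n - x) * (fx \<xi> (y + h n) - fx \<xi> y)"
      using mvt[OF DERIV_diff[OF fx fx], of "h n" x "y + h n" y] h[of n] by blast
    obtain \<eta> where \<eta>: "y < \<eta>" "\<eta> < y + h n" "fx \<xi> (y + h n) - fx \<xi> y = (y + h n - y) * fxy \<xi> \<eta>"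
      using mvt[OF fxy, of "h n" y \<xi>] h[of n] by blast
    show ?thesis using \<xi> \<eta> by (intro exI[of _ \<xi>] exI[of _ \<eta>]) simp
  qed
  have 2: "\<exists>\<xi>. \<exists>\<eta>. x < \<xi> \<and> \<xi> < x + h n \<and> y < \<eta> \<and> \<eta> < y + h n \<and>
      f (x + h n) (y + h n) - f (x + h n) y - (f x (y + h n) - f x y) = h n * (h n * fyx \<xi> \<eta>)" for n
  proof -
    obtain \<eta> where \<eta>: "y < \<eta>" "\<eta> < y + h n"
      "(f (x + h n) (y + h n) - f x (y + h n)) - (f (x + h n) y - f x y) = (y + h n - y) * (fy (x + h n) \<eta> - fy x \<eta>)"
      using mvt[OF DERIV_diff[OF fy fy], of "h n" y "x + h n" x] h[of n] by blast
    obtain \<xi> where \<xi>: "x < \<xi>" "\<xi> < x + h n" "fy (x + h n) \<eta> - fy x \<eta> = (x + h n - x) * fyx \<xi> \<eta>"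
      using mvt[OF fyx, of "h n" x \<eta>] h[of n] by blast
    show ?thesis using \<xi> \<eta> by (intro exI[of _ \<xi>] exI[of _ \<eta>]) simp
  qed
  from 1 obtain \<xi>1 \<eta>1 where a: "\<And>n. x < \<xi>1 n \<and> \<xi>1 n < x + h n \<and> y < \<eta>1 n \<and> \<eta>1 n < y + h n \<and>
      f (x + h n) (y + h n) - f (x + h n) y - (f x (y + h n) - f x y) = h n * (h n * fxy (\<xi>1 n) (\<eta>1 n))" by metis
  from 2 obtain \<xi>2 \<eta>2 where b: "\<And>n. x < \<xi>2 n \<and> \<xi>2 n < x + h n \<and> y < \<eta>2 n \<and> \<eta>2 n < y + h n \<and>
      f (x + h n) (y + h n) - f (x + h n) y - (f x (y + h n) - f x y) = h n * (h n * fyx (\<xi>2 n) (\<eta>2 n))" by metis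
  have squeeze: "g \<longlonglongrightarrow> v" if "\<And>n. v < g n \<and> g n < v + h n" for g and v :: real
  proof -
    have up: "(\<lambda>n. v + h n) \<longlonglongrightarrow> v" using tendsto_add[OF tendsto_const h_lim, of v] by simp
    have le: "\<forall>\<^sub>F n in sequentially. v \<le> g n" "\<forall>\<^sub>F n in sequentially. g n \<le> v + h n"
      using that by (simp_all add: less_imp_le)
    show ?thesis by (rule tendsto_sandwich[OF le tendsto_const up])
  qed
  have "(\<lambda>n. (\<xi>1 n, \<eta>1 n)) \<longlonglongrightarrow> (x, y)" "(\<lambda>n. (\<xi>2 n, \<eta>2 n)) \<longlonglongrightarrow> (x, y)"
    using a b by (auto intro!: tendsto_Pair squeeze)
  then have "(\<lambda>n. fxy (\<xi>1 n) (\<eta>1 n)) \<longlonglongrightarrow> fxy x y" "(\<lambda>n. fyx (\<xi>2 n) (\<eta>2 n)) \<longlonglongrightarrow> fyx x y"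
    using continuous_on_tendsto_compose[OF cont(1), of "\<lambda>n. (\<xi>1 n, \<eta>1 n)" "(x, y)" sequentially]
      continuous_on_tendsto_compose[OF cont(2), of "\<lambda>n. (\<xi>2 n, \<eta>2 n)" "(x, y)" sequentially] by auto
  moreover have "fxy (\<xi>1 n) (\<eta>1 n) = fyx (\<xi>2 n) (\<eta>2 n)" for n
    using a[of n] b[of n] h[of n] by simp
  ultimately show ?thesis by (auto intro: LIMSEQ_unique)
qed

lemma has_derivative_three_partials:
  fixes f :: "real \<Rightarrow> real \<Rightarrow> real \<Rightarrow> real" and A :: "real set"
  assumes t: "t \<in> A"
    and ft: "((\<lambda>s. f s x y) has_real_derivative ft) (at t within A)"
    and fx: "\<And>s x. s \<in> A \<Longrightarrow> ((\<lambda>v. f s v y) has_real_derivative fx s x y) (at x)"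
    and fy: "\<And>s x y. s \<in> A \<Longrightarrow> ((\<lambda>v. f s x v) has_real_derivative fy s x y) (at y)"
    and cont: "continuous_on (A \<times> UNIV \<times> UNIV) (\<lambda>(s, x, y). fx s x y)"
      "continuous_on (A \<times> UNIV \<times> UNIV) (\<lambda>(s, x, y). fy s x y)"
  shows "((\<lambda>((s, v), w). f s v w) has_derivative (\<lambda>((a, b), c). a * ft + fx t x y * b + fy t x y * c))
    (at ((t, x), y) within (A \<times> UNIV) \<times> UNIV)"
proof -
  have d1: "((\<lambda>(s, v). f s v y) has_derivative (\<lambda>(a, b). a * ft + blinfun_mult_right (fx t x y) b)) (at (t, x) within A \<times> UNIV)"
  proof (rule has_derivative_partialsI[where fy = "\<lambda>s x. blinfun_mult_right (fx s x y)"])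
    show "((\<lambda>s. f s x y) has_derivative (\<lambda>a. a * ft)) (at t within A)"
      using ft by (simp add: has_field_derivative_def mult_commute_abs)
    show "((\<lambda>v. f s v y) has_derivative blinfun_apply (blinfun_mult_right (fx s x' y))) (at x' within UNIV)" if "s \<in> A" for s x'
      using fx[OF that, of x'] by (simp add: has_field_derivative_def)
    have "continuous_on (A \<times> UNIV) (\<lambda>z. (\<lambda>(s, x, y). fx s x y) (fst z, snd z, y))"
      by (rule continuous_on_compose2[OF cont(1)]) (auto intro!: continuous_intros)
    then have "continuous_on (A \<times> UNIV) (\<lambda>(s, x). blinfun_mult_right (fx s x y))"
      by (auto simp: split_def intro!: bounded_linear.continuous_on[OF bounded_linear_blinfun_mult_right])
    then show "continuous (at (t, x) within A \<times> UNIV) (\<lambda>(s, x). blinfun_mult_right (fx s x y))"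
      using t by (simp add: continuous_on_eq_continuous_within)
  qed auto
  have "((\<lambda>(p, w). (\<lambda>(s, v). f s v w) p) has_derivative
      (\<lambda>(ab, c). (\<lambda>(a, b). a * ft + blinfun_mult_right (fx t x y) b) ab + blinfun_mult_right (fy (fst (t, x)) (snd (t, x)) y) c))
    (at ((t, x), y) within (A \<times> UNIV) \<times> UNIV)"
  proof (rule has_derivative_partialsI[where fy = "\<lambda>p y. blinfun_mult_right (fy (fst p) (snd p) y)"])
    show "((\<lambda>p. (\<lambda>(s, v). f s v y) p) has_derivative (\<lambda>(a, b). a * ft + blinfun_mult_right (fx t x y) b)) (at (t, x) within A \<times> UNIV)"
      using d1 by simp
    show "((\<lambda>w. (\<lambda>(s, v). f s v w) p) has_derivative blinfun_apply (blinfun_mult_right (fy (fst p) (snd p) y'))) (at y' within UNIV)"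
      if "p \<in> A \<times> UNIV" for p y'
      using fy[of "fst p" "snd p" y'] that by (auto simp: has_field_derivative_def split_def)
    have "continuous_on ((A \<times> UNIV) \<times> UNIV) (\<lambda>z. (\<lambda>(s, x, y). fy s x y) (fst (fst z), snd (fst z), snd z))"
      by (rule continuous_on_compose2[OF cont(2)]) (auto intro!: continuous_intros)
    then have "continuous_on ((A \<times> UNIV) \<times> UNIV) (\<lambda>(p, y). blinfun_mult_right (fy (fst p) (snd p) y))"
      by (auto simp: split_def intro!: bounded_linear.continuous_on[OF bounded_linear_blinfun_mult_right])
    then show "continuous (at ((t, x), y) within (A \<times> UNIV) \<times> UNIV) (\<lambda>(p, y). blinfun_mult_right (fy (fst p) (snd p) y))"
      using t by (simp add: continuous_on_eq_continuous_within)
  qed auto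
  then show ?thesis by (simp add: split_def)
qed

lemma chain_rule_three_partials:
  fixes f :: "real \<Rightarrow> real \<Rightarrow> real \<Rightarrow> real" and A :: "real set"
  assumes t: "t \<in> A"
    and ft: "((\<lambda>s. f s (x t) (y t)) has_real_derivative ft) (at t within A)"
    and fx: "\<And>s x y. s \<in> A \<Longrightarrow> ((\<lambda>v. f s v y) has_real_derivative fx s x y) (at x)"
    and fy: "\<And>s x y. s \<in> A \<Longrightarrow> ((\<lambda>v. f s x v) has_real_derivative fy s x y) (at y)"
    and cont: "continuous_on (A \<times> UNIV \<times> UNIV) (\<lambda>(s, x, y). fx s x y)"
      "continuous_on (A \<times> UNIV \<times> UNIV) (\<lambda>(s, x, y). fy s x y)"
    and x: "(x has_real_derivative x') (at t within A)" and y: "(y has_real_derivative y') (at t within A)"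
  shows "((\<lambda>s. f s (x s) (y s)) has_real_derivative ft + fx t (x t) (y t) * x' + fy t (x t) (y t) * y') (at t within A)"
proof -
  have "((\<lambda>s. ((s, x s), y s)) has_derivative (\<lambda>h. ((h, x' * h), y' * h))) (at t within A)"
    using x y unfolding has_field_derivative_def by (intro has_derivative_Pair) auto
  moreover have "((\<lambda>((s, v), w). f s v w) has_derivative (\<lambda>((a, b), c). a * ft + fx t (x t) (y t) * b + fy t (x t) (y t) * c))
      (at ((t, x t), y t) within (\<lambda>s. ((s, x s), y s)) ` A)"
    by (rule has_derivative_subset[OF has_derivative_three_partials[OF t ft fx fy cont]]) auto
  ultimately have "((\<lambda>s. (\<lambda>((s, v), w). f s v w) ((s, x s), y s)) has_derivative
      (\<lambda>h. (\<lambda>((a, b), c). a * ft + fx t (x t) (y t) * b + fy t (x t) (y t) * c) ((h, x' * h), y' * h))) (at t within A)"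
    by (rule has_derivative_in_compose)
  moreover have "(\<lambda>h. (\<lambda>((a, b), c). a * ft + fx t (x t) (y t) * b + fy t (x t) (y t) * c) ((h, x' * h), y' * h))
      = (*) (ft + fx t (x t) (y t) * x' + fy t (x t) (y t) * y')"
    by (auto simp: algebra_simps)
  ultimately show ?thesis by (simp add: has_field_derivative_def)
qed

text \<open>The third power makes the cutoff twice continuously differentiable; \<open>bump'\<close> and \<open>bump''\<close> are the derivatives.\<close>

definition bump :: "real \<Rightarrow> real" where "bump v = (max 0 v)^3"
definition bump' :: "real \<Rightarrow> real" where "bump' v = 3 * (max 0 v)\<^sup>2"
definition bump'' :: "real \<Rightarrow> real" where "bump'' v = 6 * max 0 v"

lemma DERIV_max_0_square: "((\<lambda>v. (max 0 v)\<^sup>2) has_real_derivative 2 * max 0 v) (at (v::real))"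
proof -
  consider "v < 0" | "v = 0" | "0 < v" by linarith
  then show ?thesis
  proof cases
    case 1
    have "((\<lambda>v::real. 0) has_real_derivative 0) (at v)" by simp
    then have "((\<lambda>v. (max 0 v)\<^sup>2) has_real_derivative 0) (at v)"
      by (rule has_field_derivative_transform_within_open[where S = "{..<0}"]) (use 1 in auto)
    then show ?thesis using 1 by simp
  next
    case 2
    have "(\<lambda>h. ((max 0 (0 + h))\<^sup>2 - (max 0 0)\<^sup>2) / h) \<midarrow>0\<rightarrow> (0::real)"
    proof (rule Lim_null_comparison)
      show "\<forall>\<^sub>F h in at 0. norm (((max 0 (0 + h))\<^sup>2 - (max 0 0)\<^sup>2) / h) \<le> \<bar>h::real\<bar>"
        by (intro always_eventually allI) (auto simp: max_def power2_eq_square)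
      show "(\<lambda>h::real. \<bar>h\<bar>) \<midarrow>0\<rightarrow> 0" by (intro tendsto_eq_intros) auto
    qed
    then show ?thesis using 2 by (simp add: DERIV_def)
  next
    case 3
    have "((\<lambda>v::real. v\<^sup>2) has_real_derivative 2 * v) (at v)" by (auto intro!: derivative_eq_intros)
    then have "((\<lambda>v. (max 0 v)\<^sup>2) has_real_derivative 2 * v) (at v)"
      by (rule has_field_derivative_transform_within_open[where S = "{0<..}"]) (use 3 in auto)
    then show ?thesis using 3 by simp
  qed
qed

lemma DERIV_bump: "(bump has_real_derivative bump' v) (at v)"
proof -
  have "bump = (\<lambda>v. v * (max 0 v)\<^sup>2)"
    by (auto simp: bump_def fun_eq_iff max_def power3_eq_cube power2_eq_square)
  moreover have "((\<lambda>v. v * (max 0 v)\<^sup>2) has_real_derivative v * (2 * max 0 v) + 1 * (max 0 v)\<^sup>2) (at v)"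
    by (intro DERIV_mult' DERIV_ident DERIV_max_0_square)
  moreover have "v * (2 * max 0 v) + 1 * (max 0 v)\<^sup>2 = bump' v"
    by (auto simp: bump'_def max_def power2_eq_square)
  ultimately show ?thesis by simp
qed

lemma DERIV_bump': "(bump' has_real_derivative bump'' v) (at v)"
  unfolding bump'_def bump''_def using DERIV_cmult[OF DERIV_max_0_square, of 3 v] by simp

lemma bump_le_1: "v \<le> 1 \<Longrightarrow> 0 \<le> bump v \<and> bump v \<le> 1 \<and> 0 \<le> bump' v \<and> bump' v \<le> 3 \<and> 0 \<le> bump'' v \<and> bump'' v \<le> 6"
  by (auto simp: bump_def bump'_def bump''_def max_def intro!: power_le_one)

lemma bump_eq_0: "v \<le> 0 \<Longrightarrow> bump v = 0 \<and> bump' v = 0 \<and> bump'' v = 0"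
  by (auto simp: bump_def bump'_def bump''_def)

lemma continuous_on_bump [continuous_intros]:
  assumes "continuous_on A f"
  shows "continuous_on A (\<lambda>x. bump (f x))" "continuous_on A (\<lambda>x. bump' (f x))" "continuous_on A (\<lambda>x. bump'' (f x))"
  unfolding bump_def bump'_def bump''_def by (intro continuous_intros assms)+

definition radius :: "real \<Rightarrow> real \<Rightarrow> real \<Rightarrow> real" where
  "radius x y z = 1 + x\<^sup>2 + y\<^sup>2 + z\<^sup>2"

text \<open>A smooth cutoff is obtained as \<open>bump (cutoff \<epsilon> x y z)\<close>. The logarithm matters: the coefficients of the diffusion grow at most
  linearly, so first- and second-order operators applied to \<open>ln (1 + |.|\<^sup>2)\<close> stay bounded. Hence removing
  the cutoff costs only \<open>O(\<epsilon>)\<close>, without any moment estimate for the state.\<close>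

definition cutoff :: "real \<Rightarrow> real \<Rightarrow> real \<Rightarrow> real \<Rightarrow> real" where
  "cutoff \<epsilon> x y z = 1 - \<epsilon> * ln (radius x y z)"

lemma radius_ge_1: "1 \<le> radius x y z" by (simp add: radius_def)
lemma radius_pos: "0 < radius x y z" using radius_ge_1[of x y z] by linarith
lemma radius_neq_0 [simp]: "radius x y z \<noteq> 0" using radius_pos[of x y z] by linarith

lemma cutoff_le_1: "0 \<le> \<epsilon> \<Longrightarrow> cutoff \<epsilon> x y z \<le> 1"
  using radius_ge_1[of x y z] by (simp add: cutoff_def)

text \<open>Outside a cube the logarithm exceeds \<open>1 / \<epsilon>\<close>, so the cutoff has compact support.\<close>

lemma cutoff_nonpos:
  assumes "0 < \<epsilon>" "exp (1 / \<epsilon>) < \<bar>x\<bar> \<or> exp (1 / \<epsilon>) < \<bar>y\<bar> \<or> exp (1 / \<epsilon>) < \<bar>z\<bar>"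
  shows "cutoff \<epsilon> x y z \<le> 0"
proof -
  have sq: "e \<le> v\<^sup>2" if "e < \<bar>v\<bar>" "1 \<le> e" for e v :: real
  proof -
    have "1 * e \<le> \<bar>v\<bar> * \<bar>v\<bar>" using that by (intro mult_mono) auto
    then show ?thesis by (simp add: power2_eq_square)
  qed
  have "1 \<le> exp (1 / \<epsilon>)" using assms(1) by simp
  then have "exp (1 / \<epsilon>) \<le> x\<^sup>2 \<or> exp (1 / \<epsilon>) \<le> y\<^sup>2 \<or> exp (1 / \<epsilon>) \<le> z\<^sup>2" using assms(2) sq by blast
  then have "exp (1 / \<epsilon>) \<le> radius x y z"
    unfolding radius_def using zero_le_power2[of x] zero_le_power2[of y] zero_le_power2[of z] by linarith
  then have "1 / \<epsilon> \<le> ln (radius x y z)" using radius_pos[of x y z] by (subst ln_ge_iff) auto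
  then show ?thesis using assms(1) by (simp add: cutoff_def divide_le_eq mult.commute)
qed

lemma bounded_of_compact_support:
  fixes h :: "real \<Rightarrow> real \<Rightarrow> real \<Rightarrow> real \<Rightarrow> real"
  assumes cont: "continuous_on ({0..T} \<times> UNIV \<times> UNIV \<times> UNIV) (\<lambda>(t, x, y, z). h t x y z)"
    and supp: "\<And>t x y z. R < \<bar>x\<bar> \<or> R < \<bar>y\<bar> \<or> R < \<bar>z\<bar> \<Longrightarrow> h t x y z = 0"
  shows "\<exists>K\<ge>0. \<forall>t\<in>{0..T}. \<forall>x y z. \<bar>h t x y z\<bar> \<le> K"
proof -
  let ?C = "{0..T} \<times> {-R..R} \<times> {-R..R} \<times> {-R..R}"
  have "bounded ((\<lambda>(t, x, y, z). h t x y z) ` ?C)"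
    by (intro compact_imp_bounded compact_continuous_image continuous_on_subset[OF cont] compact_Times) auto
  then obtain K where K: "\<forall>v\<in>(\<lambda>(t, x, y, z). h t x y z) ` ?C. norm v \<le> K" unfolding bounded_iff by (rule exE)
  have "\<bar>h t x y z\<bar> \<le> max 0 K" if t: "t \<in> {0..T}" for t x y z
  proof (cases "R < \<bar>x\<bar> \<or> R < \<bar>y\<bar> \<or> R < \<bar>z\<bar>")
    case False
    then have "(t, x, y, z) \<in> ?C" using t by auto
    from bspec[OF K imageI[OF this]] show ?thesis by simp
  qed (use supp in auto)
  then show ?thesis by (intro exI[of _ "max 0 K"]) auto
qed

section \<open>Discounted solutions of the partial differential equation along paths\<close>

text \<open>The state moves along \<open>x = x\<^sub>0 + \<sigma> w\<close>, \<open>y = y\<^sub>0 + \<phi> t w\<close> when the Brownian motion has the value \<open>w\<close>. The locale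
  collects a function \<open>G\<close> with the partial derivatives of class \<open>C\<^sup>1\<^sup>,\<^sup>2\<^sup>,\<^sup>2\<close> on a closed time interval \<open>[0, T]\<close>, which
  will be chosen strictly before maturity.\<close>

locale c122_field =
  fixes T \<sigma> :: real and \<phi> \<phi>' :: "real \<Rightarrow> real" and G gt gx gy gxx gxy gyy :: "real \<Rightarrow> real \<Rightarrow> real \<Rightarrow> real"
  assumes T: "0 \<le> T"
    and \<phi>: "\<And>t. t \<in> {0..T} \<Longrightarrow> (\<phi> has_real_derivative \<phi>' t) (at t within {0..T})"
    and G_t: "\<And>t x y. t \<in> {0..T} \<Longrightarrow> ((\<lambda>s. G s x y) has_real_derivative gt t x y) (at t within {0..T})"
    and G_x: "\<And>t x y. t \<in> {0..T} \<Longrightarrow> ((\<lambda>v. G t v y) has_real_derivative gx t x y) (at x)"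
    and G_y: "\<And>t x y. t \<in> {0..T} \<Longrightarrow> ((\<lambda>v. G t x v) has_real_derivative gy t x y) (at y)"
    and gx_x: "\<And>t x y. t \<in> {0..T} \<Longrightarrow> ((\<lambda>v. gx t v y) has_real_derivative gxx t x y) (at x)"
    and gx_y: "\<And>t x y. t \<in> {0..T} \<Longrightarrow> ((\<lambda>v. gx t x v) has_real_derivative gxy t x y) (at y)"
    and gy_x: "\<And>t x y. t \<in> {0..T} \<Longrightarrow> ((\<lambda>v. gy t v y) has_real_derivative gxy t x y) (at x)"
    and gy_y: "\<And>t x y. t \<in> {0..T} \<Longrightarrow> ((\<lambda>v. gy t x v) has_real_derivative gyy t x y) (at y)"
    and continuous_partials: "\<And>h. h \<in> {G, gt, gx, gy, gxx, gxy, gyy} \<Longrightarrow>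
      continuous_on ({0..T} \<times> UNIV \<times> UNIV) (\<lambda>(t, x, y). h t x y)"
begin

text \<open>The discounted value is \<open>V\<close>, with \<open>z\<close> the integrated short rate; a subscript \<open>w\<close> denotes a derivative along the line
  and \<open>t\<close> the time derivative along a curve with velocity \<open>(\<mu>, \<nu>, \<rho>)\<close> in \<open>(x, y, z)\<close>. The test field \<open>F\<close> is a
  truncated bounded function of \<open>V\<close>. The sine is chosen because it and its derivatives are bounded,
  with second derivative of size \<open>\<delta>\<^sup>2\<close>, and because the shift \<open>c\<close> yields the cosine as well.\<close>

definition V where "V t x y z = exp (- z) * G t x y"
definition V_w where "V_w t x y z = exp (- z) * (\<sigma> * gx t x y + \<phi> t * gy t x y)"
definition V_ww where "V_ww t x y z = exp (- z) * (\<sigma>\<^sup>2 * gxx t x y + 2 * \<sigma> * \<phi> t * gxy t x y + (\<phi> t)\<^sup>2 * gyy t x y)"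
definition V_t where "V_t t x y z \<mu> \<nu> \<rho> = exp (- z) * (gt t x y + gx t x y * \<mu> + gy t x y * \<nu> - \<rho> * G t x y)"

definition cutoff_w where "cutoff_w \<epsilon> t x y z = - \<epsilon> * ((2 * \<sigma> * x + 2 * \<phi> t * y) / radius x y z)"
definition cutoff_ww where "cutoff_ww \<epsilon> t x y z =
  - \<epsilon> * ((2 * \<sigma>\<^sup>2 + 2 * (\<phi> t)\<^sup>2) / radius x y z - ((2 * \<sigma> * x + 2 * \<phi> t * y) / radius x y z)\<^sup>2)"
definition cutoff_t where "cutoff_t \<epsilon> x y z \<mu> \<nu> \<rho> = - \<epsilon> * ((2 * x * \<mu> + 2 * y * \<nu> + 2 * z * \<rho>) / radius x y z)"

definition F where "F \<epsilon> \<delta> c t x y z = bump (cutoff \<epsilon> x y z) * sin (\<delta> * V t x y z + c)"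
definition F_w where "F_w \<epsilon> \<delta> c t x y z =
  bump' (cutoff \<epsilon> x y z) * cutoff_w \<epsilon> t x y z * sin (\<delta> * V t x y z + c)
  + bump (cutoff \<epsilon> x y z) * (\<delta> * V_w t x y z * cos (\<delta> * V t x y z + c))"
definition F_ww where "F_ww \<epsilon> \<delta> c t x y z =
  (bump'' (cutoff \<epsilon> x y z) * (cutoff_w \<epsilon> t x y z)\<^sup>2 + bump' (cutoff \<epsilon> x y z) * cutoff_ww \<epsilon> t x y z) * sin (\<delta> * V t x y z + c)
  + 2 * bump' (cutoff \<epsilon> x y z) * cutoff_w \<epsilon> t x y z * (\<delta> * V_w t x y z * cos (\<delta> * V t x y z + c))
  + bump (cutoff \<epsilon> x y z) * (\<delta> * V_ww t x y z * cos (\<delta> * V t x y z + c) - (\<delta> * V_w t x y z)\<^sup>2 * sin (\<delta> * V t x y z + c))"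
definition F_t where "F_t \<epsilon> \<delta> c t x y z \<mu> \<nu> \<rho> =
  bump' (cutoff \<epsilon> x y z) * cutoff_t \<epsilon> x y z \<mu> \<nu> \<rho> * sin (\<delta> * V t x y z + c)
  + bump (cutoff \<epsilon> x y z) * (\<delta> * V_t t x y z \<mu> \<nu> \<rho> * cos (\<delta> * V t x y z + c))"

lemma continuous_partials_comp:
  assumes "h \<in> {G, gt, gx, gy, gxx, gxy, gyy}"
    and "continuous_on A \<tau>" "\<And>p. p \<in> A \<Longrightarrow> \<tau> p \<in> {0..T}" "continuous_on A x" "continuous_on A y"
  shows "continuous_on A (\<lambda>p. h (\<tau> p) (x p) (y p))"
proof -
  have "continuous_on A (\<lambda>p. (\<lambda>(t, x, y). h t x y) (\<tau> p, x p, y p))"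
    by (rule continuous_on_compose2[OF continuous_partials[OF assms(1)]]) (use assms in \<open>auto intro!: continuous_intros\<close>)
  then show ?thesis by simp
qed

lemma \<phi>_continuous: "continuous_on {0..T} \<phi>"
  by (rule DERIV_continuous_on[OF \<phi>])

lemma line_derivative:
  assumes t: "t \<in> {0..T}" and h: "hx \<in> {G, gt, gx, gy, gxx, gxy, gyy}" "hy \<in> {G, gt, gx, gy, gxx, gxy, gyy}"
    and hx: "\<And>x y. ((\<lambda>v. h t v y) has_real_derivative hx t x y) (at x)"
    and hy: "\<And>x y. ((\<lambda>v. h t x v) has_real_derivative hy t x y) (at y)"
  shows "((\<lambda>w. h t (x0 + \<sigma> * w) (y0 + \<phi> t * w)) has_real_derivative
    hx t (x0 + \<sigma> * w) (y0 + \<phi> t * w) * \<sigma> + hy t (x0 + \<sigma> * w) (y0 + \<phi> t * w) * \<phi> t) (at w)"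
proof -
  have "((\<lambda>w. (\<lambda>_. h t) w (x0 + \<sigma> * w) (y0 + \<phi> t * w)) has_real_derivative
    0 + (\<lambda>_. hx t) w (x0 + \<sigma> * w) (y0 + \<phi> t * w) * \<sigma> + (\<lambda>_. hy t) w (x0 + \<sigma> * w) (y0 + \<phi> t * w) * \<phi> t) (at w)"
  proof (rule chain_rule_three_partials[where f = "\<lambda>_. h t" and fx = "\<lambda>_. hx t" and fy = "\<lambda>_. hy t"
        and x = "\<lambda>w. x0 + \<sigma> * w" and y = "\<lambda>w. y0 + \<phi> t * w"])
    show "continuous_on (UNIV \<times> UNIV \<times> UNIV) (\<lambda>(s::real, x, y). hx t x y)"
      unfolding split_def by (rule continuous_partials_comp[OF h(1)]) (use t in \<open>auto intro!: continuous_intros\<close>)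
    show "continuous_on (UNIV \<times> UNIV \<times> UNIV) (\<lambda>(s::real, x, y). hy t x y)"
      unfolding split_def by (rule continuous_partials_comp[OF h(2)]) (use t in \<open>auto intro!: continuous_intros\<close>)
  qed (use hx hy in \<open>auto intro!: derivative_eq_intros\<close>)
  then show ?thesis by simp
qed

lemma derivative_along_line:
  assumes t: "t \<in> {0..T}"
  shows "((\<lambda>w. F \<epsilon> \<delta> c t (x0 + \<sigma> * w) (y0 + \<phi> t * w) z) has_real_derivative
      F_w \<epsilon> \<delta> c t (x0 + \<sigma> * w) (y0 + \<phi> t * w) z) (at w)"
    and "((\<lambda>w. F_w \<epsilon> \<delta> c t (x0 + \<sigma> * w) (y0 + \<phi> t * w) z) has_real_derivative
      F_ww \<epsilon> \<delta> c t (x0 + \<sigma> * w) (y0 + \<phi> t * w) z) (at w)"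
proof -
  let ?x = "\<lambda>w. x0 + \<sigma> * w" and ?y = "\<lambda>w. y0 + \<phi> t * w"
  note G1 = line_derivative[of t gx gy G x0 y0 w, OF t _ _ G_x[OF t] G_y[OF t], simplified]
  note gx1 = line_derivative[of t gxx gxy gx x0 y0 w, OF t _ _ gx_x[OF t] gx_y[OF t], simplified]
  note gy1 = line_derivative[of t gxy gyy gy x0 y0 w, OF t _ _ gy_x[OF t] gy_y[OF t], simplified]
  have V: "((\<lambda>w. V t (?x w) (?y w) z) has_real_derivative V_w t (?x w) (?y w) z) (at w)"
    unfolding V_def V_w_def using DERIV_cmult[OF G1, of "exp (- z)"] by (simp add: mult.commute)
  have Vw: "((\<lambda>w. V_w t (?x w) (?y w) z) has_real_derivative V_ww t (?x w) (?y w) z) (at w)"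
    unfolding V_w_def V_ww_def
    by (rule DERIV_cong[OF DERIV_cmult[OF DERIV_add[OF DERIV_cmult[OF gx1] DERIV_cmult[OF gy1]]]])
      (simp add: algebra_simps power2_eq_square)
  have R: "((\<lambda>w. radius (?x w) (?y w) z) has_real_derivative 2 * \<sigma> * ?x w + 2 * \<phi> t * ?y w) (at w)"
    unfolding radius_def by (auto intro!: derivative_eq_intros)
  have cutoff: "((\<lambda>w. cutoff \<epsilon> (?x w) (?y w) z) has_real_derivative cutoff_w \<epsilon> t (?x w) (?y w) z) (at w)"
    unfolding cutoff_def cutoff_w_def
    by (rule DERIV_cong[OF DERIV_diff[OF DERIV_const DERIV_cmult[OF DERIV_chain2[OF DERIV_ln R]]]])
      (auto simp: radius_pos divide_inverse mult_ac)
  have N: "((\<lambda>w. 2 * \<sigma> * ?x w + 2 * \<phi> t * ?y w) has_real_derivative 2 * \<sigma>\<^sup>2 + 2 * (\<phi> t)\<^sup>2) (at w)"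
    by (auto intro!: derivative_eq_intros simp: power2_eq_square)
  have cutw: "((\<lambda>w. cutoff_w \<epsilon> t (?x w) (?y w) z) has_real_derivative cutoff_ww \<epsilon> t (?x w) (?y w) z) (at w)"
    unfolding cutoff_w_def cutoff_ww_def
    by (rule DERIV_cong[OF DERIV_cmult[OF DERIV_divide[OF N R]]])
      (simp_all add: diff_divide_distrib power2_eq_square)
  note b = DERIV_chain2[OF DERIV_bump cutoff] and b' = DERIV_chain2[OF DERIV_bump' cutoff]
  have s: "((\<lambda>w. sin (\<delta> * V t (?x w) (?y w) z + c)) has_real_derivative cos (\<delta> * V t (?x w) (?y w) z + c) * (\<delta> * V_w t (?x w) (?y w) z)) (at w)"
    and s': "((\<lambda>w. cos (\<delta> * V t (?x w) (?y w) z + c)) has_real_derivative - sin (\<delta> * V t (?x w) (?y w) z + c) * (\<delta> * V_w t (?x w) (?y w) z)) (at w)"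
    by (auto intro!: derivative_eq_intros V)
  show "((\<lambda>w. F \<epsilon> \<delta> c t (?x w) (?y w) z) has_real_derivative F_w \<epsilon> \<delta> c t (?x w) (?y w) z) (at w)"
    unfolding F_def F_w_def by (rule DERIV_cong[OF DERIV_mult[OF b s]]) (simp add: algebra_simps)
  show "((\<lambda>w. F_w \<epsilon> \<delta> c t (?x w) (?y w) z) has_real_derivative F_ww \<epsilon> \<delta> c t (?x w) (?y w) z) (at w)"
    unfolding F_w_def F_ww_def
    by (rule DERIV_cong[OF DERIV_add[OF DERIV_mult[OF DERIV_mult[OF b' cutw] s]
          DERIV_mult[OF b DERIV_mult[OF DERIV_cmult[OF Vw] s']]]])
      (simp add: algebra_simps power2_eq_square)
qed

lemma derivative_along_curve:
  assumes t: "t \<in> {0..T}" and x: "(x has_real_derivative \<mu>) (at t within {0..T})"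
    and y: "(y has_real_derivative \<nu>) (at t within {0..T})" and z: "(z has_real_derivative \<rho>) (at t within {0..T})"
  shows "((\<lambda>s. F \<epsilon> \<delta> c s (x s) (y s) (z s)) has_real_derivative F_t \<epsilon> \<delta> c t (x t) (y t) (z t) \<mu> \<nu> \<rho>) (at t within {0..T})"
proof -
  have G1: "((\<lambda>s. G s (x s) (y s)) has_real_derivative gt t (x t) (y t) + gx t (x t) (y t) * \<mu> + gy t (x t) (y t) * \<nu>) (at t within {0..T})"
    by (rule chain_rule_three_partials[OF t G_t[OF t] G_x G_y _ _ x y]) (assumption | rule continuous_partials; simp)+
  have e: "((\<lambda>s. exp (- z s)) has_real_derivative exp (- z t) * - \<rho>) (at t within {0..T})"
    by (auto intro!: derivative_eq_intros z)
  have V: "((\<lambda>s. V s (x s) (y s) (z s)) has_real_derivative V_t t (x t) (y t) (z t) \<mu> \<nu> \<rho>) (at t within {0..T})"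
    unfolding V_def V_t_def by (rule DERIV_cong[OF DERIV_mult[OF e G1]]) (simp add: algebra_simps)
  have R: "((\<lambda>s. radius (x s) (y s) (z s)) has_real_derivative 2 * x t * \<mu> + 2 * y t * \<nu> + 2 * z t * \<rho>) (at t within {0..T})"
    unfolding radius_def by (auto intro!: derivative_eq_intros x y z)
  have cutoff: "((\<lambda>s. cutoff \<epsilon> (x s) (y s) (z s)) has_real_derivative cutoff_t \<epsilon> (x t) (y t) (z t) \<mu> \<nu> \<rho>) (at t within {0..T})"
    unfolding cutoff_def cutoff_t_def
    by (rule DERIV_cong[OF DERIV_diff[OF DERIV_const DERIV_cmult[OF DERIV_chain2[OF DERIV_ln R]]]])
      (auto simp: radius_pos divide_inverse mult_ac)
  have s: "((\<lambda>s. sin (\<delta> * V s (x s) (y s) (z s) + c)) has_real_derivative cos (\<delta> * V t (x t) (y t) (z t) + c) * (\<delta> * V_t t (x t) (y t) (z t) \<mu> \<nu> \<rho>)) (at t within {0..T})"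
    by (auto intro!: derivative_eq_intros V)
  show ?thesis
    unfolding F_def F_t_def by (rule DERIV_cong[OF DERIV_mult[OF DERIV_chain2[OF DERIV_bump cutoff] s]]) (simp add: algebra_simps)
qed

lemma field_continuous:
  fixes A :: "'p::t2_space set" and \<tau> x y z \<mu> \<nu> \<rho> :: "'p \<Rightarrow> real"
  assumes "continuous_on A \<tau>" "\<And>p. p \<in> A \<Longrightarrow> \<tau> p \<in> {0..T}" "continuous_on A x" "continuous_on A y" "continuous_on A z"
  shows "continuous_on A (\<lambda>p. F \<epsilon> \<delta> c (\<tau> p) (x p) (y p) (z p))"
    and "continuous_on A (\<lambda>p. F_ww \<epsilon> \<delta> c (\<tau> p) (x p) (y p) (z p))"
    and "continuous_on A \<mu> \<Longrightarrow> continuous_on A \<nu> \<Longrightarrow> continuous_on A \<rho> \<Longrightarrow>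
      continuous_on A (\<lambda>p. F_t \<epsilon> \<delta> c (\<tau> p) (x p) (y p) (z p) (\<mu> p) (\<nu> p) (\<rho> p))"
proof -
  note h = continuous_partials_comp[OF _ assms(1-4)]
  have c: "continuous_on A (\<lambda>p. G (\<tau> p) (x p) (y p))" "continuous_on A (\<lambda>p. gt (\<tau> p) (x p) (y p))"
    "continuous_on A (\<lambda>p. gx (\<tau> p) (x p) (y p))" "continuous_on A (\<lambda>p. gy (\<tau> p) (x p) (y p))"
    "continuous_on A (\<lambda>p. gxx (\<tau> p) (x p) (y p))" "continuous_on A (\<lambda>p. gxy (\<tau> p) (x p) (y p))"
    "continuous_on A (\<lambda>p. gyy (\<tau> p) (x p) (y p))"
    by (intro h; simp)+
  have c\<phi>: "continuous_on A (\<lambda>p. \<phi> (\<tau> p))"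
    by (rule continuous_on_compose2[OF \<phi>_continuous assms(1)]) (use assms(2) in auto)
  have R: "continuous_on A (\<lambda>p. radius (x p) (y p) (z p))"
    unfolding radius_def by (intro continuous_intros assms)
  have cutoff: "continuous_on A (\<lambda>p. cutoff \<epsilon> (x p) (y p) (z p))"
    unfolding cutoff_def by (intro continuous_intros R) simp
  have V: "continuous_on A (\<lambda>p. V (\<tau> p) (x p) (y p) (z p))"
    unfolding V_def by (intro continuous_intros assms c)
  have s: "continuous_on A (\<lambda>p. sin (\<delta> * V (\<tau> p) (x p) (y p) (z p) + c))"
    "continuous_on A (\<lambda>p. cos (\<delta> * V (\<tau> p) (x p) (y p) (z p) + c))"
    by (intro continuous_on_sin continuous_on_cos continuous_intros V)+
  have V_w: "continuous_on A (\<lambda>p. V_w (\<tau> p) (x p) (y p) (z p))"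
    unfolding V_w_def by (intro continuous_intros assms c c\<phi>)
  have V_ww: "continuous_on A (\<lambda>p. V_ww (\<tau> p) (x p) (y p) (z p))"
    unfolding V_ww_def by (intro continuous_intros assms c c\<phi>)
  have q: "continuous_on A (\<lambda>p. (2 * \<sigma> * x p + 2 * \<phi> (\<tau> p) * y p) / radius (x p) (y p) (z p))"
    by (intro continuous_intros assms R c\<phi>) simp
  have cutoff_w: "continuous_on A (\<lambda>p. cutoff_w \<epsilon> (\<tau> p) (x p) (y p) (z p))"
    unfolding cutoff_w_def by (intro continuous_on_mult continuous_on_const q)
  have "continuous_on A (\<lambda>p. (2 * \<sigma>\<^sup>2 + 2 * (\<phi> (\<tau> p))\<^sup>2) / radius (x p) (y p) (z p))"
    by (intro continuous_intros R c\<phi>) simp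
  then have cutoff_ww: "continuous_on A (\<lambda>p. cutoff_ww \<epsilon> (\<tau> p) (x p) (y p) (z p))"
    unfolding cutoff_ww_def by (intro continuous_on_mult continuous_on_const continuous_on_diff continuous_on_power q)
  show "continuous_on A (\<lambda>p. F \<epsilon> \<delta> c (\<tau> p) (x p) (y p) (z p))"
    unfolding F_def by (intro continuous_on_mult continuous_on_bump cutoff s)
  show "continuous_on A (\<lambda>p. F_ww \<epsilon> \<delta> c (\<tau> p) (x p) (y p) (z p))"
    unfolding F_ww_def
    by (intro continuous_on_add continuous_on_diff continuous_on_mult continuous_on_power continuous_on_const
        continuous_on_bump cutoff s cutoff_w cutoff_ww V_w V_ww)
  assume v: "continuous_on A \<mu>" "continuous_on A \<nu>" "continuous_on A \<rho>"
  have "continuous_on A (\<lambda>p. V_t (\<tau> p) (x p) (y p) (z p) (\<mu> p) (\<nu> p) (\<rho> p))"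
    unfolding V_t_def by (intro continuous_intros assms c v)
  moreover have "continuous_on A (\<lambda>p. cutoff_t \<epsilon> (x p) (y p) (z p) (\<mu> p) (\<nu> p) (\<rho> p))"
    unfolding cutoff_t_def by (intro continuous_intros assms v R) simp
  ultimately show "continuous_on A (\<lambda>p. F_t \<epsilon> \<delta> c (\<tau> p) (x p) (y p) (z p) (\<mu> p) (\<nu> p) (\<rho> p))"
    unfolding F_t_def by (intro continuous_on_add continuous_on_mult continuous_on_const continuous_on_bump cutoff s)
qed

lemma F_bound: "0 < \<epsilon> \<Longrightarrow> \<bar>F \<epsilon> \<delta> c t x y z\<bar> \<le> 1"
  using bump_le_1[OF cutoff_le_1, of \<epsilon> x y z] unfolding F_def abs_mult
  by (intro mult_le_one) auto

lemma F_ww_bound: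
  assumes "0 < \<epsilon>" shows "\<exists>K\<ge>0. \<forall>t\<in>{0..T}. \<forall>x y z. \<bar>F_ww \<epsilon> \<delta> c t x y z\<bar> \<le> K"
proof (rule bounded_of_compact_support[where R = "exp (1 / \<epsilon>)"])
  show "continuous_on ({0..T} \<times> UNIV \<times> UNIV \<times> UNIV) (\<lambda>(t, x, y, z). F_ww \<epsilon> \<delta> c t x y z)"
    unfolding split_def by (rule field_continuous(2)) (auto intro!: continuous_intros)
  show "F_ww \<epsilon> \<delta> c t x y z = 0" if "exp (1 / \<epsilon>) < \<bar>x\<bar> \<or> exp (1 / \<epsilon>) < \<bar>y\<bar> \<or> exp (1 / \<epsilon>) < \<bar>z\<bar>" for t x y z
    using bump_eq_0[OF cutoff_nonpos[OF assms that]] by (simp add: F_ww_def)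
qed

text \<open>\<open>F_t\<close> is affine in the velocity with compactly supported coefficients, which are recovered from the four unit
  velocities.\<close>

lemma F_t_bound:
  assumes "0 < \<epsilon>"
  shows "\<exists>K\<ge>0. \<forall>t\<in>{0..T}. \<forall>x y z \<mu> \<nu> \<rho>. \<bar>F_t \<epsilon> \<delta> c t x y z \<mu> \<nu> \<rho>\<bar> \<le> K * (1 + \<bar>\<mu>\<bar> + \<bar>\<nu>\<bar> + \<bar>\<rho>\<bar>)"
proof -
  have "\<exists>K\<ge>0. \<forall>t\<in>{0..T}. \<forall>x y z. \<bar>F_t \<epsilon> \<delta> c t x y z m n r\<bar> \<le> K" for m n r
  proof (rule bounded_of_compact_support[where R = "exp (1 / \<epsilon>)"])
    show "continuous_on ({0..T} \<times> UNIV \<times> UNIV \<times> UNIV) (\<lambda>(t, x, y, z). F_t \<epsilon> \<delta> c t x y z m n r)"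
      unfolding split_def by (rule field_continuous(3)) (auto intro!: continuous_intros)
    show "F_t \<epsilon> \<delta> c t x y z m n r = 0" if "exp (1 / \<epsilon>) < \<bar>x\<bar> \<or> exp (1 / \<epsilon>) < \<bar>y\<bar> \<or> exp (1 / \<epsilon>) < \<bar>z\<bar>" for t x y z
      using bump_eq_0[OF cutoff_nonpos[OF assms that]] by (simp add: F_t_def)
  qed
  then obtain K where K: "\<And>m n r. 0 \<le> K m n r" "\<And>m n r t x y z. t \<in> {0..T} \<Longrightarrow> \<bar>F_t \<epsilon> \<delta> c t x y z m n r\<bar> \<le> K m n r"
    by metis
  define L where "L = K 0 0 0 + K 1 0 0 + K 0 1 0 + K 0 0 1"
  have "\<bar>F_t \<epsilon> \<delta> c t x y z \<mu> \<nu> \<rho>\<bar> \<le> L * (1 + \<bar>\<mu>\<bar> + \<bar>\<nu>\<bar> + \<bar>\<rho>\<bar>)" if t: "t \<in> {0..T}" for t x y z \<mu> \<nu> \<rho>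
  proof -
    let ?A = "F_t \<epsilon> \<delta> c t x y z"
    have "?A \<mu> \<nu> \<rho> = ?A 0 0 0 + \<mu> * (?A 1 0 0 - ?A 0 0 0) + \<nu> * (?A 0 1 0 - ?A 0 0 0) + \<rho> * (?A 0 0 1 - ?A 0 0 0)"
      by (simp add: F_t_def V_t_def cutoff_t_def algebra_simps add_divide_distrib)
    then have "\<bar>?A \<mu> \<nu> \<rho>\<bar> \<le> \<bar>?A 0 0 0\<bar> + \<bar>\<mu> * (?A 1 0 0 - ?A 0 0 0)\<bar> + \<bar>\<nu> * (?A 0 1 0 - ?A 0 0 0)\<bar> + \<bar>\<rho> * (?A 0 0 1 - ?A 0 0 0)\<bar>"
      by linarith
    also have "\<dots> = \<bar>?A 0 0 0\<bar> + \<bar>\<mu>\<bar> * \<bar>?A 1 0 0 - ?A 0 0 0\<bar> + \<bar>\<nu>\<bar> * \<bar>?A 0 1 0 - ?A 0 0 0\<bar> + \<bar>\<rho>\<bar> * \<bar>?A 0 0 1 - ?A 0 0 0\<bar>"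
      by (simp only: abs_mult)
    also have "\<dots> \<le> L + \<bar>\<mu>\<bar> * L + \<bar>\<nu>\<bar> * L + \<bar>\<rho>\<bar> * L"
    proof -
      note k = K(1)[of 0 0 0] K(1)[of 1 0 0] K(1)[of 0 1 0] K(1)[of 0 0 1]
        K(2)[OF t, of x y z 0 0 0] K(2)[OF t, of x y z 1 0 0] K(2)[OF t, of x y z 0 1 0] K(2)[OF t, of x y z 0 0 1]
      show ?thesis unfolding L_def by (intro add_mono mult_left_mono) (use k in auto)
    qed
    finally show ?thesis by (simp add: algebra_simps)
  qed
  moreover have "0 \<le> L" using K(1) by (simp add: L_def)
  ultimately show ?thesis by blast
qed

text \<open>The differential equation cancels the terms with the first derivative of the sine and no derivative
  of the cutoff. The terms with a derivative of the cutoff carry a factor \<open>\<epsilon>\<close>. What remains, up to the factor of the cutoff, is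
  \<open>- \<delta>\<^sup>2 / 2 * V_w\<^sup>2 * sin\<close>, the curvature of the test function.\<close>

lemma generator_bound:
  assumes C0: "0 \<le> C0"
  shows "\<exists>C\<ge>0. \<forall>\<epsilon> t x y z \<mu>. 0 < \<epsilon> \<longrightarrow> \<epsilon> \<le> 1 \<longrightarrow> t \<in> {0..T} \<longrightarrow> \<bar>\<mu>\<bar> \<le> C0 * (1 + \<bar>x\<bar> + \<bar>y\<bar>) \<longrightarrow>
    V_t t x y z \<mu> 0 x + V_ww t x y z / 2 = 0 \<longrightarrow>
    \<bar>F_t \<epsilon> \<delta> c t x y z \<mu> 0 x + F_ww \<epsilon> \<delta> c t x y z / 2\<bar> \<le> \<delta>\<^sup>2 / 2 * (V_w t x y z)\<^sup>2 + \<epsilon> * C * (1 + (V_w t x y z)\<^sup>2)"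
proof -
  have "bounded ((\<lambda>t. \<sigma>\<^sup>2 + (\<phi> t)\<^sup>2) ` {0..T})"
    by (intro compact_imp_bounded compact_continuous_image continuous_intros \<phi>_continuous compact_Icc)
  then obtain K where K: "\<forall>v\<in>(\<lambda>t. \<sigma>\<^sup>2 + (\<phi> t)\<^sup>2) ` {0..T}. norm v \<le> K" unfolding bounded_iff by (rule exE)
  have K': "\<sigma>\<^sup>2 + (\<phi> t)\<^sup>2 \<le> K" if "t \<in> {0..T}" for t
    using bspec[OF K imageI[OF that]] by simp
  have "0 \<le> \<sigma>\<^sup>2 + (\<phi> 0)\<^sup>2" by simp
  also have "\<dots> \<le> K" using K'[of 0] T by simp
  finally have K0: "0 \<le> K" .
  define C where "C = 3 * (6 * C0 + 2) + 21 * K + 3 * (1 + 4 * K) * \<bar>\<delta>\<bar>"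
  have C_pos: "0 \<le> C" using C0 K0 by (simp add: C_def)
  have "\<bar>F_t \<epsilon> \<delta> c t x y z \<mu> 0 x + F_ww \<epsilon> \<delta> c t x y z / 2\<bar> \<le> \<delta>\<^sup>2 / 2 * (V_w t x y z)\<^sup>2 + \<epsilon> * C * (1 + (V_w t x y z)\<^sup>2)"
    if \<epsilon>: "0 < \<epsilon>" "\<epsilon> \<le> 1" and t: "t \<in> {0..T}" and \<mu>: "\<bar>\<mu>\<bar> \<le> C0 * (1 + \<bar>x\<bar> + \<bar>y\<bar>)"
      and pde: "V_t t x y z \<mu> 0 x + V_ww t x y z / 2 = 0" for \<epsilon> t x y z \<mu>
  proof -
    define R where "R = radius x y z"
    have R1: "1 \<le> R" using radius_ge_1 by (simp add: R_def)
    have xyR: "x\<^sup>2 + y\<^sup>2 \<le> R" "x\<^sup>2 \<le> R" "y\<^sup>2 \<le> R" "z\<^sup>2 \<le> R" by (simp_all add: R_def radius_def)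
    \<comment> \<open>the logarithmic derivative of the radius along the line; Cauchy-Schwarz bounds it independently of the state\<close>
    define n where "n = (2 * \<sigma> * x + 2 * \<phi> t * y) / R"
    have n2: "n\<^sup>2 \<le> 4 * K"
    proof -
      have "0 \<le> (\<sigma> * y - \<phi> t * x)\<^sup>2" by simp
      then have "(2 * \<sigma> * x + 2 * \<phi> t * y)\<^sup>2 \<le> 4 * ((\<sigma>\<^sup>2 + (\<phi> t)\<^sup>2) * (x\<^sup>2 + y\<^sup>2))"
        by (simp add: power2_eq_square algebra_simps)
      also have "\<dots> \<le> 4 * (K * R)" using K'[OF t] xyR(1) K0 by (intro mult_left_mono mult_mono) auto
      also have "\<dots> \<le> 4 * (K * R\<^sup>2)"
        using R1 K0 by (intro mult_left_mono) (auto simp: power2_eq_square)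
      finally show ?thesis using R1 by (simp add: n_def power_divide divide_le_eq)
    qed
    have abs_le: "\<bar>v\<bar> \<le> 1 + v\<^sup>2" for v :: real
    proof -
      have "0 \<le> (\<bar>v\<bar> - 1)\<^sup>2" "0 \<le> v\<^sup>2" by simp_all
      then show ?thesis by (simp add: power2_diff)
    qed
    have n1: "\<bar>n\<bar> \<le> 1 + 4 * K" using abs_le[of n] n2 by linarith
    have cw: "cutoff_w \<epsilon> t x y z = - \<epsilon> * n" by (simp add: cutoff_w_def n_def R_def)
    have cww: "\<bar>cutoff_ww \<epsilon> t x y z\<bar> \<le> \<epsilon> * (6 * K)"
    proof -
      have "\<bar>(2 * \<sigma>\<^sup>2 + 2 * (\<phi> t)\<^sup>2) / R\<bar> \<le> 2 * K / 1"
        unfolding abs_divide using K'[OF t] R1 K0 by (intro frac_le) auto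
      then have "\<bar>(2 * \<sigma>\<^sup>2 + 2 * (\<phi> t)\<^sup>2) / R - n\<^sup>2\<bar> \<le> 6 * K" using n2 zero_le_power2[of n] by linarith
      then have "\<epsilon> * \<bar>(2 * \<sigma>\<^sup>2 + 2 * (\<phi> t)\<^sup>2) / R - n\<^sup>2\<bar> \<le> \<epsilon> * (6 * K)" using \<epsilon> by (intro mult_left_mono) auto
      moreover have "cutoff_ww \<epsilon> t x y z = - \<epsilon> * ((2 * \<sigma>\<^sup>2 + 2 * (\<phi> t)\<^sup>2) / R - n\<^sup>2)"
        by (simp add: cutoff_ww_def n_def R_def)
      ultimately show ?thesis using \<epsilon> by (simp add: abs_mult)
    qed
    have ct: "\<bar>cutoff_t \<epsilon> x y z \<mu> 0 x\<bar> \<le> \<epsilon> * (6 * C0 + 2)"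
    proof -
      have prod: "\<bar>u\<bar> * \<bar>v\<bar> \<le> R" if "u\<^sup>2 \<le> R" "v\<^sup>2 \<le> R" for u v
      proof -
        have "0 \<le> (\<bar>u\<bar> - \<bar>v\<bar>)\<^sup>2" by simp
        then have "2 * (\<bar>u\<bar> * \<bar>v\<bar>) \<le> u\<^sup>2 + v\<^sup>2" by (simp add: power2_diff)
        then show ?thesis using that by linarith
      qed
      have "\<bar>x\<bar> * \<bar>\<mu>\<bar> \<le> \<bar>x\<bar> * (C0 * (1 + \<bar>x\<bar> + \<bar>y\<bar>))" by (intro mult_left_mono \<mu>) simp
      also have "\<dots> = C0 * (\<bar>x\<bar> * \<bar>1\<bar> + \<bar>x\<bar> * \<bar>x\<bar> + \<bar>x\<bar> * \<bar>y\<bar>)" by (simp add: algebra_simps)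
      also have "\<dots> \<le> C0 * (R + R + R)" using xyR R1 by (intro mult_left_mono add_mono prod C0) auto
      finally have "\<bar>x\<bar> * \<bar>\<mu>\<bar> \<le> 3 * C0 * R" by simp
      moreover have "\<bar>z\<bar> * \<bar>x\<bar> \<le> R" using xyR by (intro prod)
      moreover have "\<bar>2 * x * \<mu> + 2 * z * x\<bar> \<le> 2 * (\<bar>x\<bar> * \<bar>\<mu>\<bar>) + 2 * (\<bar>z\<bar> * \<bar>x\<bar>)"
        unfolding abs_mult[symmetric] by linarith
      ultimately have "\<bar>2 * x * \<mu> + 2 * z * x\<bar> \<le> (6 * C0 + 2) * R" by (simp add: algebra_simps)
      then have "\<bar>2 * x * \<mu> + 2 * z * x\<bar> / R \<le> 6 * C0 + 2" using R1 by (simp add: divide_le_eq)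
      then have "\<epsilon> * (\<bar>2 * x * \<mu> + 2 * z * x\<bar> / R) \<le> \<epsilon> * (6 * C0 + 2)" using \<epsilon> by (intro mult_left_mono) auto
      then show ?thesis using \<epsilon> R1 by (simp add: cutoff_t_def R_def[symmetric] abs_mult)
    qed
    let ?k = "bump (cutoff \<epsilon> x y z)" and ?k' = "bump' (cutoff \<epsilon> x y z)" and ?k'' = "bump'' (cutoff \<epsilon> x y z)"
    let ?s = "sin (\<delta> * V t x y z + c)" and ?c = "cos (\<delta> * V t x y z + c)" and ?v = "V_w t x y z"
    have k: "0 \<le> ?k" "?k \<le> 1" "0 \<le> ?k'" "?k' \<le> 3" "0 \<le> ?k''" "?k'' \<le> 6"
      using bump_le_1[OF cutoff_le_1[of \<epsilon> x y z]] \<epsilon> by auto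
    have gen: "F_t \<epsilon> \<delta> c t x y z \<mu> 0 x + F_ww \<epsilon> \<delta> c t x y z / 2
      = (?k' * (cutoff_t \<epsilon> x y z \<mu> 0 x + cutoff_ww \<epsilon> t x y z / 2) + ?k'' * (cutoff_w \<epsilon> t x y z)\<^sup>2 / 2) * ?s
        + ?k' * cutoff_w \<epsilon> t x y z * (\<delta> * ?v * ?c) - ?k * (\<delta>\<^sup>2 / 2 * ?v\<^sup>2 * ?s)
        + ?k * \<delta> * ?c * (V_t t x y z \<mu> 0 x + V_ww t x y z / 2)"
      by (simp add: F_t_def F_ww_def algebra_simps power2_eq_square add_divide_distrib diff_divide_distrib)
    have a1: "\<bar>?k' * (cutoff_t \<epsilon> x y z \<mu> 0 x + cutoff_ww \<epsilon> t x y z / 2)\<bar> \<le> 3 * (\<epsilon> * (6 * C0 + 2) + \<epsilon> * (3 * K))"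
      unfolding abs_mult using k ct cww by (intro mult_mono) auto
    have a2: "\<bar>?k'' * (cutoff_w \<epsilon> t x y z)\<^sup>2 / 2\<bar> \<le> \<epsilon> * (12 * K)"
    proof -
      have "(cutoff_w \<epsilon> t x y z)\<^sup>2 = \<epsilon> * (\<epsilon> * n\<^sup>2)" by (simp add: cw power2_eq_square)
      also have "\<dots> \<le> \<epsilon> * (1 * (4 * K))" using \<epsilon> n2 by (intro mult_left_mono mult_mono) auto
      finally have "?k'' * (cutoff_w \<epsilon> t x y z)\<^sup>2 \<le> 6 * (\<epsilon> * (4 * K))" using k by (intro mult_mono) auto
      moreover have "0 \<le> ?k'' * (cutoff_w \<epsilon> t x y z)\<^sup>2" using k by simp
      ultimately show ?thesis by simp
    qed
    have a3: "\<bar>?k' * cutoff_w \<epsilon> t x y z * (\<delta> * ?v * ?c)\<bar> \<le> 3 * (\<epsilon> * (1 + 4 * K)) * (\<bar>\<delta>\<bar> * (1 + ?v\<^sup>2))"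
    proof -
      have "\<bar>\<delta> * ?v * ?c\<bar> \<le> \<bar>\<delta>\<bar> * (1 + ?v\<^sup>2)"
      proof -
        have "\<bar>?v\<bar> * \<bar>?c\<bar> \<le> (1 + ?v\<^sup>2) * 1" by (intro mult_mono abs_le) auto
        from mult_left_mono[OF this, of "\<bar>\<delta>\<bar>"] show ?thesis by (simp add: abs_mult mult.assoc)
      qed
      moreover have "\<bar>?k' * cutoff_w \<epsilon> t x y z\<bar> \<le> 3 * (\<epsilon> * (1 + 4 * K))"
        unfolding abs_mult cw using k n1 \<epsilon> by (intro mult_mono) (auto simp: abs_mult)
      ultimately show ?thesis unfolding abs_mult[of "?k' * cutoff_w \<epsilon> t x y z"]
        by (intro mult_mono) auto
    qed
    have a4: "\<bar>?k * (\<delta>\<^sup>2 / 2 * ?v\<^sup>2 * ?s)\<bar> \<le> \<delta>\<^sup>2 / 2 * ?v\<^sup>2"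
    proof -
      have "\<bar>?k\<bar> * \<bar>\<delta>\<^sup>2 / 2 * ?v\<^sup>2 * ?s\<bar> \<le> 1 * (\<delta>\<^sup>2 / 2 * ?v\<^sup>2 * 1)"
        using k by (intro mult_mono) (auto simp: abs_mult intro!: mult_left_le)
      then show ?thesis by (simp add: abs_mult)
    qed
    have a12: "\<bar>(?k' * (cutoff_t \<epsilon> x y z \<mu> 0 x + cutoff_ww \<epsilon> t x y z / 2) + ?k'' * (cutoff_w \<epsilon> t x y z)\<^sup>2 / 2) * ?s\<bar>
        \<le> 3 * (\<epsilon> * (6 * C0 + 2) + \<epsilon> * (3 * K)) + \<epsilon> * (12 * K)"
    proof -
      have sum: "\<bar>(p + p') * ?s\<bar> \<le> \<bar>p\<bar> + \<bar>p'\<bar>" for p p'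
      proof -
        have "\<bar>p + p'\<bar> * \<bar>?s\<bar> \<le> \<bar>p + p'\<bar> * 1" by (intro mult_left_mono) auto
        then show ?thesis using abs_triangle_ineq[of p p'] by (simp add: abs_mult)
      qed
      show ?thesis by (rule order_trans[OF sum add_mono[OF a1 a2]])
    qed
    have tri: "\<bar>p1 + p2 - p3\<bar> \<le> \<bar>p1\<bar> + \<bar>p2\<bar> + \<bar>p3\<bar>" for p1 p2 p3 :: real by linarith
    have "\<bar>F_t \<epsilon> \<delta> c t x y z \<mu> 0 x + F_ww \<epsilon> \<delta> c t x y z / 2\<bar>
        \<le> (3 * (\<epsilon> * (6 * C0 + 2) + \<epsilon> * (3 * K)) + \<epsilon> * (12 * K)) + 3 * (\<epsilon> * (1 + 4 * K)) * (\<bar>\<delta>\<bar> * (1 + ?v\<^sup>2)) + \<delta>\<^sup>2 / 2 * ?v\<^sup>2"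
      unfolding gen pde mult_zero_right add_0_right
      by (rule order_trans[OF tri add_mono[OF add_mono[OF a12 a3] a4]])
    also have "\<dots> = \<epsilon> * ((3 * (6 * C0 + 2) + 21 * K) * 1 + 3 * (1 + 4 * K) * \<bar>\<delta>\<bar> * (1 + ?v\<^sup>2)) + \<delta>\<^sup>2 / 2 * ?v\<^sup>2"
      by (simp add: algebra_simps)
    also have "\<dots> \<le> \<epsilon> * ((3 * (6 * C0 + 2) + 21 * K) * (1 + ?v\<^sup>2) + 3 * (1 + 4 * K) * \<bar>\<delta>\<bar> * (1 + ?v\<^sup>2)) + \<delta>\<^sup>2 / 2 * ?v\<^sup>2"
      using \<epsilon> C0 K0 by (intro add_mono mult_left_mono order_refl) auto
    also have "\<dots> = \<delta>\<^sup>2 / 2 * ?v\<^sup>2 + \<epsilon> * C * (1 + ?v\<^sup>2)" by (simp add: C_def algebra_simps)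
    finally show ?thesis .
  qed
  then show ?thesis using C_pos by blast
qed

end

section \<open>The short-rate model as a functional of the Brownian path\<close>

lemma has_real_derivative_LINT:
  fixes f :: "real \<Rightarrow> real"
  assumes f: "continuous_on {0..} f" and t: "0 \<le> t"
  shows "((\<lambda>t. LINT s:{0..t}|lborel. f s) has_real_derivative f t) (at t within {0..})"
proof -
  have c: "continuous_on {0..t + 1} f" by (rule continuous_on_subset[OF f]) auto
  have eq: "(LINT s:{0..v}|lborel. f s) = integral {0..v} f" for v
    by (rule set_borel_integral_eq_integral(2)[OF borel_integrable_atLeastAtMost'])
      (rule continuous_on_subset[OF f], auto)
  have "((\<lambda>t. integral {0..t} f) has_real_derivative f t) (at t within {0..t + 1})"
    using t by (intro integral_has_real_derivative[OF c]) auto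
  moreover have "at t within {0..t + 1} = at t within {0..}"
    by (rule at_within_nhd[where S = "{..<t + 1}"]) auto
  ultimately show ?thesis by (simp add: eq)
qed

lemma LINT_singleton: "(LINT s:{c}|lborel. f s) = 0" for f :: "real \<Rightarrow> real"
proof -
  have "(LINT s:{c}|lborel. f s) = (\<integral>s. indicator {c} s *\<^sub>R f c \<partial>lborel)"
    unfolding set_lebesgue_integral_def by (rule Bochner_Integration.integral_cong) (auto simp: indicator_def)
  then show ?thesis by simp
qed

lemma continuous_on_LINT:
  fixes f :: "real \<Rightarrow> real"
  assumes "continuous_on {0..} f"
  shows "continuous_on {0..} (\<lambda>t. LINT s:{0..t}|lborel. f s)"
  by (rule DERIV_continuous_on) (use has_real_derivative_LINT[OF assms] in auto)

lemma LINT_combine: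
  fixes f :: "real \<Rightarrow> real"
  assumes f: "continuous_on {0..} f" and "0 \<le> s" "s \<le> t"
  shows "(LINT v:{0..t}|lborel. f v) = (LINT v:{0..s}|lborel. f v) + (LINT v:{s..t}|lborel. f v)"
proof -
  have i: "set_integrable lborel {v..w} f" if "0 \<le> v" for v w
    by (rule borel_integrable_atLeastAtMost') (rule continuous_on_subset[OF f], use that in auto)
  have hk: "f integrable_on {0..t}"
    by (rule integrable_continuous_interval) (rule continuous_on_subset[OF f], auto)
  show ?thesis
    using Henstock_Kurzweil_Integration.integral_combine[OF assms(2,3) hk] assms(2)
    by (simp add: set_borel_integral_eq_integral(2)[OF i])
qed

lemma eq_on_of_eq_on_fractions:
  fixes f g :: "real \<Rightarrow> real"
  assumes f: "continuous_on {0..} f" and g: "continuous_on {0..} g"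
    and eq: "\<And>m n. f (real m / real (Suc n)) = g (real m / real (Suc n))" and t: "0 \<le> t"
  shows "f t = g t"
proof -
  define d where "d n = real (nat \<lceil>t * real (Suc n)\<rceil>) / real (Suc n)" for n
  have num: "t * real (Suc n) \<le> real (nat \<lceil>t * real (Suc n)\<rceil>)" "real (nat \<lceil>t * real (Suc n)\<rceil>) \<le> t * real (Suc n) + 1" for n
    using t by (simp_all add: of_nat_nat del: of_nat_Suc)
  have d1: "t \<le> d n" for n
    using num(1)[of n] by (simp add: d_def pos_le_divide_eq del: of_nat_Suc)
  have d2: "d n \<le> t + inverse (real (Suc n))" for n
  proof -
    have "d n \<le> (t * real (Suc n) + 1) / real (Suc n)"
      unfolding d_def by (rule divide_right_mono[OF num(2)]) simp
    then show ?thesis by (simp add: add_divide_distrib inverse_eq_divide del: of_nat_Suc)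
  qed
  have up: "(\<lambda>n. t + inverse (real (Suc n))) \<longlonglongrightarrow> t"
    using tendsto_add[OF tendsto_const LIMSEQ_inverse_real_of_nat, of t] by simp
  have le: "\<forall>\<^sub>F n in sequentially. t \<le> d n" "\<forall>\<^sub>F n in sequentially. d n \<le> t + inverse (real (Suc n))"
    by (intro always_eventually allI d1 d2)+
  have lim: "d \<longlonglongrightarrow> t" by (rule tendsto_sandwich[OF le tendsto_const up])
  have dpos: "d n \<in> {0..}" for n using d1[of n] t by simp
  have "(\<lambda>n. f (d n)) \<longlonglongrightarrow> f t"
    by (rule continuous_on_tendsto_compose[OF f lim]) (use t dpos in auto)
  moreover have "(\<lambda>n. g (d n)) \<longlonglongrightarrow> g t"
    by (rule continuous_on_tendsto_compose[OF g lim]) (use t dpos in auto)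
  moreover have "f (d n) = g (d n)" for n unfolding d_def by (rule eq)
  ultimately show ?thesis by (simp add: LIMSEQ_unique)
qed

text \<open>The short-rate model together with a solution of the differential equation, before a terminal payoff is fixed.\<close>

locale affine_model = brownian M W for M :: "'a measure" and W :: "real \<Rightarrow> 'a \<Rightarrow> real" +
  fixes u Y Z r :: "real \<Rightarrow> 'a \<Rightarrow> real"
    and p q a b \<sigma> r0 S :: real
    and G :: "real \<Rightarrow> real \<Rightarrow> real \<Rightarrow> real"
  assumes pq: "0 < q" "- q < p" and b: "0 < b" and S: "0 < S"
    and u_integral: "\<forall>t\<ge>0. has_ito_integral M (augmented_filtration M W) W t
          (\<lambda>s \<omega>. exp ((p + q) * s) * l_fun p q s) (u t)"
    and u_paths: "continuous_paths M u"
    and Y_integral: "\<forall>s\<ge>0. has_ito_integral M (augmented_filtration M W) W s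
          (\<lambda>\<tau> \<omega>. p * exp (- (p + q) * (s - \<tau>)) * l_fun p q \<tau>) (Y s)"
    and Y_paths: "continuous_paths M Y"
    and Z: "AE \<omega> in M. \<forall>t\<ge>0. Z t \<omega> = W t \<omega> - (LINT s:{0..t}|lborel. Y s \<omega>)"
    and r: "strong_solution M (augmented_filtration M W) Z a b \<sigma> r0 r"
    and G_cont: "continuous_on ({0..S} \<times> UNIV \<times> UNIV) (\<lambda>(t, x, y). G t x y)"
    and G_C122: "C122_on S G"
    and G_pde: "\<forall>t\<in>{0..<S}. \<forall>x y. pd_t G t x y + L_op p q a b \<sigma> G t x y = 0"
    and G_square_integrable:
      "(\<integral>\<^sup>+t\<in>{0..<S}. (\<integral>\<^sup>+\<omega>. ennreal (exp (- 2 * (LINT s:{0..t}|lborel. r s \<omega>))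
          * (Delta_op p q \<sigma> G t (r t \<omega>) (u t \<omega>))\<^sup>2) \<partial>M) \<partial>lborel) < \<infinity>"
begin

text \<open>The volatility of \<open>u\<close>, with its derivative.\<close>

definition \<phi> :: "real \<Rightarrow> real" where "\<phi> t = exp ((p + q) * t) * l_fun p q t"
definition l' :: "real \<Rightarrow> real" where
  "l' t = 2 * q * p * ((p + 2 * q)\<^sup>2 * (2 * q * exp (2 * q * t))) / ((p + 2 * q)\<^sup>2 * exp (2 * q * t) - p\<^sup>2)\<^sup>2"
definition \<phi>' :: "real \<Rightarrow> real" where
  "\<phi>' t = (p + q) * exp ((p + q) * t) * l_fun p q t + exp ((p + q) * t) * l' t"

lemma denominator_pos: "0 \<le> t \<Longrightarrow> 0 < (p + 2 * q)\<^sup>2 * exp (2 * q * t) - p\<^sup>2"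
proof -
  assume t: "0 \<le> t"
  have "0 < 4 * (q * (p + q))" using pq by simp
  also have "\<dots> = (p + 2 * q)\<^sup>2 * 1 - p\<^sup>2" by (simp add: power2_eq_square algebra_simps)
  also have "\<dots> \<le> (p + 2 * q)\<^sup>2 * exp (2 * q * t) - p\<^sup>2"
    using pq t by (intro diff_right_mono mult_left_mono) auto
  finally show ?thesis .
qed

lemma \<phi>_derivative: "0 \<le> t \<Longrightarrow> (\<phi> has_real_derivative \<phi>' t) (at t)"
proof -
  assume t: "0 \<le> t"
  let ?d = "\<lambda>t. (p + 2 * q)\<^sup>2 * exp (2 * q * t) - p\<^sup>2"
  have d0: "?d t \<noteq> 0" using denominator_pos[OF t] by simp
  have "(?d has_real_derivative (p + 2 * q)\<^sup>2 * (2 * q * exp (2 * q * t))) (at t)"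
    by (auto intro!: derivative_eq_intros)
  from DERIV_diff[OF DERIV_const[of 1] DERIV_divide[OF DERIV_const[of "2 * q * p"] this d0]]
  have "(l_fun p q has_real_derivative l' t) (at t)"
    unfolding l_fun_def[abs_def] l'_def by (simp add: power2_eq_square)
  moreover have "((\<lambda>t. exp ((p + q) * t)) has_real_derivative (p + q) * exp ((p + q) * t)) (at t)"
    by (auto intro!: derivative_eq_intros)
  ultimately show ?thesis
    unfolding \<phi>_def[abs_def] \<phi>'_def by (intro DERIV_cong[OF DERIV_mult]) (assumption+, simp)
qed

lemma \<phi>_cont: "continuous_on {0..} \<phi>" and \<phi>'_cont: "continuous_on {0..} \<phi>'"
proof -
  show "continuous_on {0..} \<phi>"
    by (rule DERIV_continuous_on) (use \<phi>_derivative in \<open>auto intro: has_field_derivative_at_within\<close>)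
  have 1: "continuous_on {0..} (l_fun p q)"
    unfolding l_fun_def[abs_def] using denominator_pos by (intro continuous_intros) force
  have 2: "continuous_on {0..} l'"
    unfolding l'_def[abs_def] using denominator_pos by (intro continuous_intros) force
  show "continuous_on {0..} \<phi>'"
    unfolding \<phi>'_def[abs_def] by (intro continuous_intros 1 2)
qed

text \<open>Almost every path satisfies these deterministic identities at all times at once. The process \<open>Y\<close> has been
  eliminated: its kernel factorises as \<open>p exp (- (p + q) s) \<phi> \<tau>\<close>, so it is a deterministic multiple of \<open>u\<close>.\<close>

definition good_path :: "'a \<Rightarrow> bool" where
  "good_path \<omega> \<longleftrightarrow> continuous_on {0..} (\<lambda>t. W t \<omega>) \<and> W 0 \<omega> = 0 \<and>
    continuous_on {0..} (\<lambda>t. u t \<omega>) \<and> continuous_on {0..} (\<lambda>t. r t \<omega>) \<and>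
    (\<forall>t\<ge>0. u t \<omega> = \<phi> t * W t \<omega> - (LINT s:{0..t}|lborel. \<phi>' s * W s \<omega>)) \<and>
    (\<forall>t\<ge>0. r t \<omega> = r0 + (LINT s:{0..t}|lborel. a - b * r s \<omega>)
       + \<sigma> * (W t \<omega> - (LINT s:{0..t}|lborel. p * exp (- (p + q) * s) * u s \<omega>)))"

lemma AE_wiener_integral: "0 \<le> t \<Longrightarrow> has_ito_integral M Fil W t (\<lambda>s \<omega>. c * \<phi> s) X \<Longrightarrow>
  AE \<omega> in M. X \<omega> = c * (\<phi> t * W t \<omega> - (LINT s:{0..t}|lborel. \<phi>' s * W s \<omega>))"
proof -
  assume t: "0 \<le> t" and ito: "has_ito_integral M Fil W t (\<lambda>s \<omega>. c * \<phi> s) X"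
  have d: "((\<lambda>s. c * \<phi> s) has_real_derivative c * \<phi>' s) (at s within {0..t})" if "s \<in> {0..t}" for s
    using DERIV_cmult[OF \<phi>_derivative, of s c] that by (auto intro: has_field_derivative_at_within)
  have c: "continuous_on {0..t} (\<lambda>s. c * \<phi>' s)"
    by (intro continuous_intros continuous_on_subset[OF \<phi>'_cont]) auto
  have "AE \<omega> in M. X \<omega> = wiener_version t (\<lambda>s. c * \<phi> s) (\<lambda>s. c * \<phi>' s) \<omega>"
    by (rule ito_integral_deterministic[OF t d c ito])
  moreover have "wiener_version t (\<lambda>s. c * \<phi> s) (\<lambda>s. c * \<phi>' s) \<omega>
      = c * \<phi> t * W t \<omega> - (LINT s:{0..t}|lborel. c * \<phi>' s * W s \<omega>)" for \<omega>
    by (rule wiener_version_def[OF t _ c]) (rule d)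
  ultimately show ?thesis by (simp add: mult.assoc right_diff_distrib)
qed

text \<open>The identities hold almost surely at each fixed time, hence at all rational times, hence by path
  continuity at all times.\<close>

lemma AE_good_path: "AE \<omega> in M. good_path \<omega>"
proof -
  let ?R = "\<lambda>t \<omega>. \<phi> t * W t \<omega> - (LINT s:{0..t}|lborel. \<phi>' s * W s \<omega>)"
  have u_t: "AE \<omega> in M. u t \<omega> = ?R t \<omega>" if "0 \<le> t" for t
    using AE_wiener_integral[OF that, of 1 "u t"] u_integral that by (simp add: \<phi>_def[abs_def])
  have Y_t: "AE \<omega> in M. Y t \<omega> = p * exp (- (p + q) * t) * ?R t \<omega>" if "0 \<le> t" for t
  proof (rule AE_wiener_integral[OF that])
    have eq: "(\<lambda>\<tau> (\<omega>::'a). p * exp (- (p + q) * (t - \<tau>)) * l_fun p q \<tau>) = (\<lambda>\<tau> \<omega>. p * exp (- (p + q) * t) * \<phi> \<tau>)"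
      by (auto simp: \<phi>_def fun_eq_iff algebra_simps exp_add[symmetric] exp_diff)
    from Y_integral[rule_format, OF that]
    show "has_ito_integral M Fil W t (\<lambda>\<tau> \<omega>. p * exp (- (p + q) * t) * \<phi> \<tau>) (Y t)" unfolding eq .
  qed
  have u_all: "AE \<omega> in M. \<forall>m n. u (real m / real (Suc n)) \<omega> = ?R (real m / real (Suc n)) \<omega>"
    by (intro AE_all_countable[THEN iffD2] allI u_t) simp
  have Y_all: "AE \<omega> in M. \<forall>m n. Y (real m / real (Suc n)) \<omega> = p * exp (- (p + q) * (real m / real (Suc n))) * ?R (real m / real (Suc n)) \<omega>"
    by (intro AE_all_countable[THEN iffD2] allI Y_t) simp
  have r_eq: "AE \<omega> in M. \<forall>t\<ge>0. r t \<omega> = r0 + (LINT s:{0..t}|lborel. a - b * r s \<omega>) + \<sigma> * (Z t \<omega> - Z 0 \<omega>)"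
    and r_cont: "AE \<omega> in M. continuous_on {0..} (\<lambda>t. r t \<omega>)"
    using r by (auto simp: strong_solution_def continuous_paths_def)
  show ?thesis
    using W_paths W_0 u_paths[unfolded continuous_paths_def] Y_paths[unfolded continuous_paths_def] u_all Y_all Z r_eq r_cont
  proof eventually_elim
    case (elim \<omega>)
    have Wc: "continuous_on {0..} (\<lambda>s. \<phi>' s * W s \<omega>)" by (intro continuous_intros \<phi>'_cont elim)
    have Rc: "continuous_on {0..} (\<lambda>t. ?R t \<omega>)"
      by (intro continuous_intros \<phi>_cont elim continuous_on_LINT[OF Wc])
    have u: "u t \<omega> = ?R t \<omega>" if "0 \<le> t" for t
      by (rule eq_on_of_eq_on_fractions[OF elim(3) Rc _ that]) (use elim(5) in blast)
    have Y: "Y t \<omega> = p * exp (- (p + q) * t) * ?R t \<omega>" if "0 \<le> t" for t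
      by (rule eq_on_of_eq_on_fractions[OF elim(4) _ _ that])
        (use elim(6) in \<open>auto intro!: continuous_intros Rc\<close>)
    have Zt: "Z t \<omega> - Z 0 \<omega> = W t \<omega> - (LINT s:{0..t}|lborel. p * exp (- (p + q) * s) * u s \<omega>)" if "0 \<le> t" for t
    proof -
      have "(LINT s:{0..t}|lborel. Y s \<omega>) = (LINT s:{0..t}|lborel. p * exp (- (p + q) * s) * u s \<omega>)"
        by (intro set_lebesgue_integral_cong) (auto simp: u Y)
      moreover have "(LINT s:{0..0}|lborel. Y s \<omega>) = 0"
        using LINT_combine[OF elim(4), of 0 0] by simp
      ultimately show ?thesis using elim(7) elim(2) that by simp
    qed
    show ?case unfolding good_path_def using elim(1,2,3,9) u elim(8) Zt by simp
  qed
qed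

text \<open>After the martingale parts \<open>\<sigma> W\<close> and \<open>\<phi> W\<close> are subtracted, the short rate and \<open>u\<close> become differentiable in time; \<open>\<rho>\<close> and
  \<open>\<eta>\<close> denote these remainders.\<close>

definition z :: "real \<Rightarrow> 'a \<Rightarrow> real" where "z t \<omega> = (LINT s:{0..t}|lborel. r s \<omega>)"
definition drift :: "real \<Rightarrow> real \<Rightarrow> real \<Rightarrow> real" where
  "drift t x y = a - b * x - p * \<sigma> * exp (- (p + q) * t) * y"
definition \<rho> :: "real \<Rightarrow> 'a \<Rightarrow> real" where "\<rho> t \<omega> = r t \<omega> - \<sigma> * W t \<omega>"
definition \<eta> :: "real \<Rightarrow> 'a \<Rightarrow> real" where "\<eta> t \<omega> = u t \<omega> - \<phi> t * W t \<omega>"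

lemma good_path_derivatives:
  assumes "good_path \<omega>" "0 \<le> t"
  shows "((\<lambda>t. z t \<omega>) has_real_derivative r t \<omega>) (at t within {0..})"
    and "((\<lambda>t. \<rho> t \<omega>) has_real_derivative drift t (r t \<omega>) (u t \<omega>)) (at t within {0..})"
    and "((\<lambda>t. \<eta> t \<omega>) has_real_derivative - (\<phi>' t * W t \<omega>)) (at t within {0..})"
proof -
  have c: "continuous_on {0..} (\<lambda>t. W t \<omega>)" "continuous_on {0..} (\<lambda>t. u t \<omega>)" "continuous_on {0..} (\<lambda>t. r t \<omega>)"
    and u: "\<And>t. 0 \<le> t \<Longrightarrow> u t \<omega> = \<phi> t * W t \<omega> - (LINT s:{0..t}|lborel. \<phi>' s * W s \<omega>)"
    and r: "\<And>t. 0 \<le> t \<Longrightarrow> r t \<omega> = r0 + (LINT s:{0..t}|lborel. a - b * r s \<omega>)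
       + \<sigma> * (W t \<omega> - (LINT s:{0..t}|lborel. p * exp (- (p + q) * s) * u s \<omega>))"
    using assms(1) unfolding good_path_def by blast+
  show "((\<lambda>t. z t \<omega>) has_real_derivative r t \<omega>) (at t within {0..})"
    unfolding z_def by (rule has_real_derivative_LINT[OF c(3) assms(2)])
  have 1: "continuous_on {0..} (\<lambda>s. \<phi>' s * W s \<omega>)" "continuous_on {0..} (\<lambda>s. a - b * r s \<omega>)"
    "continuous_on {0..} (\<lambda>s. p * exp (- (p + q) * s) * u s \<omega>)"
    by (intro continuous_intros \<phi>'_cont c)+
  have d: "((\<lambda>t. r0 + (LINT s:{0..t}|lborel. a - b * r s \<omega>) - \<sigma> * (LINT s:{0..t}|lborel. p * exp (- (p + q) * s) * u s \<omega>))
      has_real_derivative 0 + (a - b * r t \<omega>) - \<sigma> * (p * exp (- (p + q) * t) * u t \<omega>)) (at t within {0..})"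
    by (intro DERIV_diff DERIV_add DERIV_const DERIV_cmult has_real_derivative_LINT 1 assms(2))
  have "((\<lambda>t. \<rho> t \<omega>) has_real_derivative 0 + (a - b * r t \<omega>) - \<sigma> * (p * exp (- (p + q) * t) * u t \<omega>)) (at t within {0..})"
    by (rule has_field_derivative_transform_within[OF d zero_less_one])
      (use assms(2) r in \<open>auto simp: \<rho>_def algebra_simps\<close>)
  then show "((\<lambda>t. \<rho> t \<omega>) has_real_derivative drift t (r t \<omega>) (u t \<omega>)) (at t within {0..})"
    by (simp add: drift_def algebra_simps)
  have "((\<lambda>t. - (LINT s:{0..t}|lborel. \<phi>' s * W s \<omega>)) has_real_derivative - (\<phi>' t * W t \<omega>)) (at t within {0..})"
    by (intro DERIV_minus has_real_derivative_LINT 1 assms(2))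
  then show "((\<lambda>t. \<eta> t \<omega>) has_real_derivative - (\<phi>' t * W t \<omega>)) (at t within {0..})"
    by (rule has_field_derivative_transform_within[OF _ zero_less_one]) (use assms(2) u in \<open>auto simp: \<eta>_def\<close>)
qed

lemma bounded_on_Icc:
  fixes f :: "real \<Rightarrow> real"
  assumes "continuous_on {0..} f"
  obtains K where "0 \<le> K" "\<forall>t\<in>{0..S}. \<bar>f t\<bar> \<le> K"
proof -
  have "continuous_on {0..S} f" by (rule continuous_on_subset[OF assms]) auto
  then have "bounded (f ` {0..S})" by (intro compact_imp_bounded compact_continuous_image compact_Icc)
  then obtain K where "\<forall>v\<in>f ` {0..S}. norm v \<le> K" unfolding bounded_iff by (rule exE)
  then have "\<forall>t\<in>{0..S}. \<bar>f t\<bar> \<le> K" by simp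
  moreover from this S have "0 \<le> K" by force
  ultimately show ?thesis by (intro that)
qed

lemma abs_diff_le_of_derivative_bound:
  fixes f f' :: "real \<Rightarrow> real"
  assumes "\<And>s. s \<in> {0..t} \<Longrightarrow> (f has_real_derivative f' s) (at s within {0..})"
    and "\<And>s. s \<in> {0..t} \<Longrightarrow> \<bar>f' s\<bar> \<le> B" and t: "0 \<le> t"
  shows "\<bar>f t - f 0\<bar> \<le> B * t"
proof -
  have "norm (f t - f 0) \<le> B * norm (t - 0)"
  proof (rule field_differentiable_bound[of "{0..t}"])
    show "(f has_field_derivative f' s) (at s within {0..t})" if "s \<in> {0..t}" for s
      by (rule DERIV_subset[OF assms(1)[OF that]]) auto
  qed (use assms in auto)
  then show ?thesis using t by simp
qed

text \<open>The state depends on the path affinely, so it is bounded by a multiple of \<open>1 + sup \<bar>W\<bar>\<close>: \<open>u\<close> by its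
  representation, and the short rate by variation of constants, that is by differentiating
  \<open>exp (b t) \<rho> t\<close>.\<close>

lemma path_bound:
  obtains C where "0 \<le> C"
    "\<forall>\<omega> \<Lambda>. good_path \<omega> \<longrightarrow> (\<forall>t\<in>{0..S}. \<bar>W t \<omega>\<bar> \<le> \<Lambda>) \<longrightarrow>
      (\<forall>t\<in>{0..S}. \<bar>r t \<omega>\<bar> \<le> C * (1 + \<Lambda>) \<and> \<bar>z t \<omega>\<bar> \<le> C * (1 + \<Lambda>) \<and> \<bar>drift t (r t \<omega>) (u t \<omega>)\<bar> \<le> C * (1 + \<Lambda>))"
proof -
  obtain K1 where K1: "0 \<le> K1" "\<forall>t\<in>{0..S}. \<bar>\<phi> t\<bar> \<le> K1" by (rule bounded_on_Icc[OF \<phi>_cont])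
  obtain K2 where K2: "0 \<le> K2" "\<forall>t\<in>{0..S}. \<bar>\<phi>' t\<bar> \<le> K2" by (rule bounded_on_Icc[OF \<phi>'_cont])
  have "continuous_on {0..} (\<lambda>t. p * \<sigma> * exp (- (p + q) * t))" by (intro continuous_intros)
  then obtain K3 where K3: "0 \<le> K3" "\<forall>t\<in>{0..S}. \<bar>p * \<sigma> * exp (- (p + q) * t)\<bar> \<le> K3" by (rule bounded_on_Icc)
  define Cu where "Cu = K1 + K2 * S"
  define C\<kappa> where "C\<kappa> = \<bar>a\<bar> + b * \<bar>\<sigma>\<bar> + K3 * Cu"
  define C\<rho> where "C\<rho> = \<bar>r0\<bar> + exp (b * S) * C\<kappa> * S"
  define Cr where "Cr = C\<rho> + \<bar>\<sigma>\<bar>"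
  define C where "C = Cr + Cr * S + (\<bar>a\<bar> + b * Cr + K3 * Cu)"
  have Cu: "0 \<le> Cu" using K1 K2 S by (simp add: Cu_def)
  have C\<kappa>: "0 \<le> C\<kappa>" using K3 Cu b by (simp add: C\<kappa>_def)
  have C\<rho>: "0 \<le> C\<rho>" using C\<kappa> S by (simp add: C\<rho>_def)
  have Cr: "0 \<le> Cr" using C\<rho> by (simp add: Cr_def)
  have C: "0 \<le> C" "Cr \<le> C" "Cr * S \<le> C" "\<bar>a\<bar> + b * Cr + K3 * Cu \<le> C"
    using Cr S b K3 Cu by (auto simp: C_def)
  have main: "\<bar>r t \<omega>\<bar> \<le> C * (1 + \<Lambda>) \<and> \<bar>z t \<omega>\<bar> \<le> C * (1 + \<Lambda>) \<and> \<bar>drift t (r t \<omega>) (u t \<omega>)\<bar> \<le> C * (1 + \<Lambda>)"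
    if g: "good_path \<omega>" and W: "\<forall>t\<in>{0..S}. \<bar>W t \<omega>\<bar> \<le> \<Lambda>" and t: "t \<in> {0..S}" for \<omega> \<Lambda> t
  proof -
    have L0: "0 \<le> \<Lambda>" using W S by force
    have W0: "W 0 \<omega> = 0" using g by (simp add: good_path_def)
    note zero = LINT_singleton
    have u_0: "u 0 \<omega> = 0" using g unfolding good_path_def by (simp add: zero)
    have r_0: "r 0 \<omega> = r0" using g unfolding good_path_def by (simp add: zero)
    have z_0: "z 0 \<omega> = 0" by (simp add: z_def zero)
    have ub: "\<bar>u s \<omega>\<bar> \<le> Cu * \<Lambda>" if s: "s \<in> {0..S}" for s
    proof -
      have "\<bar>\<eta> s \<omega> - \<eta> 0 \<omega>\<bar> \<le> (K2 * \<Lambda>) * s"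
      proof (rule abs_diff_le_of_derivative_bound)
        fix v assume v: "v \<in> {0..s}"
        then show "((\<lambda>t. \<eta> t \<omega>) has_real_derivative - (\<phi>' v * W v \<omega>)) (at v within {0..})"
          by (intro good_path_derivatives[OF g]) auto
        show "\<bar>- (\<phi>' v * W v \<omega>)\<bar> \<le> K2 * \<Lambda>"
          using K2 W v s unfolding abs_minus_cancel abs_mult by (intro mult_mono) auto
      qed (use s in auto)
      also have "\<dots> \<le> (K2 * \<Lambda>) * S" using s K2 L0 by (intro mult_left_mono) auto
      finally have "\<bar>\<eta> s \<omega>\<bar> \<le> K2 * \<Lambda> * S" by (simp add: \<eta>_def u_0 W0)
      moreover have "\<bar>\<phi> s * W s \<omega>\<bar> \<le> K1 * \<Lambda>" using K1 W s unfolding abs_mult by (intro mult_mono) auto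
      ultimately show ?thesis unfolding \<eta>_def by (simp add: Cu_def algebra_simps)
    qed
    have yb: "\<bar>p * \<sigma> * exp (- (p + q) * s) * u s \<omega>\<bar> \<le> K3 * Cu * \<Lambda>" if s: "s \<in> {0..S}" for s
    proof -
      have "\<bar>p * \<sigma> * exp (- (p + q) * s)\<bar> * \<bar>u s \<omega>\<bar> \<le> K3 * (Cu * \<Lambda>)" using K3 ub s by (intro mult_mono) auto
      then show ?thesis by (simp add: abs_mult mult.assoc)
    qed
    have rb: "\<bar>r s \<omega>\<bar> \<le> Cr * (1 + \<Lambda>)" if s: "s \<in> {0..S}" for s
    proof -
      let ?\<kappa> = "\<lambda>v. a - b * \<sigma> * W v \<omega> - p * \<sigma> * exp (- (p + q) * v) * u v \<omega>"
      have "\<bar>exp (b * s) * \<rho> s \<omega> - exp (b * 0) * \<rho> 0 \<omega>\<bar> \<le> (exp (b * S) * (C\<kappa> * (1 + \<Lambda>))) * s"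
      proof (rule abs_diff_le_of_derivative_bound)
        fix v assume v: "v \<in> {0..s}"
        have e: "((\<lambda>v. exp (b * v)) has_real_derivative b * exp (b * v)) (at v within {0..})"
          by (auto intro!: derivative_eq_intros)
        have "((\<lambda>t. \<rho> t \<omega>) has_real_derivative drift v (r v \<omega>) (u v \<omega>)) (at v within {0..})"
          using v by (intro good_path_derivatives[OF g]) auto
        from DERIV_mult[OF e this]
        show "((\<lambda>v. exp (b * v) * \<rho> v \<omega>) has_real_derivative exp (b * v) * ?\<kappa> v) (at v within {0..})"
          by (simp add: drift_def \<rho>_def algebra_simps)
        have "\<bar>b * \<sigma> * W v \<omega>\<bar> \<le> b * \<bar>\<sigma>\<bar> * \<Lambda>"
          using W v s b by (simp add: abs_mult mult_left_mono)
        then have "\<bar>?\<kappa> v\<bar> \<le> \<bar>a\<bar> + b * \<bar>\<sigma>\<bar> * \<Lambda> + K3 * Cu * \<Lambda>" using yb[of v] v s by simp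
        also have "\<dots> \<le> C\<kappa> * (1 + \<Lambda>)"
          using L0 b K3 Cu by (simp add: C\<kappa>_def algebra_simps)
        finally have "\<bar>?\<kappa> v\<bar> \<le> C\<kappa> * (1 + \<Lambda>)" .
        moreover have "exp (b * v) \<le> exp (b * S)" using v s b by simp
        ultimately show "\<bar>exp (b * v) * ?\<kappa> v\<bar> \<le> exp (b * S) * (C\<kappa> * (1 + \<Lambda>))"
          unfolding abs_mult by (intro mult_mono) auto
      qed (use s in auto)
      also have "\<dots> \<le> (exp (b * S) * (C\<kappa> * (1 + \<Lambda>))) * S"
        using s C\<kappa> L0 by (intro mult_left_mono) auto
      finally have "\<bar>exp (b * s) * \<rho> s \<omega>\<bar> \<le> \<bar>r0\<bar> + exp (b * S) * C\<kappa> * (1 + \<Lambda>) * S"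
        by (simp add: \<rho>_def r_0 W0)
      also have "\<dots> \<le> C\<rho> * (1 + \<Lambda>)" using L0 by (simp add: C\<rho>_def algebra_simps)
      finally have 1: "\<bar>exp (b * s) * \<rho> s \<omega>\<bar> \<le> C\<rho> * (1 + \<Lambda>)" .
      have "1 * \<bar>\<rho> s \<omega>\<bar> \<le> exp (b * s) * \<bar>\<rho> s \<omega>\<bar>" using b s by (intro mult_right_mono) auto
      with 1 have 2: "\<bar>\<rho> s \<omega>\<bar> \<le> C\<rho> * (1 + \<Lambda>)" by (simp add: abs_mult)
      have "\<bar>W s \<omega>\<bar> \<le> \<Lambda>" using W s by blast
      then have "\<bar>\<sigma> * W s \<omega>\<bar> \<le> \<bar>\<sigma>\<bar> * (1 + \<Lambda>)" unfolding abs_mult by (intro mult_left_mono) auto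
      then show ?thesis using 2 unfolding \<rho>_def Cr_def distrib_right[of C\<rho>] by linarith
    qed
    have rC: "\<bar>r t \<omega>\<bar> \<le> C * (1 + \<Lambda>)"
    proof -
      have "Cr * (1 + \<Lambda>) \<le> C * (1 + \<Lambda>)" using C(2) L0 by (intro mult_right_mono) auto
      then show ?thesis using rb[OF t] by linarith
    qed
    have "\<bar>z t \<omega> - z 0 \<omega>\<bar> \<le> (Cr * (1 + \<Lambda>)) * t"
    proof (rule abs_diff_le_of_derivative_bound)
      fix v assume "v \<in> {0..t}"
      then show "((\<lambda>t. z t \<omega>) has_real_derivative r v \<omega>) (at v within {0..})" "\<bar>r v \<omega>\<bar> \<le> Cr * (1 + \<Lambda>)"
        using good_path_derivatives(1)[OF g] rb[of v] t by auto
    qed (use t in auto)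
    also have "\<dots> \<le> (Cr * (1 + \<Lambda>)) * S" using t Cr L0 by (intro mult_left_mono) auto
    also have "\<dots> = (Cr * S) * (1 + \<Lambda>)" by simp
    also have "\<dots> \<le> C * (1 + \<Lambda>)" using C(3) L0 by (intro mult_right_mono) auto
    finally have zC: "\<bar>z t \<omega>\<bar> \<le> C * (1 + \<Lambda>)" by (simp add: z_0)
    have "\<bar>b * r t \<omega>\<bar> \<le> b * (Cr * (1 + \<Lambda>))" using rb[OF t] b by (simp add: abs_mult mult_left_mono)
    then have "\<bar>drift t (r t \<omega>) (u t \<omega>)\<bar> \<le> \<bar>a\<bar> + b * (Cr * (1 + \<Lambda>)) + K3 * Cu * \<Lambda>"
      using yb[OF t] unfolding drift_def by linarith
    also have "\<dots> \<le> (\<bar>a\<bar> + b * Cr + K3 * Cu) * (1 + \<Lambda>)"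
      using L0 K3 Cu by (simp add: algebra_simps)
    also have "\<dots> \<le> C * (1 + \<Lambda>)" using C(4) L0 by (intro mult_right_mono) auto
    finally show ?thesis using rC zC by blast
  qed
  show ?thesis by (rule that[OF C(1)]) (use main in blast)
qed

end

section \<open>The discounted value process is a martingale\<close>

lemma tendsto_bump_cutoff:
  assumes "\<epsilon> \<longlonglongrightarrow> 0"
  shows "(\<lambda>n. bump (cutoff (\<epsilon> n) x y z)) \<longlonglongrightarrow> 1"
proof -
  have "(\<lambda>n. (max 0 (1 - \<epsilon> n * ln (radius x y z)))^3) \<longlonglongrightarrow> (max 0 (1 - 0 * ln (radius x y z)))^3"
    by (intro tendsto_intros assms)
  then show ?thesis by (simp add: bump_def cutoff_def)
qed

context affine_model
begin

definition discounted :: "real \<Rightarrow> 'a \<Rightarrow> real" where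
  "discounted t \<omega> = exp (- z t \<omega>) * G t (r t \<omega>) (u t \<omega>)"

definition volatility :: "real \<Rightarrow> 'a \<Rightarrow> real" where
  "volatility t \<omega> = exp (- z t \<omega>) * Delta_op p q \<sigma> G t (r t \<omega>) (u t \<omega>)"

definition total_variance :: real where
  "total_variance = enn2real (\<integral>\<^sup>+t\<in>{0..<S}. (\<integral>\<^sup>+\<omega>. ennreal ((volatility t \<omega>)\<^sup>2) \<partial>M) \<partial>lborel)"

lemma total_variance_eq:
  "(\<integral>\<^sup>+t\<in>{0..<S}. (\<integral>\<^sup>+\<omega>. ennreal ((volatility t \<omega>)\<^sup>2) \<partial>M) \<partial>lborel) = ennreal total_variance"
proof -
  have "(volatility t \<omega>)\<^sup>2 = exp (- 2 * (LINT s:{0..t}|lborel. r s \<omega>)) * (Delta_op p q \<sigma> G t (r t \<omega>) (u t \<omega>))\<^sup>2" for t \<omega>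
    by (simp add: volatility_def z_def power_mult_distrib exp_double[symmetric])
  then have "(\<integral>\<^sup>+t\<in>{0..<S}. (\<integral>\<^sup>+\<omega>. ennreal ((volatility t \<omega>)\<^sup>2) \<partial>M) \<partial>lborel) < \<infinity>"
    using G_square_integrable by simp
  then show ?thesis by (simp add: total_variance_def)
qed

lemma total_variance_nonneg: "0 \<le> total_variance" by (simp add: total_variance_def)

lemma adapted:
  assumes "0 \<le> t"
  shows "r t \<in> borel_measurable (Fil t)" "u t \<in> borel_measurable (Fil t)" "z t \<in> borel_measurable (Fil t)"
proof -
  show "r t \<in> borel_measurable (Fil t)" using r assms by (simp add: strong_solution_def)
  show "u t \<in> borel_measurable (Fil t)" using u_integral assms by (simp add: has_ito_integral_def)
  have "(\<lambda>\<omega>. LINT s:{0..t}|lborel. r s \<omega>) \<in> borel_measurable (Fil t)"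
  proof (rule Fil_integral_measurable[OF assms])
    show "r s \<in> borel_measurable (Fil t)" if "0 \<le> s" "s \<le> t" for s
      using r that(1) Fil_measurable_mono[OF _ that(2)] unfolding strong_solution_def by blast
    show "AE \<omega> in M. continuous_on {0..t} (\<lambda>s. r s \<omega>)"
      using AE_good_path by eventually_elim (auto simp: good_path_def elim: continuous_on_subset)
  qed
  then show "z t \<in> borel_measurable (Fil t)" unfolding z_def[abs_def] .
qed

lemma continuous_3_measurable:
  fixes h :: "real \<Rightarrow> real \<Rightarrow> real \<Rightarrow> real"
  assumes h: "continuous_on UNIV (\<lambda>(x, y, z). h x y z)"
    and "f1 \<in> borel_measurable N" "f2 \<in> borel_measurable N" "f3 \<in> borel_measurable N"
  shows "(\<lambda>\<omega>. h (f1 \<omega>) (f2 \<omega>) (f3 \<omega>)) \<in> borel_measurable N"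
proof -
  have "(\<lambda>\<omega>. (f1 \<omega>, f2 \<omega>, f3 \<omega>)) \<in> borel_measurable N" using assms by (intro borel_measurable_Pair)
  from measurable_compose[OF this borel_measurable_continuous_onI[OF h]] show ?thesis by simp
qed

lemma discounted_adapted:
  assumes "0 \<le> t" "t \<le> S" shows "discounted t \<in> borel_measurable (Fil t)"
proof -
  have "continuous_on UNIV (\<lambda>v::real \<times> real \<times> real. (\<lambda>(t, x, y). G t x y) (t, fst v, fst (snd v)))"
    by (rule continuous_on_compose2[OF G_cont]) (use assms in \<open>auto intro!: continuous_intros\<close>)
  then have "continuous_on UNIV (\<lambda>(x, y, z). exp (- z) * G t x y)"
    by (auto simp: split_def intro!: continuous_intros)
  from continuous_3_measurable[OF this adapted[OF assms(1)]] show ?thesis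
    by (simp add: discounted_def[abs_def])
qed

lemma discounted_measurable: "0 \<le> t \<Longrightarrow> t \<le> S \<Longrightarrow> discounted t \<in> borel_measurable M"
  by (rule measurable_from_Fil[OF discounted_adapted])

lemma discounted_0: "AE \<omega> in M. discounted 0 \<omega> = G 0 r0 0"
  using AE_good_path
proof eventually_elim
  case (elim \<omega>)
  then have "u 0 \<omega> = 0" "r 0 \<omega> = r0" by (simp_all add: good_path_def LINT_singleton)
  then show ?case by (simp add: discounted_def z_def LINT_singleton)
qed

lemma c122_field_before_maturity:
  assumes T: "0 \<le> T" "T < S"
  shows "c122_field T \<phi> \<phi>' G (pd_t G) (pd_x G) (pd_y G) (pd_x (pd_x G)) (pd_x (pd_y G)) (pd_y (pd_y G))"
proof
  have sub: "t \<in> {0..<S}" if "t \<in> {0..T}" for t using that T by auto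
  have diff: "(\<lambda>s. G s x y) differentiable (at t within {0..})"
    "f \<in> {G, pd_x G, pd_y G} \<Longrightarrow> (\<lambda>v. f t v y) differentiable (at x)"
    "f \<in> {G, pd_x G, pd_y G} \<Longrightarrow> (\<lambda>v. f t x v) differentiable (at y)" if "t \<in> {0..T}" for t x y f
    using G_C122 sub[OF that] unfolding C122_on_def by blast+
  have cont: "continuous_on ({0..<S} \<times> UNIV \<times> UNIV) (\<lambda>(t, x, y). f t x y)"
    if "f \<in> {G, pd_t G, pd_x G, pd_y G, pd_x (pd_x G), pd_x (pd_y G), pd_y (pd_x G), pd_y (pd_y G)}" for f
    using G_C122 that unfolding C122_on_def by blast
  have dx: "((\<lambda>v. f t v y) has_real_derivative pd_x f t x y) (at x)"
    and dy: "((\<lambda>v. f t x v) has_real_derivative pd_y f t x y) (at y)"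
    if "t \<in> {0..T}" "f \<in> {G, pd_x G, pd_y G}" for t x y f
    using diff(2,3)[OF that] unfolding pd_x_def[of f] pd_y_def[of f] by (simp_all add: DERIV_deriv_iff_real_differentiable)
  show "0 \<le> T" by fact
  show "(\<phi> has_real_derivative \<phi>' t) (at t within {0..T})" if "t \<in> {0..T}" for t
    using \<phi>_derivative that by (auto intro: has_field_derivative_at_within)
  show "((\<lambda>s. G s x y) has_real_derivative pd_t G t x y) (at t within {0..T})" if "t \<in> {0..T}" for t x y
  proof -
    have "((\<lambda>s. G s x y) has_vector_derivative pd_t G t x y) (at t within {0..})"
      using diff(1)[OF that] unfolding pd_t_def by (simp add: vector_derivative_works)
    then show ?thesis
      unfolding has_real_derivative_iff_has_vector_derivative by (rule has_vector_derivative_within_subset) auto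
  qed
  show "((\<lambda>v. G t v y) has_real_derivative pd_x G t x y) (at x)" "((\<lambda>v. G t x v) has_real_derivative pd_y G t x y) (at y)"
    "((\<lambda>v. pd_x G t v y) has_real_derivative pd_x (pd_x G) t x y) (at x)"
    "((\<lambda>v. pd_y G t v y) has_real_derivative pd_x (pd_y G) t x y) (at x)"
    "((\<lambda>v. pd_y G t x v) has_real_derivative pd_y (pd_y G) t x y) (at y)" if "t \<in> {0..T}" for t x y
    using dx[OF that] dy[OF that] by simp_all
  show "((\<lambda>v. pd_x G t x v) has_real_derivative pd_x (pd_y G) t x y) (at y)" if t: "t \<in> {0..T}" for t x y
  proof -
    have slice: "continuous_on UNIV (\<lambda>(x, y). f t x y)" if "f \<in> {pd_x (pd_y G), pd_y (pd_x G)}" for f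
    proof -
      have "continuous_on UNIV (\<lambda>v. (\<lambda>(t, x, y). f t x y) (t, fst v, snd v))"
        by (rule continuous_on_compose2[OF cont]) (use that sub[OF t] in \<open>auto intro!: continuous_intros\<close>)
      then show ?thesis by (simp add: split_def)
    qed
    have "pd_y (pd_x G) t x y = pd_x (pd_y G) t x y"
      by (rule mixed_partials_eq[where f = "G t" and fx = "pd_x G t" and fy = "pd_y G t"])
        (use dx[OF t] dy[OF t] slice in auto)
    then show ?thesis using dy[OF t, of "pd_x G" x y] by simp
  qed
  show "continuous_on ({0..T} \<times> UNIV \<times> UNIV) (\<lambda>(t, x, y). h t x y)"
    if "h \<in> {G, pd_t G, pd_x G, pd_y G, pd_x (pd_x G), pd_x (pd_y G), pd_y (pd_y G)}" for h
    by (rule continuous_on_subset[OF cont]) (use that sub in auto)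
qed

text \<open>Dynkin's formula for the truncated test field on \<open>[s, T]\<close>. The time integral of the drift is at most
  \<open>(\<delta>\<^sup>2 / 2 + O(\<epsilon>)) E \<integral> volatility\<^sup>2 + O(\<epsilon>)\<close> by the generator bound, and \<open>total_variance\<close> is finite by hypothesis.\<close>

lemma truncated_increment_bound:
  assumes sT: "0 \<le> s" "s \<le> T" "T < S"
  shows "\<exists>C\<ge>0. \<forall>\<epsilon> A. 0 < \<epsilon> \<longrightarrow> \<epsilon> \<le> 1 \<longrightarrow> A \<in> sets (Fil s) \<longrightarrow>
    \<bar>expectation (\<lambda>\<omega>. indicator A \<omega> * (bump (cutoff \<epsilon> (r T \<omega>) (u T \<omega>) (z T \<omega>)) * sin (\<delta> * discounted T \<omega> + c)))
     - expectation (\<lambda>\<omega>. indicator A \<omega> * (bump (cutoff \<epsilon> (r s \<omega>) (u s \<omega>) (z s \<omega>)) * sin (\<delta> * discounted s \<omega> + c)))\<bar>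
    \<le> (\<delta>\<^sup>2 / 2 + \<epsilon> * C) * total_variance + \<epsilon> * C"
proof -
  have T0: "0 \<le> T" using sT by simp
  interpret c122_field T \<sigma> \<phi> \<phi>' G "pd_t G" "pd_x G" "pd_y G" "pd_x (pd_x G)" "pd_x (pd_y G)" "pd_y (pd_y G)"
    by (rule c122_field_before_maturity[OF T0 sT(3)])
  have sub: "v \<in> {0..T}" "v \<in> {0..S}" "0 \<le> v" if "v \<in> {s..T}" for v using that sT by auto
  have V_eq: "V t (r t \<omega>) (u t \<omega>) (z t \<omega>) = discounted t \<omega>" for t \<omega>
    by (simp add: V_def discounted_def)
  have V_w_eq: "V_w t (r t \<omega>) (u t \<omega>) (z t \<omega>) = volatility t \<omega>" for t \<omega>
    by (simp add: V_w_def volatility_def Delta_op_def \<phi>_def)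
  have pde: "V_t t x y zz (drift t x y) 0 x + V_ww t x y zz / 2 = 0" if "t \<in> {0..T}" for t x y zz
  proof -
    have "pd_t G t x y + L_op p q a b \<sigma> G t x y = 0" using G_pde that sT by auto
    then have "exp (- zz) * (pd_t G t x y + L_op p q a b \<sigma> G t x y) = 0" by simp
    then show ?thesis
      by (simp add: V_t_def V_ww_def L_op_def drift_def \<phi>_def field_simps power2_eq_square)
  qed
  have "continuous_on {0..} (\<lambda>t. p * \<sigma> * exp (- (p + q) * t))" by (intro continuous_intros)
  then obtain K3 where K3: "0 \<le> K3" "\<forall>t\<in>{0..S}. \<bar>p * \<sigma> * exp (- (p + q) * t)\<bar> \<le> K3" by (rule bounded_on_Icc)
  define C0 where "C0 = \<bar>a\<bar> + b + K3"
  have C0: "0 \<le> C0" using b K3 by (simp add: C0_def)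
  have drift_bound: "\<bar>drift t x y\<bar> \<le> C0 * (1 + \<bar>x\<bar> + \<bar>y\<bar>)" if "t \<in> {0..T}" for t x y
  proof -
    have "\<bar>p * \<sigma> * exp (- (p + q) * t) * y\<bar> \<le> K3 * \<bar>y\<bar>"
      using K3 that sT unfolding abs_mult[of _ y] by (intro mult_right_mono) auto
    moreover have "\<bar>b * x\<bar> = b * \<bar>x\<bar>" using b by (simp add: abs_mult)
    ultimately have "\<bar>drift t x y\<bar> \<le> \<bar>a\<bar> * 1 + b * \<bar>x\<bar> + K3 * \<bar>y\<bar>" unfolding drift_def by linarith
    also have "\<dots> \<le> \<bar>a\<bar> * (1 + \<bar>x\<bar> + \<bar>y\<bar>) + b * (1 + \<bar>x\<bar> + \<bar>y\<bar>) + K3 * (1 + \<bar>x\<bar> + \<bar>y\<bar>)"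
      using b K3 by (intro add_mono mult_left_mono) auto
    finally show ?thesis by (simp add: C0_def algebra_simps)
  qed
  obtain C where C: "0 \<le> C" and gen: "\<And>\<epsilon> t x y zz. 0 < \<epsilon> \<Longrightarrow> \<epsilon> \<le> 1 \<Longrightarrow> t \<in> {0..T} \<Longrightarrow>
    \<bar>F_t \<epsilon> \<delta> c t x y zz (drift t x y) 0 x + F_ww \<epsilon> \<delta> c t x y zz / 2\<bar> \<le> \<delta>\<^sup>2 / 2 * (V_w t x y zz)\<^sup>2 + \<epsilon> * C * (1 + (V_w t x y zz)\<^sup>2)"
    using generator_bound[OF C0, of \<delta> c] drift_bound pde by metis
  obtain Cp where Cp: "0 \<le> Cp" "\<forall>\<omega> \<Lambda>. good_path \<omega> \<longrightarrow> (\<forall>t\<in>{0..S}. \<bar>W t \<omega>\<bar> \<le> \<Lambda>) \<longrightarrow>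
      (\<forall>t\<in>{0..S}. \<bar>r t \<omega>\<bar> \<le> Cp * (1 + \<Lambda>) \<and> \<bar>z t \<omega>\<bar> \<le> Cp * (1 + \<Lambda>) \<and> \<bar>drift t (r t \<omega>) (u t \<omega>)\<bar> \<le> Cp * (1 + \<Lambda>))"
    by (rule path_bound)
  obtain \<Lambda> where \<Lambda>: "\<Lambda> \<in> borel_measurable M" "AE \<omega> in M. \<forall>t\<in>{0..S}. \<bar>W t \<omega>\<bar> \<le> \<Lambda> \<omega>"
    "\<forall>c\<ge>0. integrable M (\<lambda>\<omega>. exp (c * \<Lambda> \<omega>))"
    by (rule running_sup_exp_moments)
  obtain K' where K': "0 \<le> K'" "\<forall>t\<in>{0..S}. \<bar>\<phi>' t\<bar> \<le> K'" by (rule bounded_on_Icc[OF \<phi>'_cont])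
  have "\<bar>expectation (\<lambda>\<omega>. indicator A \<omega> * (bump (cutoff \<epsilon> (r T \<omega>) (u T \<omega>) (z T \<omega>)) * sin (\<delta> * discounted T \<omega> + c)))
     - expectation (\<lambda>\<omega>. indicator A \<omega> * (bump (cutoff \<epsilon> (r s \<omega>) (u s \<omega>) (z s \<omega>)) * sin (\<delta> * discounted s \<omega> + c)))\<bar>
    \<le> (\<delta>\<^sup>2 / 2 + \<epsilon> * (C + 1)) * total_variance + \<epsilon> * C * (T - s)" if \<epsilon>: "0 < \<epsilon>" "\<epsilon> \<le> 1" and A: "A \<in> sets (Fil s)" for \<epsilon> A
  proof -
    have A_M [measurable]: "A \<in> sets M" by (rule sets_Fil_subset[OF A])
    obtain B1 where B1: "0 \<le> B1" "\<forall>t\<in>{0..T}. \<forall>x y z. \<bar>F_ww \<epsilon> \<delta> c t x y z\<bar> \<le> B1"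
      using F_ww_bound[OF \<epsilon>(1)] by blast
    obtain B2 where B2: "0 \<le> B2" "\<forall>t\<in>{0..T}. \<forall>x y z \<mu> \<nu> \<rho>. \<bar>F_t \<epsilon> \<delta> c t x y z \<mu> \<nu> \<rho>\<bar> \<le> B2 * (1 + \<bar>\<mu>\<bar> + \<bar>\<nu>\<bar> + \<bar>\<rho>\<bar>)"
      using F_t_bound[OF \<epsilon>(1)] by blast
    define x where "x t \<omega> w = \<rho> t \<omega> + \<sigma> * w" for t \<omega> w
    define y where "y t \<omega> w = \<eta> t \<omega> + \<phi> t * w" for t \<omega> w
    define H where "H t \<omega> w = F \<epsilon> \<delta> c t (x t \<omega> w) (y t \<omega> w) (z t \<omega>)" for t \<omega> w
    define Hw where "Hw t \<omega> w = F_w \<epsilon> \<delta> c t (x t \<omega> w) (y t \<omega> w) (z t \<omega>)" for t \<omega> w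
    define Hww where "Hww t \<omega> w = F_ww \<epsilon> \<delta> c t (x t \<omega> w) (y t \<omega> w) (z t \<omega>)" for t \<omega> w
    define Ht where "Ht t \<omega> w = F_t \<epsilon> \<delta> c t (x t \<omega> w) (y t \<omega> w) (z t \<omega>) (drift t (r t \<omega>) (u t \<omega>)) (- (\<phi>' t * W t \<omega>) + \<phi>' t * w) (r t \<omega>)" for t \<omega> w
    have x_W: "x t \<omega> (W t \<omega>) = r t \<omega>" and y_W: "y t \<omega> (W t \<omega>) = u t \<omega>" for t \<omega>
      by (simp_all add: x_def y_def \<rho>_def \<eta>_def)
    have H_W: "H t \<omega> (W t \<omega>) = bump (cutoff \<epsilon> (r t \<omega>) (u t \<omega>) (z t \<omega>)) * sin (\<delta> * discounted t \<omega> + c)" for t \<omega>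
      by (simp add: H_def x_W y_W F_def V_eq)
    \<comment> \<open>integrable majorant of the time derivative, by the path bound\<close>
    define D where "D \<omega> = B2 * (1 + Cp * (1 + \<Lambda> \<omega>) + 2 * K' * \<Lambda> \<omega> + Cp * (1 + \<Lambda> \<omega>))" for \<omega>
    have \<Lambda>_int: "integrable M \<Lambda>"
    proof (rule Bochner_Integration.integrable_bound[OF \<Lambda>(3)[rule_format, of 1]])
      show "AE \<omega> in M. norm (\<Lambda> \<omega>) \<le> norm (exp (1 * \<Lambda> \<omega>))"
        using \<Lambda>(2)
      proof eventually_elim
        case (elim \<omega>)
        then have "0 \<le> \<Lambda> \<omega>" using S by force
        moreover have "\<Lambda> \<omega> \<le> exp (\<Lambda> \<omega>)" using exp_ge_add_one_self[of "\<Lambda> \<omega>"] by linarith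
        ultimately show ?case by simp
      qed
    qed (use \<Lambda>(1) in auto)
    have joint: "(\<lambda>(\<omega>, w). H t \<omega> w) \<in> borel_measurable (Fil t \<Otimes>\<^sub>M borel)" if "t \<in> {s..T}" for t
    proof -
      have [measurable]: "W t \<in> borel_measurable (Fil t)" "r t \<in> borel_measurable (Fil t)" "u t \<in> borel_measurable (Fil t)" "z t \<in> borel_measurable (Fil t)"
        using W_adapted[OF sub(3)[OF that] order_refl] adapted[OF sub(3)[OF that]] by auto
      have cF: "continuous_on UNIV (\<lambda>(x, y, z). F \<epsilon> \<delta> c t x y z)"
        unfolding split_def by (rule field_continuous(1)) (use sub(1)[OF that] in \<open>auto intro!: continuous_intros\<close>)
      show ?thesis unfolding H_def split_def
        by (rule continuous_3_measurable[OF cF]) (simp_all add: x_def y_def \<rho>_def \<eta>_def)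
    qed
    have M_meas [measurable]: "W t \<in> borel_measurable M" "r t \<in> borel_measurable M" "u t \<in> borel_measurable M" "z t \<in> borel_measurable M" if "t \<in> {s..T}" for t
      using W_measurable[OF sub(3)[OF that]] adapted[OF sub(3)[OF that]] measurable_from_Fil by auto
    have Ht_meas: "(\<lambda>\<omega>. Ht t \<omega> (W t \<omega>)) \<in> borel_measurable M" if t: "t \<in> {s..T}" for t
    proof -
      have cF: "continuous_on UNIV (\<lambda>(x, y, z). F_t \<epsilon> \<delta> c t x y z (drift t x y) 0 x)"
        unfolding split_def drift_def
        by (rule field_continuous(3)) (use sub(1)[OF that] in \<open>auto intro!: continuous_intros\<close>)
      show ?thesis unfolding Ht_def x_W y_W
        using continuous_3_measurable[OF cF M_meas(2,3,4)[OF t]] by simp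
    qed
    have Hww_meas: "(\<lambda>\<omega>. Hww t \<omega> (W t \<omega>)) \<in> borel_measurable M" if t: "t \<in> {s..T}" for t
    proof -
      have cF: "continuous_on UNIV (\<lambda>(x, y, z). F_ww \<epsilon> \<delta> c t x y z)"
        unfolding split_def by (rule field_continuous(2)) (use sub(1)[OF that] in \<open>auto intro!: continuous_intros\<close>)
      show ?thesis unfolding Hww_def x_W y_W
        using continuous_3_measurable[OF cF M_meas(2,3,4)[OF t]] by simp
    qed
    have H_bd: "\<bar>H t \<omega> w\<bar> \<le> 1 + B1" for t \<omega> w
      using F_bound[OF \<epsilon>(1), of \<delta> c t "x t \<omega> w" "y t \<omega> w" "z t \<omega>"] B1(1) unfolding H_def by linarith
    have Hww_bd: "\<bar>Hww t \<omega> w\<bar> \<le> 1 + B1" if "t \<in> {s..T}" for t \<omega> w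
    proof -
      have "\<bar>Hww t \<omega> w\<bar> \<le> B1" unfolding Hww_def using B1(2) sub(1)[OF that] by blast
      then show ?thesis by linarith
    qed
    have deriv: "AE \<omega> in M. \<forall>t\<in>{s..T}. \<forall>w.
        ((\<lambda>t. H t \<omega> w) has_real_derivative Ht t \<omega> w) (at t within {s..T}) \<and>
        (H t \<omega> has_real_derivative Hw t \<omega> w) (at w) \<and> (Hw t \<omega> has_real_derivative Hww t \<omega> w) (at w)"
      using AE_good_path
    proof eventually_elim
      case (elim \<omega>)
      show ?case
      proof (intro ballI allI conjI)
        fix t w assume t: "t \<in> {s..T}"
        note g = good_path_derivatives[OF elim sub(3)[OF t]]
        have w: "(f has_real_derivative f') (at t within {0..T})" if "(f has_real_derivative f') (at t within {0..})" for f f'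
          by (rule DERIV_subset[OF that]) auto
        have X: "((\<lambda>t. x t \<omega> w) has_real_derivative drift t (r t \<omega>) (u t \<omega>)) (at t within {0..T})"
          unfolding x_def using DERIV_add[OF w[OF g(2)] DERIV_const] by simp
        have Y: "((\<lambda>t. y t \<omega> w) has_real_derivative - (\<phi>' t * W t \<omega>) + \<phi>' t * w) (at t within {0..T})"
          unfolding y_def by (rule DERIV_add[OF w[OF g(3)] DERIV_cmult_right[OF \<phi>[OF sub(1)[OF t]]]])
        have "((\<lambda>t. H t \<omega> w) has_real_derivative Ht t \<omega> w) (at t within {0..T})"
          unfolding H_def Ht_def by (rule derivative_along_curve[OF sub(1)[OF t] X Y w[OF g(1)]])
        then show "((\<lambda>t. H t \<omega> w) has_real_derivative Ht t \<omega> w) (at t within {s..T})"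
          by (rule DERIV_subset) (use sT in auto)
        show "(H t \<omega> has_real_derivative Hw t \<omega> w) (at w)" "(Hw t \<omega> has_real_derivative Hww t \<omega> w) (at w)"
          unfolding H_def[abs_def] Hw_def[abs_def] Hww_def x_def y_def
          by (rule derivative_along_line[OF sub(1)[OF t]])+
      qed
    qed
    have cont: "AE \<omega> in M. continuous_on ({s..T} \<times> UNIV) (\<lambda>(t, w). Ht t \<omega> w) \<and> continuous_on ({s..T} \<times> UNIV) (\<lambda>(t, w). Hww t \<omega> w)"
      using AE_good_path
    proof eventually_elim
      case (elim \<omega>)
      let ?A = "{s..T} \<times> (UNIV :: real set)"
      have lift: "continuous_on ?A (\<lambda>v. f (fst v))" if "continuous_on {0..} f" for f :: "real \<Rightarrow> real"
        by (rule continuous_on_compose2[OF that continuous_on_fst[OF continuous_on_id]]) (use sT in auto)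
      have cr: "continuous_on {0..} (\<lambda>t. r t \<omega>)" and cu: "continuous_on {0..} (\<lambda>t. u t \<omega>)" and cW: "continuous_on {0..} (\<lambda>t. W t \<omega>)"
        using elim by (auto simp: good_path_def)
      have cz: "continuous_on {0..} (\<lambda>t. z t \<omega>)" unfolding z_def by (rule continuous_on_LINT[OF cr])
      note L = lift[OF cr] lift[OF cu] lift[OF cW] lift[OF cz] lift[OF \<phi>_cont] lift[OF \<phi>'_cont]
      have \<tau>: "continuous_on ?A fst" "\<And>v. v \<in> ?A \<Longrightarrow> fst v \<in> {0..T}" using sT by (auto intro!: continuous_intros)
      have cx: "continuous_on ?A (\<lambda>v. x (fst v) \<omega> (snd v))" and cy: "continuous_on ?A (\<lambda>v. y (fst v) \<omega> (snd v))"
        unfolding x_def y_def \<rho>_def \<eta>_def by (intro continuous_intros L)+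
      have cd: "continuous_on ?A (\<lambda>v. drift (fst v) (r (fst v) \<omega>) (u (fst v) \<omega>))"
        unfolding drift_def by (intro continuous_intros L)
      have cn: "continuous_on ?A (\<lambda>v. - (\<phi>' (fst v) * W (fst v) \<omega>) + \<phi>' (fst v) * snd v)"
        by (intro continuous_intros L)
      have "continuous_on ?A (\<lambda>v. Ht (fst v) \<omega> (snd v))"
        unfolding Ht_def by (rule field_continuous(3)[OF \<tau> cx cy L(4) cd cn L(1)])
      moreover have "continuous_on ?A (\<lambda>v. Hww (fst v) \<omega> (snd v))"
        unfolding Hww_def by (rule field_continuous(2)[OF \<tau> cx cy L(4)])
      ultimately show ?case by (simp add: split_def)
    qed
    have dom: "AE \<omega> in M. \<forall>t\<in>{s..T}. \<forall>t'\<in>{s..T}. \<bar>Ht t \<omega> (W t' \<omega>)\<bar> \<le> D \<omega>"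
      using AE_good_path \<Lambda>(2)
    proof eventually_elim
      case (elim \<omega>)
      show ?case
      proof (intro ballI)
        fix t t' assume t: "t \<in> {s..T}" and t': "t' \<in> {s..T}"
        have W: "\<bar>W t \<omega>\<bar> \<le> \<Lambda> \<omega>" "\<bar>W t' \<omega>\<bar> \<le> \<Lambda> \<omega>" using elim(2) sub(2)[OF t] sub(2)[OF t'] by auto
        have pb: "\<bar>r t \<omega>\<bar> \<le> Cp * (1 + \<Lambda> \<omega>)" "\<bar>drift t (r t \<omega>) (u t \<omega>)\<bar> \<le> Cp * (1 + \<Lambda> \<omega>)"
          using Cp(2) elim sub(2)[OF t] by blast+
        have "\<bar>\<phi>' t\<bar> \<le> K'" using K' sub(2)[OF t] by blast
        then have "\<bar>\<phi>' t * W t \<omega>\<bar> \<le> K' * \<Lambda> \<omega>" "\<bar>\<phi>' t * W t' \<omega>\<bar> \<le> K' * \<Lambda> \<omega>"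
          using W K'(1) unfolding abs_mult by (auto intro: mult_mono)
        then have yb: "\<bar>- (\<phi>' t * W t \<omega>) + \<phi>' t * W t' \<omega>\<bar> \<le> 2 * K' * \<Lambda> \<omega>" by linarith
        have "\<bar>Ht t \<omega> (W t' \<omega>)\<bar> \<le> B2 * (1 + \<bar>drift t (r t \<omega>) (u t \<omega>)\<bar> + \<bar>- (\<phi>' t * W t \<omega>) + \<phi>' t * W t' \<omega>\<bar> + \<bar>r t \<omega>\<bar>)"
          unfolding Ht_def using B2(2) sub(1)[OF t] by blast
        also have "\<dots> \<le> D \<omega>" unfolding D_def using pb yb B2(1) by (intro mult_left_mono add_mono order_refl)
        finally show "\<bar>Ht t \<omega> (W t' \<omega>)\<bar> \<le> D \<omega>" .
      qed
    qed
    have D_int: "integrable M D" unfolding D_def[abs_def] using \<Lambda>_int by simp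
    define d where "d t = expectation (\<lambda>\<omega>. indicator A \<omega> * (Ht t \<omega> (W t \<omega>) + Hww t \<omega> (W t \<omega>) / 2))" for t
    have cont1: "AE \<omega> in M. continuous_on ({s..T} \<times> UNIV) (\<lambda>(t, w). Ht t \<omega> w)"
      and cont2: "AE \<omega> in M. continuous_on ({s..T} \<times> UNIV) (\<lambda>(t, w). Hww t \<omega> w)"
      using cont by (eventually_elim; blast)+
    note dyn = dynkin_formula[OF sT(1) joint Ht_meas Hww_meas H_bd Hww_bd deriv cont1 cont2 dom D_int A sT(2)]
    have d_cont: "continuous_on {s..T} d" unfolding d_def by (rule dyn(1))
    have dyn2: "expectation (\<lambda>\<omega>. indicator A \<omega> * H T \<omega> (W T \<omega>)) - expectation (\<lambda>\<omega>. indicator A \<omega> * H s \<omega> (W s \<omega>))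
        = (LINT t:{s..T}|lborel. d t)" unfolding d_def by (rule dyn(2))
    define k where "k = \<delta>\<^sup>2 / 2 + \<epsilon> * (C + 1)"
    have k: "0 < k" unfolding k_def using \<epsilon> C by (intro add_nonneg_pos) auto
    \<comment> \<open>the part of the drift above \<open>\<epsilon> C\<close>; it is continuous, and it lies below the variance, whose measurability in time need not be discussed\<close>
    define excess where "excess t = max 0 (\<bar>d t\<bar> - \<epsilon> * C) / k" for t
    have excess_cont: "continuous_on {s..T} excess" unfolding excess_def using k by (intro continuous_intros d_cont) auto
    have excess_nonneg: "0 \<le> excess t" for t using k by (simp add: excess_def)
    have excess_le: "ennreal (excess t) \<le> (\<integral>\<^sup>+\<omega>. ennreal ((volatility t \<omega>)\<^sup>2) \<partial>M)" if t: "t \<in> {s..T}" for t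
    proof -
      have vol_meas: "(\<lambda>\<omega>. (volatility t \<omega>)\<^sup>2) \<in> borel_measurable M"
      proof -
        have "continuous_on UNIV (\<lambda>v::real \<times> real \<times> real. h ((\<lambda>_. t) v) (fst v) (fst (snd v)))" if "h \<in> {pd_x G, pd_y G}" for h
          by (rule continuous_partials_comp) (use that sub(1)[OF t] in \<open>auto intro!: continuous_intros\<close>)
        from this[of "pd_x G"] this[of "pd_y G"]
        have c: "continuous_on UNIV (\<lambda>v::real \<times> real \<times> real. pd_x G t (fst v) (fst (snd v)))"
          "continuous_on UNIV (\<lambda>v::real \<times> real \<times> real. pd_y G t (fst v) (fst (snd v)))" by simp_all
        have "continuous_on UNIV (\<lambda>(x, y, z). V_w t x y z)"
          unfolding split_def V_w_def by (intro continuous_intros c)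
        from continuous_3_measurable[OF this M_meas(2,3,4)[OF t]] show ?thesis unfolding V_w_eq by simp
      qed
      have "ennreal \<bar>d t\<bar> \<le> (\<integral>\<^sup>+\<omega>. ennreal \<bar>indicator A \<omega> * (Ht t \<omega> (W t \<omega>) + Hww t \<omega> (W t \<omega>) / 2)\<bar> \<partial>M)"
      proof (cases "integrable M (\<lambda>\<omega>. indicator A \<omega> * (Ht t \<omega> (W t \<omega>) + Hww t \<omega> (W t \<omega>) / 2))")
        case True
        from integral_norm_bound_ennreal[OF this] show ?thesis by (simp add: d_def)
      qed (simp add: d_def not_integrable_integral_eq)
      also have "\<dots> \<le> (\<integral>\<^sup>+\<omega>. ennreal k * ennreal ((volatility t \<omega>)\<^sup>2) + ennreal (\<epsilon> * C) \<partial>M)"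
      proof (rule nn_integral_mono)
        fix \<omega>
        have "\<bar>Ht t \<omega> (W t \<omega>) + Hww t \<omega> (W t \<omega>) / 2\<bar> \<le> \<delta>\<^sup>2 / 2 * (volatility t \<omega>)\<^sup>2 + \<epsilon> * C * (1 + (volatility t \<omega>)\<^sup>2)"
          unfolding Ht_def Hww_def x_W y_W V_w_eq[symmetric] using gen[OF \<epsilon> sub(1)[OF t], of "r t \<omega>" "u t \<omega>" "z t \<omega>"] by simp
        also have "\<dots> \<le> k * (volatility t \<omega>)\<^sup>2 + \<epsilon> * C" using \<epsilon> by (simp add: k_def algebra_simps)
        finally have "\<bar>indicator A \<omega> * (Ht t \<omega> (W t \<omega>) + Hww t \<omega> (W t \<omega>) / 2)\<bar> \<le> k * (volatility t \<omega>)\<^sup>2 + \<epsilon> * C"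
          using k \<epsilon> C by (auto simp: indicator_def)
        then have "ennreal \<bar>indicator A \<omega> * (Ht t \<omega> (W t \<omega>) + Hww t \<omega> (W t \<omega>) / 2)\<bar> \<le> ennreal (k * (volatility t \<omega>)\<^sup>2 + \<epsilon> * C)"
          by (rule ennreal_leI)
        then show "ennreal \<bar>indicator A \<omega> * (Ht t \<omega> (W t \<omega>) + Hww t \<omega> (W t \<omega>) / 2)\<bar> \<le> ennreal k * ennreal ((volatility t \<omega>)\<^sup>2) + ennreal (\<epsilon> * C)"
          using k \<epsilon> C by (simp add: ennreal_plus ennreal_mult)
      qed
      also have "\<dots> = ennreal k * (\<integral>\<^sup>+\<omega>. ennreal ((volatility t \<omega>)\<^sup>2) \<partial>M) + ennreal (\<epsilon> * C)"
        using vol_meas by (subst nn_integral_add) (auto simp: nn_integral_cmult emeasure_space_1)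
      finally have le: "ennreal \<bar>d t\<bar> \<le> ennreal k * (\<integral>\<^sup>+\<omega>. ennreal ((volatility t \<omega>)\<^sup>2) \<partial>M) + ennreal (\<epsilon> * C)" .
      show ?thesis
      proof (cases "\<integral>\<^sup>+\<omega>. ennreal ((volatility t \<omega>)\<^sup>2) \<partial>M")
        case (real i)
        then have "ennreal \<bar>d t\<bar> \<le> ennreal (k * i + \<epsilon> * C)" using le k \<epsilon> C by (simp add: ennreal_plus ennreal_mult)
        then have "\<bar>d t\<bar> \<le> k * i + \<epsilon> * C" using k \<epsilon> C real by (subst (asm) ennreal_le_iff) auto
        then have "max 0 (\<bar>d t\<bar> - \<epsilon> * C) \<le> i * k" using k real by (auto simp: mult.commute)
        then have "excess t \<le> i" using k by (simp add: excess_def pos_divide_le_eq)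
        then show ?thesis using real by (simp add: ennreal_leI)
      qed simp
    qed
    have excess_int: "set_integrable lborel {s..T} excess" by (rule borel_integrable_atLeastAtMost'[OF excess_cont])
    have "ennreal (LINT t:{s..T}|lborel. excess t) = (\<integral>\<^sup>+t. ennreal (indicator {s..T} t * excess t) \<partial>lborel)"
      unfolding set_lebesgue_integral_def using excess_int excess_nonneg
      by (subst nn_integral_eq_integral) (auto simp: set_integrable_def)
    also have "\<dots> \<le> (\<integral>\<^sup>+t\<in>{0..<S}. (\<integral>\<^sup>+\<omega>. ennreal ((volatility t \<omega>)\<^sup>2) \<partial>M) \<partial>lborel)"
    proof (rule nn_integral_mono)
      fix t
      show "ennreal (indicator {s..T} t * excess t) \<le> (\<integral>\<^sup>+\<omega>. ennreal ((volatility t \<omega>)\<^sup>2) \<partial>M) * indicator {0..<S} t"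
        using excess_le[of t] sT by (cases "t \<in> {s..T}") auto
    qed
    finally have "ennreal (LINT t:{s..T}|lborel. excess t) \<le> ennreal total_variance" unfolding total_variance_eq .
    then have excess_total: "(LINT t:{s..T}|lborel. excess t) \<le> total_variance"
      using total_variance_nonneg by (subst (asm) ennreal_le_iff) auto
    have d_int: "set_integrable lborel {s..T} d" by (rule borel_integrable_atLeastAtMost'[OF d_cont])
    have "\<bar>LINT t:{s..T}|lborel. d t\<bar> \<le> (LINT t:{s..T}|lborel. \<bar>d t\<bar>)"
      using set_integral_norm_bound[OF d_int] by simp
    also have "\<dots> \<le> (LINT t:{s..T}|lborel. \<epsilon> * C + k * excess t)"
    proof (rule set_integral_mono)
      show "set_integrable lborel {s..T} (\<lambda>t. \<bar>d t\<bar>)" using set_integrable_abs[OF d_int] .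
      show "set_integrable lborel {s..T} (\<lambda>t. \<epsilon> * C + k * excess t)"
        by (rule borel_integrable_atLeastAtMost') (intro continuous_intros excess_cont)
      show "\<bar>d t\<bar> \<le> \<epsilon> * C + k * excess t" for t using k by (simp add: excess_def max_def)
    qed
    also have "\<dots> = (LINT t:{s..T}|lborel. \<epsilon> * C) + k * (LINT t:{s..T}|lborel. excess t)"
      using excess_int by (subst set_integral_add) (auto intro: borel_integrable_atLeastAtMost' simp: set_integrable_mult_right)
    also have "(LINT t:{s..T}|lborel. \<epsilon> * C) = \<epsilon> * C * (T - s)"
      using sT by (simp add: set_lebesgue_integral_def)
    also have "\<epsilon> * C * (T - s) + k * (LINT t:{s..T}|lborel. excess t) \<le> \<epsilon> * C * (T - s) + k * total_variance"
      using k excess_total by (intro add_left_mono mult_left_mono) auto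
    finally have "\<bar>LINT t:{s..T}|lborel. d t\<bar> \<le> \<epsilon> * C * (T - s) + k * total_variance" .
    then show ?thesis unfolding dyn2[symmetric] H_W k_def by (simp only: add.commute)
  qed
  note bound = this
  define C' where "C' = (C + 1) * (1 + (T - s))"
  have C': "0 \<le> C'" "C + 1 \<le> C'" "C * (T - s) \<le> C'"
  proof -
    have "C' = C + 1 + C * (T - s) + (T - s)" by (simp add: C'_def algebra_simps)
    moreover have "0 \<le> C * (T - s)" "0 \<le> T - s" using C sT by auto
    ultimately show "0 \<le> C'" "C + 1 \<le> C'" "C * (T - s) \<le> C'" using C by linarith+
  qed
  show ?thesis
  proof (intro exI[of _ C'] conjI allI impI C'(1))
    fix \<epsilon> :: real and A assume \<epsilon>: "0 < \<epsilon>" "\<epsilon> \<le> 1" and A: "A \<in> sets (Fil s)"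
    have "(\<delta>\<^sup>2 / 2 + \<epsilon> * (C + 1)) * total_variance + \<epsilon> * C * (T - s) \<le> (\<delta>\<^sup>2 / 2 + \<epsilon> * C') * total_variance + \<epsilon> * C'"
      using C' \<epsilon> total_variance_nonneg unfolding mult.assoc[of \<epsilon> C]
      by (intro add_mono mult_right_mono mult_left_mono order_refl) auto
    with bound[OF \<epsilon> A] show "\<bar>expectation (\<lambda>\<omega>. indicator A \<omega> * (bump (cutoff \<epsilon> (r T \<omega>) (u T \<omega>) (z T \<omega>)) * sin (\<delta> * discounted T \<omega> + c)))
      - expectation (\<lambda>\<omega>. indicator A \<omega> * (bump (cutoff \<epsilon> (r s \<omega>) (u s \<omega>) (z s \<omega>)) * sin (\<delta> * discounted s \<omega> + c)))\<bar>
      \<le> (\<delta>\<^sup>2 / 2 + \<epsilon> * C') * total_variance + \<epsilon> * C'" by (rule order_trans)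
  qed
qed

text \<open>Removing the cutoff: it tends to \<open>1\<close> everywhere as \<open>\<epsilon> \<longlonglongrightarrow> 0\<close>.\<close>

lemma sin_discounted_increment_before_maturity:
  assumes sT: "0 \<le> s" "s \<le> T" "T < S" and A: "A \<in> sets (Fil s)"
  shows "\<bar>expectation (\<lambda>\<omega>. indicator A \<omega> * sin (\<delta> * discounted T \<omega> + c))
      - expectation (\<lambda>\<omega>. indicator A \<omega> * sin (\<delta> * discounted s \<omega> + c))\<bar> \<le> \<delta>\<^sup>2 / 2 * total_variance"
proof -
  have A_M [measurable]: "A \<in> sets M" by (rule sets_Fil_subset[OF A])
  define \<epsilon> where "\<epsilon> n = inverse (real (Suc n))" for n
  have \<epsilon>: "0 < \<epsilon> n" "\<epsilon> n \<le> 1" for n by (auto simp: \<epsilon>_def intro: inverse_le_1_iff[THEN iffD2])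
  have \<epsilon>_lim: "\<epsilon> \<longlonglongrightarrow> 0" unfolding \<epsilon>_def by (rule LIMSEQ_inverse_real_of_nat)
  define E where "E n t = expectation (\<lambda>\<omega>. indicator A \<omega> * (bump (cutoff (\<epsilon> n) (r t \<omega>) (u t \<omega>) (z t \<omega>)) * sin (\<delta> * discounted t \<omega> + c)))" for n t
  have lim: "(\<lambda>n. E n t) \<longlonglongrightarrow> expectation (\<lambda>\<omega>. indicator A \<omega> * sin (\<delta> * discounted t \<omega> + c))" if t: "0 \<le> t" "t \<le> S" for t
    unfolding E_def
  proof (rule integral_dominated_convergence[where w = "\<lambda>_. 1"])
    note [measurable] = discounted_measurable[OF t] adapted[OF t(1), THEN measurable_from_Fil]
    show "(\<lambda>\<omega>. indicator A \<omega> * sin (\<delta> * discounted t \<omega> + c)) \<in> borel_measurable M" by measurable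
    show "(\<lambda>\<omega>. indicator A \<omega> * (bump (cutoff (\<epsilon> n) (r t \<omega>) (u t \<omega>) (z t \<omega>)) * sin (\<delta> * discounted t \<omega> + c))) \<in> borel_measurable M" for n
      unfolding bump_def cutoff_def radius_def by measurable
    show "AE \<omega> in M. (\<lambda>n. indicator A \<omega> * (bump (cutoff (\<epsilon> n) (r t \<omega>) (u t \<omega>) (z t \<omega>)) * sin (\<delta> * discounted t \<omega> + c)))
        \<longlonglongrightarrow> indicator A \<omega> * sin (\<delta> * discounted t \<omega> + c)"
    proof (rule AE_I2)
      fix \<omega>
      have "(\<lambda>n. indicator A \<omega> * (bump (cutoff (\<epsilon> n) (r t \<omega>) (u t \<omega>) (z t \<omega>)) * sin (\<delta> * discounted t \<omega> + c)))
        \<longlonglongrightarrow> indicator A \<omega> * (1 * sin (\<delta> * discounted t \<omega> + c))"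
        by (intro tendsto_mult tendsto_const tendsto_bump_cutoff \<epsilon>_lim)
      then show "(\<lambda>n. indicator A \<omega> * (bump (cutoff (\<epsilon> n) (r t \<omega>) (u t \<omega>) (z t \<omega>)) * sin (\<delta> * discounted t \<omega> + c)))
        \<longlonglongrightarrow> indicator A \<omega> * sin (\<delta> * discounted t \<omega> + c)" by simp
    qed
    show "AE \<omega> in M. norm (indicator A \<omega> * (bump (cutoff (\<epsilon> n) (r t \<omega>) (u t \<omega>) (z t \<omega>)) * sin (\<delta> * discounted t \<omega> + c))) \<le> 1" for n
    proof (rule AE_I2)
      fix \<omega>
      have "0 \<le> bump (cutoff (\<epsilon> n) (r t \<omega>) (u t \<omega>) (z t \<omega>))" "bump (cutoff (\<epsilon> n) (r t \<omega>) (u t \<omega>) (z t \<omega>)) \<le> 1"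
        using bump_le_1[OF cutoff_le_1] \<epsilon>(1)[of n] by (auto simp: less_imp_le)
      then have "\<bar>bump (cutoff (\<epsilon> n) (r t \<omega>) (u t \<omega>) (z t \<omega>))\<bar> * \<bar>sin (\<delta> * discounted t \<omega> + c)\<bar> \<le> 1"
        by (intro mult_le_one) auto
      then show "norm (indicator A \<omega> * (bump (cutoff (\<epsilon> n) (r t \<omega>) (u t \<omega>) (z t \<omega>)) * sin (\<delta> * discounted t \<omega> + c))) \<le> 1"
        by (simp add: indicator_def abs_mult)
    qed
  qed simp
  obtain C where C: "0 \<le> C" "\<forall>\<epsilon> A. 0 < \<epsilon> \<longrightarrow> \<epsilon> \<le> 1 \<longrightarrow> A \<in> sets (Fil s) \<longrightarrow>
    \<bar>expectation (\<lambda>\<omega>. indicator A \<omega> * (bump (cutoff \<epsilon> (r T \<omega>) (u T \<omega>) (z T \<omega>)) * sin (\<delta> * discounted T \<omega> + c)))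
     - expectation (\<lambda>\<omega>. indicator A \<omega> * (bump (cutoff \<epsilon> (r s \<omega>) (u s \<omega>) (z s \<omega>)) * sin (\<delta> * discounted s \<omega> + c)))\<bar>
    \<le> (\<delta>\<^sup>2 / 2 + \<epsilon> * C) * total_variance + \<epsilon> * C"
    using truncated_increment_bound[OF sT, of \<delta> c] by blast
  have le: "\<bar>E n T - E n s\<bar> \<le> (\<delta>\<^sup>2 / 2 + \<epsilon> n * C) * total_variance + \<epsilon> n * C" for n
    unfolding E_def using C(2) \<epsilon> A by blast
  have "(\<lambda>n. \<bar>E n T - E n s\<bar>) \<longlonglongrightarrow> \<bar>expectation (\<lambda>\<omega>. indicator A \<omega> * sin (\<delta> * discounted T \<omega> + c))
      - expectation (\<lambda>\<omega>. indicator A \<omega> * sin (\<delta> * discounted s \<omega> + c))\<bar>"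
    using sT by (intro tendsto_rabs tendsto_diff lim) auto
  moreover have "(\<lambda>n. (\<delta>\<^sup>2 / 2 + \<epsilon> n * C) * total_variance + \<epsilon> n * C) \<longlonglongrightarrow> (\<delta>\<^sup>2 / 2 + 0 * C) * total_variance + 0 * C"
    by (intro tendsto_intros \<epsilon>_lim)
  ultimately have "\<bar>expectation (\<lambda>\<omega>. indicator A \<omega> * sin (\<delta> * discounted T \<omega> + c))
      - expectation (\<lambda>\<omega>. indicator A \<omega> * sin (\<delta> * discounted s \<omega> + c))\<bar> \<le> (\<delta>\<^sup>2 / 2 + 0 * C) * total_variance + 0 * C"
    by (rule LIMSEQ_le) (use le in blast)
  then show ?thesis by simp
qed

lemma discounted_continuous:
  assumes "good_path \<omega>" shows "continuous_on {0..S} (\<lambda>t. discounted t \<omega>)"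
proof -
  have cr: "continuous_on {0..} (\<lambda>t. r t \<omega>)" and cu: "continuous_on {0..} (\<lambda>t. u t \<omega>)"
    using assms by (auto simp: good_path_def)
  have cz: "continuous_on {0..} (\<lambda>t. z t \<omega>)" unfolding z_def by (rule continuous_on_LINT[OF cr])
  have sub: "{0..S} \<subseteq> {0..}" by auto
  have "continuous_on {0..S} (\<lambda>t. (\<lambda>(t, x, y). G t x y) (t, r t \<omega>, u t \<omega>))"
    by (rule continuous_on_compose2[OF G_cont])
      (auto intro!: continuous_intros continuous_on_subset[OF cr sub] continuous_on_subset[OF cu sub])
  then show ?thesis
    unfolding discounted_def by (intro continuous_intros continuous_on_subset[OF cz sub]) simp
qed

text \<open>The bound does not depend on \<open>T < S\<close> and the sine is bounded, so maturity is reached by continuity of \<open>G\<close>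
  up to time \<open>S\<close>; the derivatives of \<open>G\<close> may blow up there.\<close>

lemma sin_discounted_increment:
  assumes st: "0 \<le> s" "s \<le> t" "t \<le> S" and A: "A \<in> sets (Fil s)"
  shows "\<bar>expectation (\<lambda>\<omega>. indicator A \<omega> * sin (\<delta> * discounted t \<omega> + c))
      - expectation (\<lambda>\<omega>. indicator A \<omega> * sin (\<delta> * discounted s \<omega> + c))\<bar> \<le> \<delta>\<^sup>2 / 2 * total_variance"
proof -
  consider "t < S" | "s = t" | "s < S" "t = S" using st by linarith
  then show ?thesis
  proof cases
    case 1
    then show ?thesis using sin_discounted_increment_before_maturity st A by blast
  next
    case 2
    then show ?thesis using total_variance_nonneg by simp
  next
    case 3
    have A_M [measurable]: "A \<in> sets M" by (rule sets_Fil_subset[OF A])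
    define v where "v n = S - (S - s) * inverse (real (Suc n))" for n
    have inv: "0 < inverse (real (Suc n))" "inverse (real (Suc n)) \<le> 1" for n
      by (auto intro: inverse_le_1_iff[THEN iffD2])
    have v: "s \<le> v n" "v n < S" for n
    proof -
      have "(S - s) * inverse (real (Suc n)) \<le> (S - s) * 1" using inv[of n] 3 by (intro mult_left_mono) auto
      then show "s \<le> v n" by (simp add: v_def)
      have "0 < (S - s) * inverse (real (Suc n))" using inv(1)[of n] 3 by (intro mult_pos_pos) auto
      then show "v n < S" by (simp add: v_def)
    qed
    have "v \<longlonglongrightarrow> S - (S - s) * 0" unfolding v_def by (intro tendsto_intros LIMSEQ_inverse_real_of_nat)
    then have v_lim: "v \<longlonglongrightarrow> S" by simp
    have "(\<lambda>n. expectation (\<lambda>\<omega>. indicator A \<omega> * sin (\<delta> * discounted (v n) \<omega> + c)))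
        \<longlonglongrightarrow> expectation (\<lambda>\<omega>. indicator A \<omega> * sin (\<delta> * discounted S \<omega> + c))"
    proof (rule integral_dominated_convergence[where w = "\<lambda>_. 1"])
      have [measurable]: "discounted S \<in> borel_measurable M" "discounted (v n) \<in> borel_measurable M" for n
        using v[of n] st S by (auto intro!: discounted_measurable)
      show "(\<lambda>\<omega>. indicator A \<omega> * sin (\<delta> * discounted S \<omega> + c)) \<in> borel_measurable M"
        "(\<lambda>\<omega>. indicator A \<omega> * sin (\<delta> * discounted (v n) \<omega> + c)) \<in> borel_measurable M" for n
        by measurable
      show "AE \<omega> in M. (\<lambda>n. indicator A \<omega> * sin (\<delta> * discounted (v n) \<omega> + c)) \<longlonglongrightarrow> indicator A \<omega> * sin (\<delta> * discounted S \<omega> + c)"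
        using AE_good_path
      proof eventually_elim
        case (elim \<omega>)
        have "(\<lambda>n. discounted (v n) \<omega>) \<longlonglongrightarrow> discounted S \<omega>"
        proof (rule continuous_on_tendsto_compose[OF discounted_continuous[OF elim] v_lim])
          show "\<forall>\<^sub>F n in sequentially. v n \<in> {0..S}"
            using v st by (intro always_eventually allI) (auto intro: order_trans less_imp_le)
        qed (use S in auto)
        then show ?case by (intro tendsto_intros)
      qed
      show "AE \<omega> in M. norm (indicator A \<omega> * sin (\<delta> * discounted (v n) \<omega> + c)) \<le> 1" for n
        by (intro AE_I2) (simp add: indicator_def)
    qed simp
    then have "(\<lambda>n. \<bar>expectation (\<lambda>\<omega>. indicator A \<omega> * sin (\<delta> * discounted (v n) \<omega> + c))
        - expectation (\<lambda>\<omega>. indicator A \<omega> * sin (\<delta> * discounted s \<omega> + c))\<bar>)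
      \<longlonglongrightarrow> \<bar>expectation (\<lambda>\<omega>. indicator A \<omega> * sin (\<delta> * discounted S \<omega> + c))
        - expectation (\<lambda>\<omega>. indicator A \<omega> * sin (\<delta> * discounted s \<omega> + c))\<bar>"
      by (intro tendsto_rabs tendsto_diff tendsto_const)
    then have "\<bar>expectation (\<lambda>\<omega>. indicator A \<omega> * sin (\<delta> * discounted S \<omega> + c))
        - expectation (\<lambda>\<omega>. indicator A \<omega> * sin (\<delta> * discounted s \<omega> + c))\<bar> \<le> \<delta>\<^sup>2 / 2 * total_variance"
      by (rule LIMSEQ_le_const2) (use sin_discounted_increment_before_maturity[OF st(1) v(1,2) A] in blast)
    then show ?thesis using 3 by simp
  qed
qed

lemma tendsto_sin_quotient:
  fixes v :: real
  assumes "h \<longlonglongrightarrow> 0" "\<And>n. h n \<noteq> 0"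
  shows "(\<lambda>n::nat. sin (h n * v) / h n) \<longlonglongrightarrow> v"
proof -
  have "((\<lambda>x. sin (x * v)) has_real_derivative v) (at 0)" by (auto intro!: derivative_eq_intros)
  then have "(\<lambda>x. sin (x * v) / x) \<midarrow>0\<rightarrow> v" by (simp add: DERIV_def)
  then show ?thesis
    by (rule filterlim_compose) (use assms in \<open>auto simp: filterlim_at\<close>)
qed

text \<open>With \<open>c = \<pi> / 2\<close> the previous bound controls the cosine. Dividing \<open>1 - cos (2 h v) = 2 (sin (h v))\<^sup>2\<close> by \<open>2 h\<^sup>2\<close>
  and letting \<open>h \<longlonglongrightarrow> 0\<close> gives the second moment, by Fatou's lemma.\<close>

lemma discounted_L2:
  assumes t: "0 \<le> t" "t \<le> S"
  shows "integrable M (\<lambda>\<omega>. (discounted t \<omega>)\<^sup>2)"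
proof -
  note [measurable] = discounted_measurable[OF t] discounted_measurable[OF order_refl less_imp_le[OF S]]
  define h where "h n = inverse (real (Suc n))" for n
  have h: "0 < h n" for n by (simp add: h_def)
  have h_lim: "h \<longlonglongrightarrow> 0" unfolding h_def by (rule LIMSEQ_inverse_real_of_nat)
  let ?v = "G 0 r0 0"
  have sq: "(sin (h n * v) / h n)\<^sup>2 = (1 - sin (2 * h n * v + pi / 2)) / (2 * (h n)\<^sup>2)" for n v
  proof -
    have "sin (2 * h n * v + pi / 2) = cos (2 * (h n * v))" by (simp add: sin_add mult.assoc)
    then show ?thesis using h[of n] by (simp add: cos_double_sin power_divide)
  qed
  have bound: "expectation (\<lambda>\<omega>. (sin (h n * discounted t \<omega>) / h n)\<^sup>2) \<le> ?v\<^sup>2 + total_variance" for n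
  proof -
    let ?E = "\<lambda>t. expectation (\<lambda>\<omega>. sin (2 * h n * discounted t \<omega> + pi / 2))"
    have int: "integrable M (\<lambda>\<omega>. sin (2 * h n * discounted t \<omega> + pi / 2))"
      by (rule integrable_const_bound[where B = 1]) auto
    have "space M \<in> sets (Fil 0)" by (metis sets.top space_Fil)
    from sin_discounted_increment[OF order_refl t this, of "2 * h n" "pi / 2"]
    have inc: "?E 0 - ?E t \<le> (2 * h n)\<^sup>2 / 2 * total_variance"
      by (simp add: indicator_def cong: Bochner_Integration.integral_cong)
    have "?E 0 = expectation (\<lambda>\<omega>. sin (2 * h n * ?v + pi / 2))"
      using discounted_0 by (intro integral_cong_AE) auto
    then have E0: "?E 0 = sin (2 * h n * ?v + pi / 2)" by (simp add: prob_space)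
    have "expectation (\<lambda>\<omega>. (sin (h n * discounted t \<omega>) / h n)\<^sup>2) = (1 - ?E t) / (2 * (h n)\<^sup>2)"
      unfolding sq using int by (simp add: prob_space)
    also have "\<dots> \<le> (1 - ?E 0 + (2 * h n)\<^sup>2 / 2 * total_variance) / (2 * (h n)\<^sup>2)"
      using inc by (intro divide_right_mono) auto
    also have "\<dots> = (sin (h n * ?v) / h n)\<^sup>2 + total_variance"
      unfolding sq E0 using h[of n] by (simp add: add_divide_distrib power_mult_distrib)
    also have "(sin (h n * ?v) / h n)\<^sup>2 \<le> ?v\<^sup>2"
    proof -
      have "\<bar>sin (h n * ?v)\<bar> \<le> \<bar>h n * ?v\<bar>" by (rule abs_sin_x_le_abs_x)
      then have "\<bar>sin (h n * ?v) / h n\<bar> \<le> \<bar>?v\<bar>" using h[of n] by (simp add: abs_mult divide_le_eq mult.commute)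
      then show ?thesis by (rule abs_le_square_iff[THEN iffD1])
    qed
    finally show ?thesis by simp
  qed
  show ?thesis
  proof (rule integrableI_bounded)
    have "(\<integral>\<^sup>+\<omega>. ennreal (norm ((discounted t \<omega>)\<^sup>2)) \<partial>M) = (\<integral>\<^sup>+\<omega>. liminf (\<lambda>n. ennreal ((sin (h n * discounted t \<omega>) / h n)\<^sup>2)) \<partial>M)"
    proof (rule nn_integral_cong)
      fix \<omega>
      have "(\<lambda>n. ennreal ((sin (h n * discounted t \<omega>) / h n)\<^sup>2)) \<longlonglongrightarrow> ennreal ((discounted t \<omega>)\<^sup>2)"
        using h by (intro tendsto_ennrealI tendsto_power tendsto_sin_quotient h_lim) (simp add: less_imp_neq[THEN not_sym])
      from lim_imp_Liminf[OF _ this] show "ennreal (norm ((discounted t \<omega>)\<^sup>2)) = liminf (\<lambda>n. ennreal ((sin (h n * discounted t \<omega>) / h n)\<^sup>2))" by simp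
    qed
    also have "\<dots> \<le> liminf (\<lambda>n. \<integral>\<^sup>+\<omega>. ennreal ((sin (h n * discounted t \<omega>) / h n)\<^sup>2) \<partial>M)"
      by (intro nn_integral_liminf) measurable
    also have "\<dots> \<le> liminf (\<lambda>n::nat. ennreal (?v\<^sup>2 + total_variance))"
    proof (intro Liminf_mono always_eventually allI)
      fix n
      have "integrable M (\<lambda>\<omega>. (sin (h n * discounted t \<omega>) / h n)\<^sup>2)"
        unfolding sq by (intro integrable_divide_zero Bochner_Integration.integrable_diff integrable_const integrable_const_bound[where B = 1]) auto
      then have "(\<integral>\<^sup>+\<omega>. ennreal ((sin (h n * discounted t \<omega>) / h n)\<^sup>2) \<partial>M) = ennreal (expectation (\<lambda>\<omega>. (sin (h n * discounted t \<omega>) / h n)\<^sup>2))"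
        by (intro nn_integral_eq_integral) auto
      also have "\<dots> \<le> ennreal (?v\<^sup>2 + total_variance)" by (rule ennreal_leI[OF bound])
      finally show "(\<integral>\<^sup>+\<omega>. ennreal ((sin (h n * discounted t \<omega>) / h n)\<^sup>2) \<partial>M) \<le> ennreal (?v\<^sup>2 + total_variance)" .
    qed
    also have "\<dots> < \<infinity>" by (simp add: Liminf_const)
    finally show "(\<integral>\<^sup>+\<omega>. ennreal (norm ((discounted t \<omega>)\<^sup>2)) \<partial>M) < \<infinity>" .
  qed measurable
qed

lemma discounted_integrable: "0 \<le> t \<Longrightarrow> t \<le> S \<Longrightarrow> integrable M (discounted t)"
  by (rule square_integrable_imp_integrable[OF discounted_measurable discounted_L2])

text \<open>\<open>sin (h v) / h\<close> tends to \<open>v\<close> and is dominated by \<open>\<bar>v\<bar>\<close>, while the error \<open>h\<^sup>2 / 2 * total_variance\<close> divided by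
  \<open>h\<close> tends to \<open>0\<close>.\<close>

lemma discounted_martingale:
  assumes st: "0 \<le> s" "s \<le> t" "t \<le> S" and A: "A \<in> sets (Fil s)"
  shows "expectation (\<lambda>\<omega>. indicator A \<omega> * discounted t \<omega>) = expectation (\<lambda>\<omega>. indicator A \<omega> * discounted s \<omega>)"
proof -
  have A_M [measurable]: "A \<in> sets M" by (rule sets_Fil_subset[OF A])
  define h where "h n = inverse (real (Suc n))" for n
  have h: "0 < h n" for n by (simp add: h_def)
  have h_lim: "h \<longlonglongrightarrow> 0" unfolding h_def by (rule LIMSEQ_inverse_real_of_nat)
  define E where "E n t = expectation (\<lambda>\<omega>. indicator A \<omega> * (sin (h n * discounted t \<omega>) / h n))" for n t
  have lim: "(\<lambda>n. E n t) \<longlonglongrightarrow> expectation (\<lambda>\<omega>. indicator A \<omega> * discounted t \<omega>)" if t: "0 \<le> t" "t \<le> S" for t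
    unfolding E_def
  proof (rule integral_dominated_convergence[where w = "\<lambda>\<omega>. \<bar>discounted t \<omega>\<bar>"])
    note [measurable] = discounted_measurable[OF t]
    show "(\<lambda>\<omega>. indicator A \<omega> * discounted t \<omega>) \<in> borel_measurable M"
      "(\<lambda>\<omega>. indicator A \<omega> * (sin (h n * discounted t \<omega>) / h n)) \<in> borel_measurable M" for n by measurable
    show "integrable M (\<lambda>\<omega>. \<bar>discounted t \<omega>\<bar>)" using discounted_integrable[OF t] by simp
    show "AE \<omega> in M. (\<lambda>n. indicator A \<omega> * (sin (h n * discounted t \<omega>) / h n)) \<longlonglongrightarrow> indicator A \<omega> * discounted t \<omega>"
      using h by (intro AE_I2 tendsto_mult tendsto_const tendsto_sin_quotient h_lim) (simp add: less_imp_neq[THEN not_sym])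
    show "AE \<omega> in M. norm (indicator A \<omega> * (sin (h n * discounted t \<omega>) / h n)) \<le> \<bar>discounted t \<omega>\<bar>" for n
    proof (rule AE_I2)
      fix \<omega>
      have "\<bar>sin (h n * discounted t \<omega>)\<bar> \<le> \<bar>h n * discounted t \<omega>\<bar>" by (rule abs_sin_x_le_abs_x)
      then have "\<bar>sin (h n * discounted t \<omega>) / h n\<bar> \<le> \<bar>discounted t \<omega>\<bar>" using h[of n] by (simp add: abs_mult divide_le_eq mult.commute)
      then show "norm (indicator A \<omega> * (sin (h n * discounted t \<omega>) / h n)) \<le> \<bar>discounted t \<omega>\<bar>"
        by (simp add: indicator_def)
    qed
  qed
  have le: "\<bar>E n t - E n s\<bar> \<le> h n / 2 * total_variance" for n
  proof -
    have "E n v = expectation (\<lambda>\<omega>. indicator A \<omega> * sin (h n * discounted v \<omega> + 0)) / h n" for v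
      unfolding E_def by (simp flip: Bochner_Integration.integral_divide_zero)
    then have "\<bar>E n t - E n s\<bar> = \<bar>expectation (\<lambda>\<omega>. indicator A \<omega> * sin (h n * discounted t \<omega> + 0))
        - expectation (\<lambda>\<omega>. indicator A \<omega> * sin (h n * discounted s \<omega> + 0))\<bar> / h n"
      using h[of n] by (simp flip: diff_divide_distrib)
    also have "\<dots> \<le> ((h n)\<^sup>2 / 2 * total_variance) / h n"
      using h[of n] by (intro divide_right_mono sin_discounted_increment[OF st A]) auto
    also have "\<dots> = h n / 2 * total_variance" using h[of n] by (simp add: power2_eq_square)
    finally show ?thesis .
  qed
  have "(\<lambda>n. \<bar>E n t - E n s\<bar>) \<longlonglongrightarrow> \<bar>expectation (\<lambda>\<omega>. indicator A \<omega> * discounted t \<omega>) - expectation (\<lambda>\<omega>. indicator A \<omega> * discounted s \<omega>)\<bar>"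
    using st by (intro tendsto_rabs tendsto_diff lim) auto
  moreover have "(\<lambda>n. h n / 2 * total_variance) \<longlonglongrightarrow> 0 / 2 * total_variance"
    by (intro tendsto_intros h_lim) simp
  ultimately have "\<bar>expectation (\<lambda>\<omega>. indicator A \<omega> * discounted t \<omega>) - expectation (\<lambda>\<omega>. indicator A \<omega> * discounted s \<omega>)\<bar> \<le> 0 / 2 * total_variance"
    by (rule LIMSEQ_le) (use le in blast)
  then show ?thesis by simp
qed

lemma exp_z_L2:
  assumes t: "0 \<le> t" "t \<le> S" shows "integrable M (\<lambda>\<omega>. (exp (z t \<omega>))\<^sup>2)"
proof -
  obtain C where C: "0 \<le> C" "\<forall>\<omega> \<Lambda>. good_path \<omega> \<longrightarrow> (\<forall>t\<in>{0..S}. \<bar>W t \<omega>\<bar> \<le> \<Lambda>) \<longrightarrow>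
      (\<forall>t\<in>{0..S}. \<bar>r t \<omega>\<bar> \<le> C * (1 + \<Lambda>) \<and> \<bar>z t \<omega>\<bar> \<le> C * (1 + \<Lambda>) \<and> \<bar>drift t (r t \<omega>) (u t \<omega>)\<bar> \<le> C * (1 + \<Lambda>))"
    by (rule path_bound)
  obtain \<Lambda> where \<Lambda>: "\<Lambda> \<in> borel_measurable M" "AE \<omega> in M. \<forall>t\<in>{0..S}. \<bar>W t \<omega>\<bar> \<le> \<Lambda> \<omega>"
    "\<forall>c\<ge>0. integrable M (\<lambda>\<omega>. exp (c * \<Lambda> \<omega>))"
    by (rule running_sup_exp_moments)
  have z: "z t \<in> borel_measurable M" by (rule measurable_from_Fil[OF adapted(3)[OF t(1)]])
  show ?thesis
  proof (rule Bochner_Integration.integrable_bound[of M "\<lambda>\<omega>. exp (2 * C) * exp (2 * C * \<Lambda> \<omega>)"])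
    show "integrable M (\<lambda>\<omega>. exp (2 * C) * exp (2 * C * \<Lambda> \<omega>))" using \<Lambda>(3) C(1) by simp
    show "AE \<omega> in M. norm ((exp (z t \<omega>))\<^sup>2) \<le> norm (exp (2 * C) * exp (2 * C * \<Lambda> \<omega>))"
      using AE_good_path \<Lambda>(2)
    proof eventually_elim
      case (elim \<omega>)
      have "t \<in> {0..S}" using t by simp
      then have "\<bar>z t \<omega>\<bar> \<le> C * (1 + \<Lambda> \<omega>)" using C(2) elim by blast
      then have "2 * z t \<omega> \<le> 2 * C + 2 * C * \<Lambda> \<omega>" by (simp add: algebra_simps)
      then show ?case by (simp add: exp_double[symmetric] exp_add[symmetric])
    qed
  qed (use z in simp)
qed

text \<open>The payoff discounted to time \<open>t\<close> is \<open>exp (z t)\<close> times the discounted value at maturity. Both factors are square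
  integrable, so the factor known at time \<open>t\<close> may be taken out of the conditional expectation.\<close>

lemma conditional_discounted_payoff:
  assumes t: "0 \<le> t" "t \<le> S" and g: "\<forall>x y. G S x y = g x y"
  shows "integrable M (\<lambda>\<omega>. exp (- (LINT s:{t..S}|lborel. r s \<omega>)) * g (r S \<omega>) (u S \<omega>))"
    and "AE \<omega> in M. real_cond_exp M (Fil t) (\<lambda>\<omega>'. exp (- (LINT s:{t..S}|lborel. r s \<omega>')) * g (r S \<omega>') (u S \<omega>')) \<omega> = G t (r t \<omega>) (u t \<omega>)"
proof -
  let ?f = "\<lambda>\<omega>. exp (- (LINT s:{t..S}|lborel. r s \<omega>)) * g (r S \<omega>) (u S \<omega>)"
  let ?h = "\<lambda>\<omega>. exp (z t \<omega>) * discounted S \<omega>"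
  have S0: "0 \<le> S" using S by simp
  interpret fm: finite_measure_subalgebra M "Fil t"
    by unfold_locales (rule Fil_subalgebra)
  have eq: "AE \<omega> in M. ?h \<omega> = ?f \<omega>"
    using AE_good_path
  proof eventually_elim
    case (elim \<omega>)
    then have c: "continuous_on {0..} (\<lambda>t. r t \<omega>)" by (simp add: good_path_def)
    have "z S \<omega> = z t \<omega> + (LINT s:{t..S}|lborel. r s \<omega>)"
      unfolding z_def by (rule LINT_combine[OF c t])
    then show ?case using g by (simp add: discounted_def mult.assoc[symmetric] exp_add[symmetric])
  qed
  have z_t: "z t \<in> borel_measurable (Fil t)" by (rule adapted(3)[OF t(1)])
  have z_M: "z t \<in> borel_measurable M" by (rule measurable_from_Fil[OF z_t])
  have h_S: "?h \<in> borel_measurable (Fil S)"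
    using Fil_measurable_mono[OF z_t t(2)] discounted_adapted[OF S0 order_refl] by simp
  have f_M: "?f \<in> borel_measurable M"
    by (rule measurable_from_Fil[OF Fil_measurable_AE_eq[OF h_S eq]])
  have h_M: "?h \<in> borel_measurable M" by (rule measurable_from_Fil[OF h_S])
  have h_int: "integrable M ?h"
    using z_M by (intro integrable_mult_L2 exp_z_L2[OF t] discounted_L2 discounted_measurable) (use S0 in auto)
  show "integrable M ?f" using h_int by (subst integrable_cong_AE[OF f_M h_M]) (use eq in auto)
  have ce: "AE \<omega> in M. real_cond_exp M (Fil t) (discounted S) \<omega> = discounted t \<omega>"
  proof (rule fm.real_cond_exp_charact)
    show "set_lebesgue_integral M A (discounted S) = set_lebesgue_integral M A (discounted t)" if "A \<in> sets (Fil t)" for A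
      using discounted_martingale[OF t order_refl that] by (simp add: set_lebesgue_integral_def)
    show "integrable M (discounted S)" "integrable M (discounted t)" using discounted_integrable t S0 by auto
    show "discounted t \<in> borel_measurable (Fil t)" by (rule discounted_adapted[OF t])
  qed
  have "AE \<omega> in M. real_cond_exp M (Fil t) ?h \<omega> = exp (z t \<omega>) * real_cond_exp M (Fil t) (discounted S) \<omega>"
    by (rule fm.real_cond_exp_mult) (use z_t discounted_measurable[OF S0 order_refl] h_int in auto)
  moreover have "AE \<omega> in M. real_cond_exp M (Fil t) ?h \<omega> = real_cond_exp M (Fil t) ?f \<omega>"
    by (rule fm.real_cond_exp_cong[OF eq h_M f_M])
  ultimately show "AE \<omega> in M. real_cond_exp M (Fil t) ?f \<omega> = G t (r t \<omega>) (u t \<omega>)"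
    using ce
  proof eventually_elim
    case (elim \<omega>)
    then show ?case by (simp add: discounted_def mult.assoc[symmetric] exp_add[symmetric])
  qed
qed

end

theorem proposition5p3:
  fixes M :: "'a measure"
    and W u Y Z r :: "real \<Rightarrow> 'a \<Rightarrow> real"
    and p q a b \<sigma> r0 S :: real
    and g :: "real \<Rightarrow> real \<Rightarrow> real"
    and G :: "real \<Rightarrow> real \<Rightarrow> real \<Rightarrow> real"
  assumes "prob_space M" and "complete_measure M"
    and "brownian_motion M W"
    and "0 < q" and "- q < p"
    and "0 < a" and "0 < b" and "0 < \<sigma>" and "0 \<le> r0" and "0 < S"
    and u_integral: "\<forall>t\<ge>0. has_ito_integral M (augmented_filtration M W) W t
          (\<lambda>s \<omega>. exp ((p + q) * s) * l_fun p q s) (u t)"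
    and u_paths: "continuous_paths M u"
    and Y_integral: "\<forall>s\<ge>0. has_ito_integral M (augmented_filtration M W) W s
          (\<lambda>\<tau> \<omega>. p * exp (- (p + q) * (s - \<tau>)) * l_fun p q \<tau>) (Y s)"
    and Y_paths: "continuous_paths M Y"
    and Z: "AE \<omega> in M. \<forall>t\<ge>0. Z t \<omega> = W t \<omega> - (LINT s:{0..t}|lborel. Y s \<omega>)"
    and r: "strong_solution M (augmented_filtration M W) Z a b \<sigma> r0 r"
    and g_cont: "continuous_on UNIV (\<lambda>(x, y). g x y)"
    and G_cont: "continuous_on ({0..S} \<times> UNIV \<times> UNIV) (\<lambda>(t, x, y). G t x y)"
    and G_C122: "C122_on S G"
    and G_pde: "\<forall>t\<in>{0..<S}. \<forall>x y. pd_t G t x y + L_op p q a b \<sigma> G t x y = 0"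
    and G_terminal: "\<forall>x y. G S x y = g x y"
    and G_square_integrable:
      "(\<integral>\<^sup>+t\<in>{0..<S}. (\<integral>\<^sup>+\<omega>. ennreal (exp (- 2 * (LINT s:{0..t}|lborel. r s \<omega>))
          * (Delta_op p q \<sigma> G t (r t \<omega>) (u t \<omega>))\<^sup>2) \<partial>M) \<partial>lborel) < \<infinity>"
  shows "\<forall>t\<in>{0..S}.
      integrable M (\<lambda>\<omega>. exp (- (LINT s:{t..S}|lborel. r s \<omega>)) * g (r S \<omega>) (u S \<omega>)) \<and>
      (AE \<omega> in M.
        real_cond_exp M (augmented_filtration M W t)
          (\<lambda>\<omega>'. exp (- (LINT s:{t..S}|lborel. r s \<omega>')) * g (r S \<omega>') (u S \<omega>')) \<omega>
        = G t (r t \<omega>) (u t \<omega>))"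
proof -
  have brownian: "brownian M W"
    using assms(1-3) by (simp add: brownian_def brownian_axioms_def)
  then interpret affine_model M W u Y Z r p q a b \<sigma> r0 S G
    by (rule affine_model.intro) (unfold_locales, use assms in auto)
  show ?thesis
  proof (intro ballI conjI)
    fix t assume "t \<in> {0..S}"
    then have t: "0 \<le> t" "t \<le> S" by auto
    show "integrable M (\<lambda>\<omega>. exp (- (LINT s:{t..S}|lborel. r s \<omega>)) * g (r S \<omega>) (u S \<omega>))"
      by (rule conditional_discounted_payoff(1)[OF t G_terminal])
    show "AE \<omega> in M. real_cond_exp M (Fil t)
        (\<lambda>\<omega>'. exp (- (LINT s:{t..S}|lborel. r s \<omega>')) * g (r S \<omega>') (u S \<omega>')) \<omega> = G t (r t \<omega>) (u t \<omega>)"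
      by (rule conditional_discounted_payoff(2)[OF t G_terminal])
  qed
qed

end
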